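(* Let $F$ be a countable field and let $R$ be the unital $F$-subalgebra of $T=\prod_{n=1}^\infty M_n(F)$ generated by $\mathrm{soc}(T)=\bigoplus_{n=1}^\infty M_n(F)$, the elements $w=(w_n)$ and $w^*=(w_n^* )$, and the inverses in $T$ of all elements $f(w)$ with $f\in F[x]$, $f(0)=1$, where $w_n,w_n^*\in M_n(F)$ are the matrices described in the context. Then $R$ is von Neumann regular, and $V(R)\cong\mathcal M$.
   Context: Construction of $w_n$, $w_n^*$. Let $f_0=1,f_1,f_2,\dots$ be an enumeration of $\Sigma=\{f\in F[x]\mid f(0)=1\}$, and set $F_i=f_0f_1\cdots f_i$. For each $k\ge 0$ let $N(k)=\deg F_k$ and let $(1,a_{k,1},\dots,a_{k,N(k)})$ be the row of coefficients of $F_k$, so $F_k=1+a_{k,1}x+\cdots+a_{k,N(k)}x^{N(k)}$. Choose positive integers $M(1)<M(2)<\cdots$ such that $M(k)\ge 2(k+1)N(k)$ for all $k\ge 1$. Write $e_{ij}$ for the standard matrix units. Put $w_1=w_1^*=0$, and for $n>1$ put $w_n=\sum_{i=1}^{n-1}e_{i+1,i}\in M_n(F)$. For $2\le n\le M(1)-1$ put $w_n^*=\sum_{i=1}^{n-1}e_{i,i+1}$. For $k\ge1$ and $M(k)\le n<M(k+1)$ put $$w_n^*=\sum_{i=1}^{n-1}e_{i,i+1}-\sum_{j=1}^{N(k)}a_{k,j}(e_{j1}+e_{n,n-j+1}).$$ (No involution is assumed; $w_n^*$ is just a name for this matrix.) Every $f(w)$ with $f\in\Sigma$ is invertible in $T$.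 For a unital ring $R$, $V(R)$ is the commutative monoid of isomorphism classes of finitely generated projective left $R$-modules with addition induced by direct sum. $\mathcal M$ is the commutative monoid presented by the generators $x_0,y_0,z_0,a_1,x_1,y_1,z_1,a_2,x_2,y_2,z_2,\dots$ and the relations $x_0+y_0=x_0+z_0$ and, for all $l\ge 0$, $y_l=y_{l+1}+a_{l+1}$, $z_l=z_{l+1}+a_{l+1}$, $x_l=x_{l+1}+y_{l+1}=x_{l+1}+z_{l+1}$. *)

theory Defs
  imports
    "Jordan_Normal_Form.Matrix"
    "HOL-Algebra.Embedded_Algebras"
    "HOL-Computational_Algebra.Polynomial"
    "HOL-Library.Countable_Set"
    "HOL-Library.FuncSet"
    "HOL-Library.Multiset"
begin

section \<open>Left modules over a not necessarily commutative ring\<close>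

text \<open>
  The locale \<open>module\<close> of HOL-Algebra requires a commutative ring of scalars. Its record
  type is reused here; its fields \<^const>\<open>monoid.mult\<close> and \<^const>\<open>monoid.one\<close> play no role
  for modules and are left unspecified.
\<close>

locale left_module = R?: ring R + M?: abelian_group M
  for R :: "('r, 's) ring_scheme" (structure) and M :: "('r, 'm) module" (structure) +
  assumes smult_closed:
      "\<lbrakk>a \<in> carrier R; x \<in> carrier M\<rbrakk> \<Longrightarrow> a \<odot>\<^bsub>M\<^esub> x \<in> carrier M"
    and smult_l_distr:
      "\<lbrakk>a \<in> carrier R; b \<in> carrier R; x \<in> carrier M\<rbrakk> \<Longrightarrow>
         (a \<oplus>\<^bsub>R\<^esub> b) \<odot>\<^bsub>M\<^esub> x = a \<odot>\<^bsub>M\<^esub> x \<oplus>\<^bsub>M\<^esub> b \<odot>\<^bsub>M\<^esub> x"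
    and smult_r_distr:
      "\<lbrakk>a \<in> carrier R; x \<in> carrier M; y \<in> carrier M\<rbrakk> \<Longrightarrow>
         a \<odot>\<^bsub>M\<^esub> (x \<oplus>\<^bsub>M\<^esub> y) = a \<odot>\<^bsub>M\<^esub> x \<oplus>\<^bsub>M\<^esub> a \<odot>\<^bsub>M\<^esub> y"
    and smult_assoc:
      "\<lbrakk>a \<in> carrier R; b \<in> carrier R; x \<in> carrier M\<rbrakk> \<Longrightarrow>
         (a \<otimes>\<^bsub>R\<^esub> b) \<odot>\<^bsub>M\<^esub> x = a \<odot>\<^bsub>M\<^esub> (b \<odot>\<^bsub>M\<^esub> x)"
    and smult_one: "x \<in> carrier M \<Longrightarrow> \<one>\<^bsub>R\<^esub> \<odot>\<^bsub>M\<^esub> x = x"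

definition left_module_hom ::
  "('r, 's) ring_scheme \<Rightarrow> ('r, 'm) module \<Rightarrow> ('r, 'n) module \<Rightarrow> ('m \<Rightarrow> 'n) set" where
  "left_module_hom R M N =
     {h \<in> carrier M \<rightarrow> carrier N.
        (\<forall>x\<in>carrier M. \<forall>y\<in>carrier M. h (x \<oplus>\<^bsub>M\<^esub> y) = h x \<oplus>\<^bsub>N\<^esub> h y) \<and>
        (\<forall>a\<in>carrier R. \<forall>x\<in>carrier M. h (a \<odot>\<^bsub>M\<^esub> x) = a \<odot>\<^bsub>N\<^esub> h x)}"

definition left_module_isomorphic ::
  "('r, 's) ring_scheme \<Rightarrow> ('r, 'm) module \<Rightarrow> ('r, 'n) module \<Rightarrow> bool" where
  "left_module_isomorphic R M N \<longleftrightarrow>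
     (\<exists>h\<in>left_module_hom R M N. bij_betw h (carrier M) (carrier N))"

definition module_direct_sum ::
  "('r, 'm) module \<Rightarrow> ('r, 'n) module \<Rightarrow> ('r, 'm \<times> 'n) module" where
  "module_direct_sum M N =
     \<lparr>carrier = carrier M \<times> carrier N,
      monoid.mult = undefined, one = undefined,
      zero = (\<zero>\<^bsub>M\<^esub>, \<zero>\<^bsub>N\<^esub>),
      add = (\<lambda>(x, y) (x', y'). (x \<oplus>\<^bsub>M\<^esub> x', y \<oplus>\<^bsub>N\<^esub> y')),
      module.smult = (\<lambda>a (x, y). (a \<odot>\<^bsub>M\<^esub> x, a \<odot>\<^bsub>N\<^esub> y))\<rparr>"

definition free_left_module :: "('r, 's) ring_scheme \<Rightarrow> 'i set \<Rightarrow> ('r, 'i \<Rightarrow> 'r) module" where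
  "free_left_module R I =
     \<lparr>carrier = {v \<in> I \<rightarrow>\<^sub>E carrier R. finite {i \<in> I. v i \<noteq> \<zero>\<^bsub>R\<^esub>}},
      monoid.mult = undefined, one = undefined,
      zero = (\<lambda>i\<in>I. \<zero>\<^bsub>R\<^esub>),
      add = (\<lambda>u v. \<lambda>i\<in>I. u i \<oplus>\<^bsub>R\<^esub> v i),
      module.smult = (\<lambda>a v. \<lambda>i\<in>I. a \<otimes>\<^bsub>R\<^esub> v i)\<rparr>"

definition fin_gen_module :: "('r, 's) ring_scheme \<Rightarrow> ('r, 'm) module \<Rightarrow> bool" where
  "fin_gen_module R M \<longleftrightarrow>
     (\<exists>S \<subseteq> carrier M. finite S \<and>
        (\<forall>x\<in>carrier M. \<exists>r \<in> S \<rightarrow> carrier R. x = (\<Oplus>\<^bsub>M\<^esub>s\<in>S. r s \<odot>\<^bsub>M\<^esub> s)))"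

text \<open>
  Projective: a direct summand of a free module. Restricting the basis to the type of the
  elements of \<open>P\<close> loses nothing: \<open>P\<close> is a quotient of the free module on the set
  \<^term>\<open>carrier P\<close>, so if \<open>P\<close> is projective then it is a summand of that one, with the
  kernel of the quotient map as complement.
\<close>

definition projective_module :: "('r, 's) ring_scheme \<Rightarrow> ('r, 'm) module \<Rightarrow> bool" where
  "projective_module R P \<longleftrightarrow>
     (\<exists>(I :: 'm set) (Q :: ('r, 'm \<Rightarrow> 'r) module). left_module R Q \<and>
        left_module_isomorphic R (module_direct_sum P Q) (free_left_module R I))"

definition fgp_module :: "('r, 's) ring_scheme \<Rightarrow> ('r, 'm) module \<Rightarrow> bool" where
  "fgp_module R P \<longleftrightarrow> left_module R P \<and> fin_gen_module R P \<and> projective_module R P"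


section \<open>The monoid V(R)\<close>

text \<open>
  Isomorphism classes are taken among the modules whose elements are of type
  \<^typ>\<open>nat \<Rightarrow> 'r\<close>. Every finitely generated projective left module over \<open>R\<close>, of
  whatever element type, is isomorphic to such a module, namely to a submodule of
  \<^term>\<open>free_left_module R {..<n}\<close> for some \<open>n\<close>. In particular this provides a
  representative of the direct sum of two such modules.
\<close>

definition iso_class ::
  "('r, 's) ring_scheme \<Rightarrow> ('r, 'm) module \<Rightarrow> ('r, nat \<Rightarrow> 'r) module set" where
  "iso_class R M = {P. fgp_module R P \<and> left_module_isomorphic R M P}"

definition V_monoid :: "('r, 's) ring_scheme \<Rightarrow> ('r, nat \<Rightarrow> 'r) module set monoid" where
  "V_monoid R =
     \<lparr>carrier = {iso_class R P | P :: ('r, nat \<Rightarrow> 'r) module. fgp_module R P},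
      monoid.mult = (\<lambda>X Y. \<Union>P\<in>X. \<Union>Q\<in>Y. iso_class R (module_direct_sum P Q)),
      one = iso_class R (free_left_module R ({} :: nat set))\<rparr>"


section \<open>Commutative monoids given by generators and relations\<close>

inductive pres_cong ::
  "('g multiset \<times> 'g multiset) set \<Rightarrow> 'g multiset \<Rightarrow> 'g multiset \<Rightarrow> bool"
  for rels where
  rel: "(u, v) \<in> rels \<Longrightarrow> pres_cong rels u v"
| refl: "pres_cong rels u u"
| sym: "pres_cong rels u v \<Longrightarrow> pres_cong rels v u"
| trans: "pres_cong rels u v \<Longrightarrow> pres_cong rels v t \<Longrightarrow> pres_cong rels u t"
| add: "pres_cong rels u v \<Longrightarrow> pres_cong rels (u + t) (v + t)"

definition presented_comm_monoid ::
  "('g multiset \<times> 'g multiset) set \<Rightarrow> 'g multiset set monoid" where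
  "presented_comm_monoid rels =
     \<lparr>carrier = UNIV // {(u, v). pres_cong rels u v},
      monoid.mult = (\<lambda>U V. \<Union>u\<in>U. \<Union>v\<in>V. {t. pres_cong rels (u + v) t}),
      one = {t. pres_cong rels {#} t}\<rparr>"

text \<open>
  \<open>gen_x l\<close>, \<open>gen_y l\<close>, \<open>gen_z l\<close> are the generators $x_l, y_l, z_l$, whereas \<open>gen_a l\<close> is the
  generator $a_{l+1}$ (there is no $a_0$).
\<close>

datatype gen = gen_x nat | gen_y nat | gen_z nat | gen_a nat

definition M_relations :: "(gen multiset \<times> gen multiset) set" where
  "M_relations =
     {({#gen_x 0, gen_y 0#}, {#gen_x 0, gen_z 0#})}
     \<union> (\<Union>l. {({#gen_y l#}, {#gen_y (l + 1), gen_a l#}),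
              ({#gen_z l#}, {#gen_z (l + 1), gen_a l#}),
              ({#gen_x l#}, {#gen_x (l + 1), gen_y (l + 1)#}),
              ({#gen_x l#}, {#gen_x (l + 1), gen_z (l + 1)#})})"

definition M_monoid :: "gen multiset set monoid" where
  "M_monoid = presented_comm_monoid M_relations"


section \<open>The algebra R\<close>

definition von_neumann_regular :: "('r, 's) ring_scheme \<Rightarrow> bool" where
  "von_neumann_regular R \<longleftrightarrow>
     ring R \<and> (\<forall>a\<in>carrier R. \<exists>x\<in>carrier R. a = a \<otimes>\<^bsub>R\<^esub> x \<otimes>\<^bsub>R\<^esub> a)"

definition product_ring :: "'i set \<Rightarrow> ('i \<Rightarrow> ('r, 's) ring_scheme) \<Rightarrow> ('i \<Rightarrow> 'r) ring" where
  "product_ring I R =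
     \<lparr>carrier = (\<Pi>\<^sub>E i\<in>I. carrier (R i)),
      monoid.mult = (\<lambda>x y. \<lambda>i\<in>I. x i \<otimes>\<^bsub>R i\<^esub> y i),
      one = (\<lambda>i\<in>I. \<one>\<^bsub>R i\<^esub>),
      zero = (\<lambda>i\<in>I. \<zero>\<^bsub>R i\<^esub>),
      add = (\<lambda>x y. \<lambda>i\<in>I. x i \<oplus>\<^bsub>R i\<^esub> y i)\<rparr>"

definition T_ring :: "(nat \<Rightarrow> 'a::field mat) ring" where
  "T_ring = product_ring {1..} (\<lambda>n. ring_mat TYPE('a) n ())"

definition T_scalar :: "'a::field \<Rightarrow> nat \<Rightarrow> 'a mat" where
  "T_scalar c = (\<lambda>n\<in>{1..}. c \<cdot>\<^sub>m 1\<^sub>m n)"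

definition T_poly :: "'a::field poly \<Rightarrow> (nat \<Rightarrow> 'a mat) \<Rightarrow> nat \<Rightarrow> 'a mat" where
  "T_poly p t =
     (\<Oplus>\<^bsub>T_ring\<^esub>i\<in>{..degree p}. T_scalar (coeff p i) \<otimes>\<^bsub>T_ring\<^esub> t [^]\<^bsub>T_ring\<^esub> i)"

text \<open>The socle of $T$ is the direct sum of the matrix algebras.\<close>

definition T_soc :: "(nat \<Rightarrow> 'a::field mat) set" where
  "T_soc = {t \<in> carrier T_ring. finite {n \<in> {1..}. t n \<noteq> 0\<^sub>m n n}}"

definition Sigma_polys :: "'a::field poly set" where
  "Sigma_polys = {p. poly p 0 = 1}"

definition partial_prod :: "(nat \<Rightarrow> 'a::field poly) \<Rightarrow> nat \<Rightarrow> 'a poly" where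
  "partial_prod f k = (\<Prod>i\<le>k. f i)"

definition N_deg :: "(nat \<Rightarrow> 'a::field poly) \<Rightarrow> nat \<Rightarrow> nat" where
  "N_deg f k = degree (partial_prod f k)"

text \<open>
  The entry of the matrix unit $e_{ij}$ at position $(r,c)$. All indices count from 1,
  whereas those of \<^const>\<open>mat\<close> count from 0, hence the shifts by \<^const>\<open>Suc\<close> below.
\<close>

definition e_unit :: "nat \<Rightarrow> nat \<Rightarrow> nat \<Rightarrow> nat \<Rightarrow> 'a::field" where
  "e_unit i j r c = (if r = i \<and> c = j then 1 else 0)"

definition w_mat :: "nat \<Rightarrow> 'a::field mat" where
  "w_mat n = mat n n (\<lambda>(r, c). \<Sum>i\<in>{1..<n}. e_unit (i + 1) i (Suc r) (Suc c))"

definition wstar_level :: "(nat \<Rightarrow> nat) \<Rightarrow> nat \<Rightarrow> nat" where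
  "wstar_level M n = (THE k. 1 \<le> k \<and> M k \<le> n \<and> n < M (k + 1))"

text \<open>
  For \<open>n = 1\<close> the sum over $1 \le i \le n-1$ is empty, so \<^term>\<open>w_mat 1\<close> is the zero
  matrix, and so is \<^term>\<open>wstar_mat f M 1\<close> since \<open>M 1 > 1\<close> in the situation considered.
\<close>

definition wstar_mat :: "(nat \<Rightarrow> 'a::field poly) \<Rightarrow> (nat \<Rightarrow> nat) \<Rightarrow> nat \<Rightarrow> 'a mat" where
  "wstar_mat f M n =
     (if n < M 1
      then mat n n (\<lambda>(r, c). \<Sum>i\<in>{1..<n}. e_unit i (i + 1) (Suc r) (Suc c))
      else let k = wstar_level M n in
        mat n n (\<lambda>(r, c).
          (\<Sum>i\<in>{1..<n}. e_unit i (i + 1) (Suc r) (Suc c))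
          - (\<Sum>j\<in>{1..N_deg f k}. coeff (partial_prod f k) j *
               (e_unit j 1 (Suc r) (Suc c) + e_unit n (n - j + 1) (Suc r) (Suc c)))))"

definition w_elem :: "nat \<Rightarrow> 'a::field mat" where
  "w_elem = (\<lambda>n\<in>{1..}. w_mat n)"

definition wstar_elem :: "(nat \<Rightarrow> 'a::field poly) \<Rightarrow> (nat \<Rightarrow> nat) \<Rightarrow> nat \<Rightarrow> 'a mat" where
  "wstar_elem f M = (\<lambda>n\<in>{1..}. wstar_mat f M n)"

definition T_generated_subalgebra :: "(nat \<Rightarrow> 'a::field mat) set \<Rightarrow> (nat \<Rightarrow> 'a mat) set" where
  "T_generated_subalgebra G =
     \<Inter>{S. subring S T_ring \<and> subalgebra (range T_scalar) S T_ring \<and> G \<subseteq> S}"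

definition R_algebra ::
  "(nat \<Rightarrow> 'a::field poly) \<Rightarrow> (nat \<Rightarrow> nat) \<Rightarrow> (nat \<Rightarrow> 'a mat) ring" where
  "R_algebra f M = T_ring\<lparr>carrier := T_generated_subalgebra
     (T_soc \<union> {w_elem, wstar_elem f M} \<union>
      {inv\<^bsub>T_ring\<^esub> (T_poly p w_elem) | p. p \<in> Sigma_polys})\<rparr>"

end

theory Submission
  imports
    Defs
    "HOL-Combinatorics.Permutations"
    "HOL-Computational_Algebra.Polynomial_FPS"
    "Jordan_Normal_Form.Determinant"
begin

text \<open>
  Put $p = 1 - ww^*$ and $q = 1 - w^*w$, of rank one at every level. Modulo the socle of $T$,
  $Rp = F[x]_{(x)}(w)\,p$, $qR = q\,F[x]_{(x)}(w)$, $pR$ is spanned by the $p(w^*)^j$, $Rq$ by the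
  $(w^*)^jq$, and $pRq = qRp = 0$; the growth of $M$ is what forces $q\,g(w)\,p$ to vanish from some
  level on. Modulo the ideal $J = RpR + RqR$, which contains the socle, every element has the form
  $(w^*)^i g(w)$ with $g \in F[x]_{(x)}$, so it is zero or invertible. Elements of $J$ are annihilated
  by some $w^N$ acting on both sides modulo the socle, and induction on the two exponents
  gives regularity.

  For $V(R)$, the generators are represented by $x_l = [w^{l+1}(w^*)^{l+1}]$, by $p$, $q$ cut off to
  the levels $n > l$ for $y_l$, $z_l$, and by $p$ at level $l + 1$ for $a_{l+1}$. An idempotent $e \in J$ is
  a sum of terms $r_i g_i c_i$ with $g_i \in \{p, q\}$, which embeds $Re$ into a sum of modules $Rp$, $Rq$;
  over a regular ring a finitely generated submodule of such a sum is again a sum of modules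
  $Rh$ with $h$ an idempotent of $pRp$ or $qRq$, hence $h$ is $p$ or $q$ cut off to a finite or
  cofinite set of levels. An idempotent $e \notin J$ has $1 - e \in J$, so it
  contains a copy of some $w^l(w^*)^l$ with complement in $J$. Conversely an isomorphism class
  determines the rank at every level and, if no $x_l$ occurs, the number of $y$'s,
  because $pRq$ is zero modulo the socle; these numbers determine an element of $\mathcal M$.
\<close>

section \<open>Left modules\<close>

text \<open>If w* were the plain transposed shift, the only entry of q g(w) p would be the
  coefficient of x^(n-1) in g, which need not die out for a proper fraction g. The corrections turn
  p into F_k(w) e_11 and q into e_nn F_k(w), and that coefficient into the one of g F_k^2. Once the
  denominator of g divides F_k this series is a polynomial of degree at most 2 N(k) plus a constant,
  whence the need for 2 N(k) to stay below n by a growing margin. The opposite product p v^l q, with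
  v for w*, vanishes for a cruder reason: v has only one superdiagonal, so v^l does not connect the
  first index with the last one when n is large.

  At a single level p and q are both of rank one and equivalent, but no element of R realizes these
  equivalences at infinitely many levels. So ranks cannot tell y_l from z_l; an x_l removes the
  difference because the same idempotent splits off a copy of either, with complements of the same
  class.

  Relations that hold modulo the socle become exact behind a factor w^l, which is zero at the levels
  up to l. This produces honest idempotents of R from computations with germs.\<close>

lemma left_moduleI:
  fixes R :: "('r, 's) ring_scheme" and M :: "('r, 'm) module"
  assumes "ring R"
    and "\<And>x y. \<lbrakk>x \<in> carrier M; y \<in> carrier M\<rbrakk> \<Longrightarrow> x \<oplus>\<^bsub>M\<^esub> y \<in> carrier M"
    and "\<zero>\<^bsub>M\<^esub> \<in> carrier M"
    and "\<And>x y z. \<lbrakk>x \<in> carrier M; y \<in> carrier M; z \<in> carrier M\<rbrakk> \<Longrightarrow>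
           (x \<oplus>\<^bsub>M\<^esub> y) \<oplus>\<^bsub>M\<^esub> z = x \<oplus>\<^bsub>M\<^esub> (y \<oplus>\<^bsub>M\<^esub> z)"
    and "\<And>x y. \<lbrakk>x \<in> carrier M; y \<in> carrier M\<rbrakk> \<Longrightarrow> x \<oplus>\<^bsub>M\<^esub> y = y \<oplus>\<^bsub>M\<^esub> x"
    and "\<And>x. x \<in> carrier M \<Longrightarrow> \<zero>\<^bsub>M\<^esub> \<oplus>\<^bsub>M\<^esub> x = x"
    and "\<And>x. x \<in> carrier M \<Longrightarrow> \<exists>y\<in>carrier M. y \<oplus>\<^bsub>M\<^esub> x = \<zero>\<^bsub>M\<^esub>"
    and "\<And>a x. \<lbrakk>a \<in> carrier R; x \<in> carrier M\<rbrakk> \<Longrightarrow> a \<odot>\<^bsub>M\<^esub> x \<in> carrier M"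
    and "\<And>a b x. \<lbrakk>a \<in> carrier R; b \<in> carrier R; x \<in> carrier M\<rbrakk> \<Longrightarrow>
           (a \<oplus>\<^bsub>R\<^esub> b) \<odot>\<^bsub>M\<^esub> x = a \<odot>\<^bsub>M\<^esub> x \<oplus>\<^bsub>M\<^esub> b \<odot>\<^bsub>M\<^esub> x"
    and "\<And>a x y. \<lbrakk>a \<in> carrier R; x \<in> carrier M; y \<in> carrier M\<rbrakk> \<Longrightarrow>
           a \<odot>\<^bsub>M\<^esub> (x \<oplus>\<^bsub>M\<^esub> y) = a \<odot>\<^bsub>M\<^esub> x \<oplus>\<^bsub>M\<^esub> a \<odot>\<^bsub>M\<^esub> y"
    and "\<And>a b x. \<lbrakk>a \<in> carrier R; b \<in> carrier R; x \<in> carrier M\<rbrakk> \<Longrightarrow>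
           (a \<otimes>\<^bsub>R\<^esub> b) \<odot>\<^bsub>M\<^esub> x = a \<odot>\<^bsub>M\<^esub> (b \<odot>\<^bsub>M\<^esub> x)"
    and "\<And>x. x \<in> carrier M \<Longrightarrow> \<one>\<^bsub>R\<^esub> \<odot>\<^bsub>M\<^esub> x = x"
  shows "left_module R M"
proof -
  have "abelian_group M"
    by (rule abelian_groupI) (use assms in auto)
  then show ?thesis
    using assms by (intro left_module.intro left_module_axioms.intro) auto
qed

definition submodule_set :: "('r, 's) ring_scheme \<Rightarrow> ('r, 'm) module \<Rightarrow> 'm set \<Rightarrow> bool" where
  "submodule_set R M H \<longleftrightarrow> H \<subseteq> carrier M \<and> \<zero>\<^bsub>M\<^esub> \<in> H \<and>
     (\<forall>x\<in>H. \<forall>y\<in>H. x \<oplus>\<^bsub>M\<^esub> y \<in> H) \<and> (\<forall>a\<in>carrier R. \<forall>x\<in>H. a \<odot>\<^bsub>M\<^esub> x \<in> H)"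

context left_module
begin

lemma smult_l_zero: "x \<in> carrier M \<Longrightarrow> \<zero>\<^bsub>R\<^esub> \<odot>\<^bsub>M\<^esub> x = \<zero>\<^bsub>M\<^esub>"
  by (metis R.zero_closed R.l_zero M.add.r_cancel_one' smult_closed smult_l_distr)

lemma smult_r_zero: "a \<in> carrier R \<Longrightarrow> a \<odot>\<^bsub>M\<^esub> \<zero>\<^bsub>M\<^esub> = \<zero>\<^bsub>M\<^esub>"
  by (metis M.zero_closed M.l_zero M.add.r_cancel_one' smult_closed smult_r_distr)

lemma smult_l_minus: "\<lbrakk>a \<in> carrier R; x \<in> carrier M\<rbrakk> \<Longrightarrow> (\<ominus>\<^bsub>R\<^esub> a) \<odot>\<^bsub>M\<^esub> x = \<ominus>\<^bsub>M\<^esub> (a \<odot>\<^bsub>M\<^esub> x)"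
  by (metis M.minus_equality R.a_inv_closed R.l_neg smult_closed smult_l_distr smult_l_zero)

lemma minus_eq_smult: "x \<in> carrier M \<Longrightarrow> \<ominus>\<^bsub>M\<^esub> x = (\<ominus>\<^bsub>R\<^esub> \<one>\<^bsub>R\<^esub>) \<odot>\<^bsub>M\<^esub> x"
  by (simp add: smult_l_minus smult_one)

lemma smult_finsum:
  assumes "finite S" "g \<in> S \<rightarrow> carrier M" "a \<in> carrier R"
  shows "a \<odot>\<^bsub>M\<^esub> (\<Oplus>\<^bsub>M\<^esub>s\<in>S. g s) = (\<Oplus>\<^bsub>M\<^esub>s\<in>S. a \<odot>\<^bsub>M\<^esub> g s)"
  using assms
proof (induction S rule: finite_induct)
  case (insert s S)
  then have "g \<in> S \<rightarrow> carrier M" "g s \<in> carrier M" by auto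
  moreover from this insert.prems have "(\<lambda>s. a \<odot>\<^bsub>M\<^esub> g s) \<in> S \<rightarrow> carrier M"
    by (auto intro: smult_closed)
  ultimately show ?case
    using insert by (simp add: M.finsum_insert smult_closed smult_r_distr)
qed (simp add: smult_r_zero)

lemma submodule_set_finsum:
  assumes "submodule_set R M H" "finite S" "g \<in> S \<rightarrow> H"
  shows "(\<Oplus>\<^bsub>M\<^esub>s\<in>S. g s) \<in> H"
  using assms(2,3)
proof (induction S rule: finite_induct)
  case empty
  then show ?case using assms(1) by (simp add: submodule_set_def)
next
  case (insert s S)
  have "H \<subseteq> carrier M" using assms(1) by (simp add: submodule_set_def)
  then have "g \<in> S \<rightarrow> carrier M" "g s \<in> carrier M" using insert.prems by auto
  then show ?case using insert assms(1) by (simp add: M.finsum_insert submodule_set_def)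
qed

lemma submodule_set_span:
  assumes "S \<subseteq> carrier M" "finite S"
  shows "submodule_set R M {x. \<exists>r \<in> S \<rightarrow> carrier R. x = (\<Oplus>\<^bsub>M\<^esub>s\<in>S. r s \<odot>\<^bsub>M\<^esub> s)}" (is "submodule_set R M ?H")
    and "S \<subseteq> {x. \<exists>r \<in> S \<rightarrow> carrier R. x = (\<Oplus>\<^bsub>M\<^esub>s\<in>S. r s \<odot>\<^bsub>M\<^esub> s)}"
proof -
  have cl: "(\<lambda>s. r s \<odot>\<^bsub>M\<^esub> s) \<in> S \<rightarrow> carrier M" if "r \<in> S \<rightarrow> carrier R" for r
    using that assms by (auto intro!: smult_closed)
  show "submodule_set R M ?H"
    unfolding submodule_set_def
  proof (intro conjI ballI)
    show "?H \<subseteq> carrier M" using cl by (auto intro: M.finsum_closed)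
    have "\<zero>\<^bsub>M\<^esub> = (\<Oplus>\<^bsub>M\<^esub>s\<in>S. \<zero>\<^bsub>R\<^esub> \<odot>\<^bsub>M\<^esub> s)"
      using assms by (subst M.finsum_cong'[where g = "\<lambda>_. \<zero>\<^bsub>M\<^esub>" and B = S])
        (auto simp: smult_l_zero subset_iff)
    then show "\<zero>\<^bsub>M\<^esub> \<in> ?H" by (auto intro!: bexI[of _ "\<lambda>_. \<zero>\<^bsub>R\<^esub>"])
  next
    fix x y assume "x \<in> ?H" "y \<in> ?H"
    then obtain r r' where r: "r \<in> S \<rightarrow> carrier R" "x = (\<Oplus>\<^bsub>M\<^esub>s\<in>S. r s \<odot>\<^bsub>M\<^esub> s)"
      "r' \<in> S \<rightarrow> carrier R" "y = (\<Oplus>\<^bsub>M\<^esub>s\<in>S. r' s \<odot>\<^bsub>M\<^esub> s)" by blast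
    have "x \<oplus>\<^bsub>M\<^esub> y = (\<Oplus>\<^bsub>M\<^esub>s\<in>S. r s \<odot>\<^bsub>M\<^esub> s \<oplus>\<^bsub>M\<^esub> r' s \<odot>\<^bsub>M\<^esub> s)"
      using r cl by (simp add: M.finsum_addf)
    also have "\<dots> = (\<Oplus>\<^bsub>M\<^esub>s\<in>S. (r s \<oplus>\<^bsub>R\<^esub> r' s) \<odot>\<^bsub>M\<^esub> s)"
      using r assms(1) by (intro M.finsum_cong') (auto simp: smult_l_distr subset_iff Pi_iff intro!: smult_closed)
    finally show "x \<oplus>\<^bsub>M\<^esub> y \<in> ?H" using r by (auto intro!: bexI[of _ "\<lambda>s. r s \<oplus>\<^bsub>R\<^esub> r' s"])
  next
    fix a x assume a: "a \<in> carrier R" and "x \<in> ?H"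
    then obtain r where r: "r \<in> S \<rightarrow> carrier R" "x = (\<Oplus>\<^bsub>M\<^esub>s\<in>S. r s \<odot>\<^bsub>M\<^esub> s)" by blast
    have "a \<odot>\<^bsub>M\<^esub> x = (\<Oplus>\<^bsub>M\<^esub>s\<in>S. a \<odot>\<^bsub>M\<^esub> (r s \<odot>\<^bsub>M\<^esub> s))"
      using r a assms cl by (simp add: smult_finsum)
    also have "\<dots> = (\<Oplus>\<^bsub>M\<^esub>s\<in>S. (a \<otimes>\<^bsub>R\<^esub> r s) \<odot>\<^bsub>M\<^esub> s)"
      using r a assms(1) by (intro M.finsum_cong') (auto simp: smult_assoc subset_iff Pi_iff intro!: smult_closed)
    finally show "a \<odot>\<^bsub>M\<^esub> x \<in> ?H" using r a by (auto intro!: bexI[of _ "\<lambda>s. a \<otimes>\<^bsub>R\<^esub> r s"])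
  qed
  show "S \<subseteq> ?H"
  proof
    fix s assume s: "s \<in> S"
    have "(\<Oplus>\<^bsub>M\<^esub>t\<in>S. (if s = t then \<one>\<^bsub>R\<^esub> else \<zero>\<^bsub>R\<^esub>) \<odot>\<^bsub>M\<^esub> t) = (\<Oplus>\<^bsub>M\<^esub>t\<in>S. if s = t then t else \<zero>\<^bsub>M\<^esub>)"
      using assms by (intro M.finsum_cong') (auto simp: smult_one smult_l_zero subset_iff)
    also have "\<dots> = s" using s assms by (simp add: M.add.finprod_singleton subset_iff)
    finally show "s \<in> ?H"
      by (auto intro!: bexI[of _ "\<lambda>t. if s = t then \<one>\<^bsub>R\<^esub> else \<zero>\<^bsub>R\<^esub>"])
  qed
qed

text \<open>Linear combinations are indexed by a set, and a homomorphism may identify generators.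
  The description by submodules that contain the generators avoids any reindexing, since preimages
  of submodules are submodules.\<close>

lemma fin_gen_iff:
  "fin_gen_module R M \<longleftrightarrow>
     (\<exists>S\<subseteq>carrier M. finite S \<and> (\<forall>H. submodule_set R M H \<longrightarrow> S \<subseteq> H \<longrightarrow> carrier M \<subseteq> H))"
proof
  assume "fin_gen_module R M"
  then obtain S where S: "S \<subseteq> carrier M" "finite S"
    and gen: "\<forall>x\<in>carrier M. \<exists>r \<in> S \<rightarrow> carrier R. x = (\<Oplus>\<^bsub>M\<^esub>s\<in>S. r s \<odot>\<^bsub>M\<^esub> s)"
    by (auto simp: fin_gen_module_def)
  have "x \<in> H" if H: "submodule_set R M H" "S \<subseteq> H" and x: "x \<in> carrier M" for H x
  proof -
    obtain r where r: "r \<in> S \<rightarrow> carrier R" "x = (\<Oplus>\<^bsub>M\<^esub>s\<in>S. r s \<odot>\<^bsub>M\<^esub> s)" using gen x by blast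
    have "(\<lambda>s. r s \<odot>\<^bsub>M\<^esub> s) \<in> S \<rightarrow> H"       using r H unfolding submodule_set_def Pi_iff by (metis subsetD)
    then show ?thesis using submodule_set_finsum[OF H(1) S(2)] r by simp
  qed
  then show "\<exists>S\<subseteq>carrier M. finite S \<and> (\<forall>H. submodule_set R M H \<longrightarrow> S \<subseteq> H \<longrightarrow> carrier M \<subseteq> H)"
    using S by blast
next
  assume "\<exists>S\<subseteq>carrier M. finite S \<and> (\<forall>H. submodule_set R M H \<longrightarrow> S \<subseteq> H \<longrightarrow> carrier M \<subseteq> H)"
  then obtain S where S: "S \<subseteq> carrier M" "finite S"
    and gen: "\<And>H. submodule_set R M H \<Longrightarrow> S \<subseteq> H \<Longrightarrow> carrier M \<subseteq> H" by blast
  show "fin_gen_module R M"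
    unfolding fin_gen_module_def
    using S gen[OF submodule_set_span(1)[OF S] submodule_set_span(2)[OF S]] by (intro exI[of _ S]) auto
qed

end

lemma left_module_homD:
  assumes "h \<in> left_module_hom R M N"
  shows "x \<in> carrier M \<Longrightarrow> h x \<in> carrier N"
    and "\<lbrakk>x \<in> carrier M; y \<in> carrier M\<rbrakk> \<Longrightarrow> h (x \<oplus>\<^bsub>M\<^esub> y) = h x \<oplus>\<^bsub>N\<^esub> h y"
    and "\<lbrakk>a \<in> carrier R; x \<in> carrier M\<rbrakk> \<Longrightarrow> h (a \<odot>\<^bsub>M\<^esub> x) = a \<odot>\<^bsub>N\<^esub> h x"
  using assms by (auto simp: left_module_hom_def)

lemma left_module_homI:
  assumes "\<And>x. x \<in> carrier M \<Longrightarrow> h x \<in> carrier N"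
    and "\<And>x y. \<lbrakk>x \<in> carrier M; y \<in> carrier M\<rbrakk> \<Longrightarrow> h (x \<oplus>\<^bsub>M\<^esub> y) = h x \<oplus>\<^bsub>N\<^esub> h y"
    and "\<And>a x. \<lbrakk>a \<in> carrier R; x \<in> carrier M\<rbrakk> \<Longrightarrow> h (a \<odot>\<^bsub>M\<^esub> x) = a \<odot>\<^bsub>N\<^esub> h x"
  shows "h \<in> left_module_hom R M N"
  using assms by (auto simp: left_module_hom_def)

lemma left_module_hom_zero:
  assumes "left_module R M" "left_module R N" "h \<in> left_module_hom R M N"
  shows "h \<zero>\<^bsub>M\<^esub> = \<zero>\<^bsub>N\<^esub>"
proof -
  interpret M: left_module R M by fact
  interpret N: left_module R N by fact
  have "h (\<zero>\<^bsub>R\<^esub> \<odot>\<^bsub>M\<^esub> \<zero>\<^bsub>M\<^esub>) = \<zero>\<^bsub>R\<^esub> \<odot>\<^bsub>N\<^esub> h \<zero>\<^bsub>M\<^esub>"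
    using left_module_homD(3)[OF assms(3)] by simp
  then show ?thesis using left_module_homD(1)[OF assms(3)] by (simp add: M.smult_l_zero N.smult_l_zero)
qed

lemma left_module_isomorphicI:
  assumes "h \<in> left_module_hom R M N" "inj_on h (carrier M)"
    and "\<And>y. y \<in> carrier N \<Longrightarrow> \<exists>x\<in>carrier M. h x = y"
  shows "left_module_isomorphic R M N"
  unfolding left_module_isomorphic_def bij_betw_def
  using assms left_module_homD(1)[OF assms(1)] by (intro bexI[of _ h]) auto

lemma left_module_isomorphic_refl: "left_module_isomorphic R M M"
  by (rule left_module_isomorphicI[of "\<lambda>x. x"]) (auto intro: left_module_homI)

lemma left_module_hom_inverse:
  assumes "left_module R M" and h: "h \<in> left_module_hom R M N" "bij_betw h (carrier M) (carrier N)"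
  obtains k where "k \<in> left_module_hom R N M" "bij_betw k (carrier N) (carrier M)"
    "\<And>x. x \<in> carrier M \<Longrightarrow> k (h x) = x"
proof -
  interpret M: left_module R M by fact
  define k where "k = inv_into (carrier M) h"
  have k: "bij_betw k (carrier N) (carrier M)" using h(2) by (simp add: k_def bij_betw_inv_into)
  have kh: "k (h x) = x" if "x \<in> carrier M" for x
    using h(2) that by (simp add: k_def bij_betw_inv_into_left)
  have hk: "h (k y) = y" if "y \<in> carrier N" for y
    using h(2) that by (simp add: k_def bij_betw_inv_into_right)
  have kc: "k y \<in> carrier M" if "y \<in> carrier N" for y using k that by (auto simp: bij_betw_def)
  have "k \<in> left_module_hom R N M"
  proof (rule left_module_homI)
    fix x y assume "x \<in> carrier N" "y \<in> carrier N"
    then show "k (x \<oplus>\<^bsub>N\<^esub> y) = k x \<oplus>\<^bsub>M\<^esub> k y"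
      using kh[of "k x \<oplus>\<^bsub>M\<^esub> k y"] left_module_homD(2)[OF h(1), of "k x" "k y"] by (simp add: kc hk)
  next
    fix a x assume "a \<in> carrier R" "x \<in> carrier N"
    then show "k (a \<odot>\<^bsub>N\<^esub> x) = a \<odot>\<^bsub>M\<^esub> k x"
      using kh[of "a \<odot>\<^bsub>M\<^esub> k x"] left_module_homD(3)[OF h(1), of a "k x"]
      by (simp add: kc hk M.smult_closed)
  qed (rule kc)
  then show ?thesis using k kh by (rule that)
qed

lemma left_module_isomorphic_sym:
  assumes "left_module R M" "left_module_isomorphic R M N"
  shows "left_module_isomorphic R N M"
  using assms left_module_hom_inverse unfolding left_module_isomorphic_def by metis

lemma left_module_hom_comp:
  assumes "h \<in> left_module_hom R M N" "k \<in> left_module_hom R N P"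
  shows "k \<circ> h \<in> left_module_hom R M P"
  by (rule left_module_homI)
    (simp_all add: left_module_homD[OF assms(1)] left_module_homD[OF assms(2)])

lemma left_module_isomorphic_trans:
  assumes "left_module_isomorphic R M N" "left_module_isomorphic R N P"
  shows "left_module_isomorphic R M P"
proof -
  obtain h where h: "h \<in> left_module_hom R M N" "bij_betw h (carrier M) (carrier N)"
    using assms(1) by (auto simp: left_module_isomorphic_def)
  obtain k where k: "k \<in> left_module_hom R N P" "bij_betw k (carrier N) (carrier P)"
    using assms(2) by (auto simp: left_module_isomorphic_def)
  have "bij_betw (k \<circ> h) (carrier M) (carrier P)" using bij_betw_trans[OF h(2) k(2)] .
  then show ?thesis using left_module_hom_comp[OF h(1) k(1)] by (auto simp: left_module_isomorphic_def)
qed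

lemma left_module_direct_sum:
  assumes "left_module R M" "left_module R N"
  shows "left_module R (module_direct_sum M N)"
proof -
  interpret M: left_module R M by fact
  interpret N: left_module R N by fact
  show ?thesis
  proof (rule left_moduleI)
    fix x assume "x \<in> carrier (module_direct_sum M N)"
    then show "\<exists>y\<in>carrier (module_direct_sum M N). y \<oplus>\<^bsub>module_direct_sum M N\<^esub> x = \<zero>\<^bsub>module_direct_sum M N\<^esub>"
      by (intro bexI[of _ "(\<ominus>\<^bsub>M\<^esub> fst x, \<ominus>\<^bsub>N\<^esub> snd x)"])
        (auto simp: module_direct_sum_def M.M.l_neg N.M.l_neg)
  next
    fix x y assume "x \<in> carrier (module_direct_sum M N)" "y \<in> carrier (module_direct_sum M N)"
    then show "x \<oplus>\<^bsub>module_direct_sum M N\<^esub> y = y \<oplus>\<^bsub>module_direct_sum M N\<^esub> x"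
      by (auto simp: module_direct_sum_def M.M.a_comm N.M.a_comm)
  qed (auto simp: module_direct_sum_def M.M.a_assoc N.M.a_assoc M.R.ring_axioms
      M.smult_closed N.smult_closed M.smult_l_distr N.smult_l_distr M.smult_r_distr N.smult_r_distr
      M.smult_assoc N.smult_assoc M.smult_one N.smult_one)
qed

lemma module_direct_sum_cong:
  assumes "left_module_isomorphic R M M'" "left_module_isomorphic R N N'"
  shows "left_module_isomorphic R (module_direct_sum M N) (module_direct_sum M' N')"
proof -
  obtain h where h: "h \<in> left_module_hom R M M'" "bij_betw h (carrier M) (carrier M')"
    using assms(1) by (auto simp: left_module_isomorphic_def)
  obtain k where k: "k \<in> left_module_hom R N N'" "bij_betw k (carrier N) (carrier N')"
    using assms(2) by (auto simp: left_module_isomorphic_def)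
  have "map_prod h k \<in> left_module_hom R (module_direct_sum M N) (module_direct_sum M' N')"
    by (rule left_module_homI)
      (auto simp: module_direct_sum_def left_module_homD[OF h(1)] left_module_homD[OF k(1)])
  moreover have "bij_betw (map_prod h k) (carrier (module_direct_sum M N)) (carrier (module_direct_sum M' N'))"
    using bij_betw_map_prod[OF h(2) k(2)] by (simp add: module_direct_sum_def)
  ultimately show ?thesis by (auto simp: left_module_isomorphic_def)
qed

lemma fin_gen_surj:
  assumes "left_module R M" "left_module R N" "h \<in> left_module_hom R M N"
    and surj: "h ` carrier M = carrier N" and "fin_gen_module R M"
  shows "fin_gen_module R N"
proof -
  interpret M: left_module R M by fact
  interpret N: left_module R N by fact
  obtain S where S: "S \<subseteq> carrier M" "finite S"
    and gen: "\<And>H. submodule_set R M H \<Longrightarrow> S \<subseteq> H \<Longrightarrow> carrier M \<subseteq> H"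
    using assms(5) M.fin_gen_iff by blast
  have "carrier N \<subseteq> H" if H: "submodule_set R N H" "h ` S \<subseteq> H" for H
  proof -
    have "submodule_set R M {x \<in> carrier M. h x \<in> H}"
      using H(1) left_module_homD[OF assms(3)] left_module_hom_zero[OF assms(1-3)]
      by (auto simp: submodule_set_def M.smult_closed)
    from gen[OF this] H(2) S(1) have "carrier M \<subseteq> {x \<in> carrier M. h x \<in> H}" by auto
    then have "h ` carrier M \<subseteq> H" by auto
    then show ?thesis using surj by simp
  qed
  moreover have "h ` S \<subseteq> carrier N" using S left_module_homD(1)[OF assms(3)] by auto
  ultimately show ?thesis using S by (auto simp: N.fin_gen_iff intro!: exI[of _ "h ` S"])
qed

section \<open>Sums of cyclic modules given by idempotents\<close>

text \<open>For a finite index set and idempotents \<open>e i\<close> this is the direct sum of the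
  left ideals generated by the \<open>e i\<close>; membership is expressed by the equation xe = x,
  which needs no witness. Over an infinite index set it would be the product.\<close>

definition sum_mod :: "('r, 's) ring_scheme \<Rightarrow> 'i set \<Rightarrow> ('i \<Rightarrow> 'r) \<Rightarrow> ('r, 'i \<Rightarrow> 'r) module" where
  "sum_mod R I e =
     \<lparr>carrier = {x \<in> I \<rightarrow>\<^sub>E carrier R. \<forall>i\<in>I. x i \<otimes>\<^bsub>R\<^esub> e i = x i},
      monoid.mult = undefined, one = undefined,
      zero = (\<lambda>i\<in>I. \<zero>\<^bsub>R\<^esub>),
      add = (\<lambda>u v. \<lambda>i\<in>I. u i \<oplus>\<^bsub>R\<^esub> v i),
      module.smult = (\<lambda>a v. \<lambda>i\<in>I. a \<otimes>\<^bsub>R\<^esub> v i)\<rparr>"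

definition cyc_mod :: "('r, 's) ring_scheme \<Rightarrow> 'r \<Rightarrow> ('r, 'r) module" where
  "cyc_mod R e =
     \<lparr>carrier = {x \<in> carrier R. x \<otimes>\<^bsub>R\<^esub> e = x},
      monoid.mult = undefined, one = undefined,
      zero = \<zero>\<^bsub>R\<^esub>, add = add R, module.smult = monoid.mult R\<rparr>"

lemma sum_mod_simps:
  "x \<in> carrier (sum_mod R I e) \<longleftrightarrow> x \<in> extensional I \<and> (\<forall>i\<in>I. x i \<in> carrier R \<and> x i \<otimes>\<^bsub>R\<^esub> e i = x i)"
  "\<zero>\<^bsub>sum_mod R I e\<^esub> = (\<lambda>i\<in>I. \<zero>\<^bsub>R\<^esub>)"
  "u \<oplus>\<^bsub>sum_mod R I e\<^esub> v = (\<lambda>i\<in>I. u i \<oplus>\<^bsub>R\<^esub> v i)"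
  "a \<odot>\<^bsub>sum_mod R I e\<^esub> v = (\<lambda>i\<in>I. a \<otimes>\<^bsub>R\<^esub> v i)"
  by (auto simp: sum_mod_def PiE_def)

lemma cyc_mod_simps:
  "carrier (cyc_mod R e) = {x \<in> carrier R. x \<otimes>\<^bsub>R\<^esub> e = x}"
  "\<zero>\<^bsub>cyc_mod R e\<^esub> = \<zero>\<^bsub>R\<^esub>" "x \<oplus>\<^bsub>cyc_mod R e\<^esub> y = x \<oplus>\<^bsub>R\<^esub> y" "x \<odot>\<^bsub>cyc_mod R e\<^esub> y = x \<otimes>\<^bsub>R\<^esub> y"
  by (auto simp: cyc_mod_def)

lemma free_left_module_eq_sum_mod:
  "ring R \<Longrightarrow> finite I \<Longrightarrow> free_left_module R I = sum_mod R I (\<lambda>_. \<one>\<^bsub>R\<^esub>)"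
  by (auto simp: free_left_module_def sum_mod_def ring.ring_simprules PiE_def Pi_iff
      monoid.r_one[OF ring.is_monoid])

lemma module_direct_sum_simps:
  "carrier (module_direct_sum M N) = carrier M \<times> carrier N"
  "\<zero>\<^bsub>module_direct_sum M N\<^esub> = (\<zero>\<^bsub>M\<^esub>, \<zero>\<^bsub>N\<^esub>)"
  "(x, y) \<oplus>\<^bsub>module_direct_sum M N\<^esub> (x', y') = (x \<oplus>\<^bsub>M\<^esub> x', y \<oplus>\<^bsub>N\<^esub> y')"
  "a \<odot>\<^bsub>module_direct_sum M N\<^esub> (x, y) = (a \<odot>\<^bsub>M\<^esub> x, a \<odot>\<^bsub>N\<^esub> y)"
  by (auto simp: module_direct_sum_def)

context ring
begin

lemma left_module_sum_mod:
  assumes "e \<in> I \<rightarrow> carrier R"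
  shows "left_module R (sum_mod R I e)"
proof (rule left_moduleI)
  fix x assume x: "x \<in> carrier (sum_mod R I e)"
  then show "\<exists>y\<in>carrier (sum_mod R I e). y \<oplus>\<^bsub>sum_mod R I e\<^esub> x = \<zero>\<^bsub>sum_mod R I e\<^esub>"
    using assms by (intro bexI[of _ "\<lambda>i\<in>I. \<ominus> x i"]) (auto simp: sum_mod_simps l_neg l_minus fun_eq_iff Pi_iff)
qed (use assms in \<open>auto simp: sum_mod_simps ring_axioms a_assoc l_distr r_distr m_assoc Pi_iff extensional_def fun_eq_iff intro: a_comm\<close>)

lemma left_module_cyc_mod: "e \<in> carrier R \<Longrightarrow> left_module R (cyc_mod R e)"
proof (rule left_moduleI)
  assume e: "e \<in> carrier R"
  fix x assume "x \<in> carrier (cyc_mod R e)"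
  then show "\<exists>y\<in>carrier (cyc_mod R e). y \<oplus>\<^bsub>cyc_mod R e\<^esub> x = \<zero>\<^bsub>cyc_mod R e\<^esub>"
    using e by (intro bexI[of _ "\<ominus> x"]) (auto simp: cyc_mod_simps l_neg l_minus)
next
  fix x y assume "x \<in> carrier (cyc_mod R e)" "y \<in> carrier (cyc_mod R e)"
  then show "x \<oplus>\<^bsub>cyc_mod R e\<^esub> y = y \<oplus>\<^bsub>cyc_mod R e\<^esub> x"
    by (auto simp: cyc_mod_simps a_comm)
qed (auto simp: cyc_mod_simps ring_axioms a_assoc l_distr r_distr m_assoc)

lemma sum_mod_empty_isomorphic:
  "left_module_isomorphic R (sum_mod R {} e) (sum_mod R {} e')"
  by (rule left_module_isomorphicI[where h = "\<lambda>_ _. undefined"])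
    (auto simp: sum_mod_simps inj_on_def intro!: left_module_homI exI[of _ "\<lambda>_. undefined"])

lemma sum_mod_reindex:
  assumes "bij_betw b I J" "\<And>i. i \<in> I \<Longrightarrow> f (b i) = e i"
  shows "left_module_isomorphic R (sum_mod R J f) (sum_mod R I e)"
proof (rule left_module_isomorphicI[of "\<lambda>x. \<lambda>i\<in>I. x (b i)"])
  have bI: "b i \<in> J" if "i \<in> I" for i using assms(1) that by (auto simp: bij_betw_def)
  show "(\<lambda>x. \<lambda>i\<in>I. x (b i)) \<in> left_module_hom R (sum_mod R J f) (sum_mod R I e)"
    using assms(2) bI by (intro left_module_homI) (fastforce simp: sum_mod_simps fun_eq_iff)+
  show "inj_on (\<lambda>x. \<lambda>i\<in>I. x (b i)) (carrier (sum_mod R J f))"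
  proof (rule inj_onI)
    fix x y assume x: "x \<in> carrier (sum_mod R J f)" "y \<in> carrier (sum_mod R J f)"
      and eq: "(\<lambda>i\<in>I. x (b i)) = (\<lambda>i\<in>I. y (b i))"
    show "x = y"
    proof (rule extensionalityI[of _ J])
      fix j assume "j \<in> J"
      then obtain i where "i \<in> I" "j = b i" using assms(1) by (auto simp: bij_betw_def)
      then show "x j = y j" using fun_cong[OF eq, of i] by simp
    qed (use x in \<open>auto simp: sum_mod_simps\<close>)
  qed
  fix y assume y: "y \<in> carrier (sum_mod R I e)"
  define x where "x = (\<lambda>j\<in>J. y (inv_into I b j))"
  have "x \<in> carrier (sum_mod R J f)"
  proof -
    have "inv_into I b j \<in> I" "f j = e (inv_into I b j)" if "j \<in> J" for j
      using assms that bij_betw_inv_into_right[OF assms(1) that] inv_into_into[of j b I]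
      by (auto simp: bij_betw_def)
    then show ?thesis using y by (auto simp: x_def sum_mod_simps)
  qed
  moreover have "(\<lambda>i\<in>I. x (b i)) = y"
    using y bI bij_betw_inv_into_left[OF assms(1)] by (auto simp: x_def sum_mod_simps fun_eq_iff extensional_def)
  ultimately show "\<exists>x\<in>carrier (sum_mod R J f). (\<lambda>i\<in>I. x (b i)) = y" by blast
qed

lemma sum_mod_insert:
  assumes "i \<notin> I"
  shows "left_module_isomorphic R (sum_mod R (insert i I) e) (module_direct_sum (cyc_mod R (e i)) (sum_mod R I e))"
proof (rule left_module_isomorphicI[of "\<lambda>x. (x i, restrict x I)"])
  show "(\<lambda>x. (x i, restrict x I)) \<in> left_module_hom R (sum_mod R (insert i I) e)
      (module_direct_sum (cyc_mod R (e i)) (sum_mod R I e))"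
    by (rule left_module_homI) (auto simp: sum_mod_simps cyc_mod_simps module_direct_sum_simps fun_eq_iff)
  show "inj_on (\<lambda>x. (x i, restrict x I)) (carrier (sum_mod R (insert i I) e))"
    by (rule inj_onI) (auto simp: sum_mod_simps fun_eq_iff extensional_def restrict_def, metis)
  fix y assume y: "y \<in> carrier (module_direct_sum (cyc_mod R (e i)) (sum_mod R I e))"
  obtain a b where ab: "y = (a, b)" by (cases y)
  have "b(i := a) \<in> carrier (sum_mod R (insert i I) e)"
    using y assms by (auto simp: ab sum_mod_simps cyc_mod_simps module_direct_sum_simps extensional_def)
  moreover have "((b(i := a)) i, restrict (b(i := a)) I) = y"
    using y assms by (auto simp: ab sum_mod_simps cyc_mod_simps module_direct_sum_simps fun_eq_iff extensional_def)
  ultimately show "\<exists>x\<in>carrier (sum_mod R (insert i I) e). (x i, restrict x I) = y" by blast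
qed

lemma sum_mod_append:
  assumes "I \<inter> J = {}"
  shows "left_module_isomorphic R (sum_mod R (I \<union> J) e) (module_direct_sum (sum_mod R I e) (sum_mod R J e))"
proof (rule left_module_isomorphicI[of "\<lambda>x. (restrict x I, restrict x J)"])
  show "(\<lambda>x. (restrict x I, restrict x J)) \<in> left_module_hom R (sum_mod R (I \<union> J) e)
      (module_direct_sum (sum_mod R I e) (sum_mod R J e))"
    by (rule left_module_homI) (auto simp: sum_mod_simps module_direct_sum_simps fun_eq_iff)
  show "inj_on (\<lambda>x. (restrict x I, restrict x J)) (carrier (sum_mod R (I \<union> J) e))"
  proof (rule inj_onI)
    fix x y assume x: "x \<in> carrier (sum_mod R (I \<union> J) e)" "y \<in> carrier (sum_mod R (I \<union> J) e)"
      and eq: "(restrict x I, restrict x J) = (restrict y I, restrict y J)"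
    then have "restrict x I k = restrict y I k" "restrict x J k = restrict y J k" for k by auto
    then show "x = y" using x by (auto simp: sum_mod_simps intro!: extensionalityI[of x "I \<union> J" y]) metis+
  qed
  fix y assume y: "y \<in> carrier (module_direct_sum (sum_mod R I e) (sum_mod R J e))"
  obtain a b where ab: "y = (a, b)" by (cases y)
  define x where "x = (\<lambda>i\<in>I \<union> J. if i \<in> I then a i else b i)"
  have "x \<in> carrier (sum_mod R (I \<union> J) e)"
    using y by (auto simp: x_def ab sum_mod_simps module_direct_sum_simps)
  moreover have "(restrict x I, restrict x J) = y"
    using y assms by (auto simp: x_def ab sum_mod_simps module_direct_sum_simps fun_eq_iff extensional_def)
  ultimately show "\<exists>x\<in>carrier (sum_mod R (I \<union> J) e). (restrict x I, restrict x J) = y" by blast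
qed

lemma sum_mod_singleton: "left_module_isomorphic R (sum_mod R {i} e) (cyc_mod R (e i))"
proof (rule left_module_isomorphicI[of "\<lambda>x. x i"])
  show "inj_on (\<lambda>x. x i) (carrier (sum_mod R {i} e))"
    by (rule inj_onI) (auto simp: sum_mod_simps fun_eq_iff extensional_def, metis)
  fix y assume "y \<in> carrier (cyc_mod R (e i))"
  then show "\<exists>x\<in>carrier (sum_mod R {i} e). x i = y"
    by (intro bexI[of _ "\<lambda>k\<in>{i}. y"]) (auto simp: sum_mod_simps cyc_mod_simps)
qed (auto simp: sum_mod_simps cyc_mod_simps intro!: left_module_homI)

lemma cyc_mod_zero: "left_module_isomorphic R (cyc_mod R \<zero>) (sum_mod R {} e)"
  by (rule left_module_isomorphicI[of "\<lambda>x. \<lambda>_. undefined"])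
    (auto simp: sum_mod_simps cyc_mod_simps inj_on_def extensional_def intro!: left_module_homI bexI[of _ \<zero>])

text \<open>Equivalence of the idempotents e = ab and f = ba: right multiplication by
  \<open>a\<close> maps Re to Rf, and right multiplication by \<open>b\<close> maps it back.\<close>

lemma cyc_mod_equiv:
  assumes ab: "a \<in> carrier R" "b \<in> carrier R" and e: "a \<otimes> b = e" "e \<otimes> e = e" and f: "b \<otimes> a = f" "f \<otimes> f = f"
  shows "left_module_isomorphic R (cyc_mod R e) (cyc_mod R f)"
proof (rule left_module_isomorphicI[of "\<lambda>x. x \<otimes> a"])
  have c: "e \<in> carrier R" "f \<in> carrier R" using ab e(1) f(1) by auto
  have xf: "x \<otimes> a \<otimes> f = x \<otimes> a" if "x \<in> carrier R" "x \<otimes> e = x" for x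
    using that ab c e(1) f(1) by (metis m_assoc)
  have ye: "y \<otimes> b \<otimes> e = y \<otimes> b" if "y \<in> carrier R" "y \<otimes> f = y" for y
    using that ab c e(1) f(1) by (metis m_assoc)
  have xab: "x \<otimes> a \<otimes> b = x" if "x \<in> carrier R" "x \<otimes> e = x" for x
    using that ab e(1) by (metis m_assoc)
  have yba: "y \<otimes> b \<otimes> a = y" if "y \<in> carrier R" "y \<otimes> f = y" for y
    using that ab f(1) by (metis m_assoc)
  show "(\<lambda>x. x \<otimes> a) \<in> left_module_hom R (cyc_mod R e) (cyc_mod R f)"
    using ab xf by (intro left_module_homI) (auto simp: cyc_mod_simps l_distr m_assoc)
  show "inj_on (\<lambda>x. x \<otimes> a) (carrier (cyc_mod R e))"
    by (rule inj_onI) (auto simp: cyc_mod_simps, metis xab)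
  fix y assume "y \<in> carrier (cyc_mod R f)"
  then show "\<exists>x\<in>carrier (cyc_mod R e). x \<otimes> a = y"
    using ab ye yba by (intro bexI[of _ "y \<otimes> b"]) (auto simp: cyc_mod_simps)
qed

lemma cyc_mod_add:
  assumes ef: "e \<in> carrier R" "f \<in> carrier R" "e \<otimes> e = e" "f \<otimes> f = f" "e \<otimes> f = \<zero>" "f \<otimes> e = \<zero>"
  shows "left_module_isomorphic R (cyc_mod R (e \<oplus> f)) (module_direct_sum (cyc_mod R e) (cyc_mod R f))"
proof (rule left_module_isomorphicI[of "\<lambda>x. (x \<otimes> e, x \<otimes> f)"])
  show "(\<lambda>x. (x \<otimes> e, x \<otimes> f)) \<in> left_module_hom R (cyc_mod R (e \<oplus> f))
      (module_direct_sum (cyc_mod R e) (cyc_mod R f))"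
    using ef by (intro left_module_homI) (auto simp: cyc_mod_simps module_direct_sum_simps l_distr m_assoc)
  show "inj_on (\<lambda>x. (x \<otimes> e, x \<otimes> f)) (carrier (cyc_mod R (e \<oplus> f)))"
    using ef by (intro inj_onI) (auto simp: cyc_mod_simps, metis r_distr)
  fix y assume y: "y \<in> carrier (module_direct_sum (cyc_mod R e) (cyc_mod R f))"
  obtain a b where ab: "y = (a, b)" by (cases y)
  have c: "a \<in> carrier R" "b \<in> carrier R" and ae: "a \<otimes> e = a" and bf: "b \<otimes> f = b"
    using y by (auto simp: ab cyc_mod_simps module_direct_sum_simps)
  have af: "a \<otimes> f = \<zero>" using ef c ae m_assoc[of a e f] by simp
  have be: "b \<otimes> e = \<zero>" using ef c bf m_assoc[of b f e] by simp
  have "a \<oplus> b \<in> carrier (cyc_mod R (e \<oplus> f))"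
    using c ef by (auto simp: cyc_mod_simps l_distr r_distr ae af be bf)
  moreover have "((a \<oplus> b) \<otimes> e, (a \<oplus> b) \<otimes> f) = y"
    using c ef by (simp add: ab l_distr ae af be bf)
  ultimately show "\<exists>x\<in>carrier (cyc_mod R (e \<oplus> f)). (x \<otimes> e, x \<otimes> f) = y" by blast
qed

end

section \<open>Finitely generated projective modules over a regular ring\<close>

lemma submodule_setD:
  assumes "submodule_set R M H"
  shows "\<lbrakk>x \<in> H; y \<in> H\<rbrakk> \<Longrightarrow> x \<oplus>\<^bsub>M\<^esub> y \<in> H" "\<lbrakk>a \<in> carrier R; x \<in> H\<rbrakk> \<Longrightarrow> a \<odot>\<^bsub>M\<^esub> x \<in> H"
  using assms by (auto simp: submodule_set_def)

definition idem :: "('r, 's) ring_scheme \<Rightarrow> 'r \<Rightarrow> bool" where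
  "idem R e \<longleftrightarrow> e \<in> carrier R \<and> e \<otimes>\<^bsub>R\<^esub> e = e"

context ring
begin

text \<open>The entry in place \<open>i\<close> is \<open>e i\<close> because 1 need not belong to
  the left ideal of \<open>e i\<close>; these vectors generate the sum.\<close>

definition unit_vec :: "'i set \<Rightarrow> ('i \<Rightarrow> 'a) \<Rightarrow> 'i \<Rightarrow> 'i \<Rightarrow> 'a" where
  "unit_vec I e i = (\<lambda>k\<in>I. if k = i then e i else \<zero>)"

lemma unit_vec_in: "\<lbrakk>i \<in> I; \<forall>i\<in>I. idem R (e i)\<rbrakk> \<Longrightarrow> unit_vec I e i \<in> carrier (sum_mod R I e)"
  by (auto simp: unit_vec_def sum_mod_simps idem_def)

lemma sum_mod_generated:
  assumes "finite I" "\<forall>i\<in>I. idem R (e i)"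
    and H: "submodule_set R (sum_mod R I e) H" "\<And>i. i \<in> I \<Longrightarrow> unit_vec I e i \<in> H"
  shows "carrier (sum_mod R I e) \<subseteq> H"
proof
  fix x assume x: "x \<in> carrier (sum_mod R I e)"
  have "(\<lambda>k\<in>I. if k \<in> J then x k else \<zero>) \<in> H" if "finite J" "J \<subseteq> I" for J
    using that
  proof (induction J rule: finite_induct)
    case empty
    then show ?case using H(1) by (simp add: submodule_set_def sum_mod_simps(2) restrict_def)
  next
    case (insert j J)
    have "(\<lambda>k\<in>I. if k \<in> insert j J then x k else \<zero>) =
      x j \<odot>\<^bsub>sum_mod R I e\<^esub> unit_vec I e j \<oplus>\<^bsub>sum_mod R I e\<^esub> (\<lambda>k\<in>I. if k \<in> J then x k else \<zero>)"
      using x insert assms(2) by (auto simp: sum_mod_simps unit_vec_def fun_eq_iff idem_def)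
    moreover have "x j \<in> carrier R" using insert x by (auto simp: sum_mod_simps)
    moreover have "(\<lambda>k\<in>I. if k \<in> J then x k else \<zero>) \<in> H" "unit_vec I e j \<in> H"
      using insert.IH insert.prems H(2) by blast+
    ultimately show ?case
      using submodule_setD[OF H(1)] by simp
  qed
  from this[OF assms(1)] have "(\<lambda>k\<in>I. if k \<in> I then x k else \<zero>) \<in> H" by simp
  moreover have "(\<lambda>k\<in>I. if k \<in> I then x k else \<zero>) = x"
    using x by (auto simp: sum_mod_simps fun_eq_iff extensional_def)
  ultimately show "x \<in> H" by simp
qed

lemma left_module_sum_mod_idem: "\<forall>i\<in>I. idem R (e i) \<Longrightarrow> left_module R (sum_mod R I e)"
  by (rule left_module_sum_mod) (auto simp: idem_def)

lemma fin_gen_sum_mod: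
  assumes "finite I" "\<forall>i\<in>I. idem R (e i)"
  shows "fin_gen_module R (sum_mod R I e)"
proof -
  interpret M: left_module R "sum_mod R I e" using left_module_sum_mod_idem[OF assms(2)] .
  show ?thesis
    unfolding M.fin_gen_iff using sum_mod_generated[OF assms] unit_vec_in[OF _ assms(2)] assms(1)
    by (intro exI[of _ "unit_vec I e ` I"]) blast
qed

text \<open>The complement in a free module is the sum of the left ideals generated by the 1 -
  \<open>e i\<close>.\<close>

lemma fgp_sum_mod:
  fixes e :: "nat \<Rightarrow> 'a"
  assumes "finite I" "\<forall>i\<in>I. idem R (e i)" and ne: "\<one> \<noteq> \<zero>"
  shows "fgp_module R (sum_mod R I e)"
proof -
  \<comment> \<open>\<open>projective_module\<close> asks for a basis consisting of elements of the
    type of the module, here functions on the naturals. So \<open>I\<close> is copied to a set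
    \<open>J\<close> of such functions; there are enough of them because 1 and 0 differ.\<close>
  have "inj (\<lambda>n k. if k = n then \<one> else \<zero>)"
    using ne by (auto simp: inj_on_def fun_eq_iff split: if_splits)
  then have "infinite (UNIV :: (nat \<Rightarrow> 'a) set)"
    using finite_imageD[of _ UNIV] by (metis finite_subset infinite_UNIV_nat subset_UNIV)
  then obtain J :: "(nat \<Rightarrow> 'a) set" where J: "finite J" "card J = card I"
    using infinite_arbitrarily_large by metis
  then obtain b where b: "bij_betw b I J" using finite_same_card_bij assms(1) by metis
  define f where "f = e \<circ> inv_into I b"
  have fb: "f (b i) = e i" if "i \<in> I" for i
    using that b by (simp add: f_def bij_betw_inv_into_left)
  have fi: "\<forall>j\<in>J. idem R (f j)" using b assms(2) fb by (auto simp: bij_betw_def)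
  then have fi': "\<And>j. j \<in> J \<Longrightarrow> f j \<in> carrier R" "\<And>j. j \<in> J \<Longrightarrow> f j \<otimes> f j = f j"
    by (auto simp: idem_def)
  define f' where "f' = (\<lambda>j. \<one> \<ominus> f j)"
  have f': "\<And>j. j \<in> J \<Longrightarrow> f' j \<in> carrier R"
      "\<And>j. j \<in> J \<Longrightarrow> f j \<otimes> f' j = \<zero>" "\<And>j. j \<in> J \<Longrightarrow> f' j \<otimes> f j = \<zero>"
    using fi' by (simp_all add: f'_def minus_eq l_distr r_distr l_minus r_minus r_neg)
  have sum1: "x \<otimes> f j \<oplus> x \<otimes> f' j = x" if "j \<in> J" "x \<in> carrier R" for j x
  proof -
    have "f j \<oplus> f' j = \<one>" using fi' that by (simp add: f'_def minus_eq a_lcomm r_neg)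
    then show ?thesis using that fi' f' by (metis r_distr r_one)
  qed
  have lQ: "left_module R (sum_mod R J f')" using f' by (intro left_module_sum_mod) auto
  have lP: "left_module R (sum_mod R I e)" using left_module_sum_mod_idem assms(2) by blast
  have "left_module_isomorphic R (module_direct_sum (sum_mod R J f) (sum_mod R J f')) (sum_mod R J (\<lambda>_. \<one>))"
  proof (rule left_module_isomorphicI[of "\<lambda>(x, y). \<lambda>j\<in>J. x j \<oplus> y j"])
    let ?h = "\<lambda>(x, y). \<lambda>j\<in>J. x j \<oplus> y j"
    let ?P = "module_direct_sum (sum_mod R J f) (sum_mod R J f')"
    have l: "x j \<oplus> (y j \<oplus> (x' j \<oplus> y' j)) = x j \<oplus> (x' j \<oplus> (y j \<oplus> y' j))"
      if "x j \<in> carrier R" "y j \<in> carrier R" "x' j \<in> carrier R" "y' j \<in> carrier R" for x y x' y' :: "(nat \<Rightarrow> 'a) \<Rightarrow> 'a" and j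
      using that by (simp add: a_lcomm)
    show "?h \<in> left_module_hom R ?P (sum_mod R J (\<lambda>_. \<one>))"
      by (rule left_module_homI)
        (auto simp: sum_mod_simps module_direct_sum_simps fun_eq_iff r_distr a_assoc l)
    have key: "(x j \<oplus> y j) \<otimes> f j = x j" "(x j \<oplus> y j) \<otimes> f' j = y j"
      if "(x, y) \<in> carrier ?P" "j \<in> J" for x y j
    proof -
      have c: "x j \<in> carrier R" "y j \<in> carrier R" "x j \<otimes> f j = x j" "y j \<otimes> f' j = y j"
        using that by (auto simp: sum_mod_simps module_direct_sum_simps)
      have "x j \<otimes> f' j = \<zero>" "y j \<otimes> f j = \<zero>"
        using c fi'[OF that(2)] f'[OF that(2)] by (metis m_assoc r_null)+
      then show "(x j \<oplus> y j) \<otimes> f j = x j" "(x j \<oplus> y j) \<otimes> f' j = y j"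
        using c fi'[OF that(2)] f'[OF that(2)] by (simp_all add: l_distr)
    qed
    show "inj_on ?h (carrier ?P)"
    proof (rule inj_onI)
      fix u v assume u: "u \<in> carrier ?P" "v \<in> carrier ?P" and eq: "?h u = ?h v"
      obtain x y x' y' where uv: "u = (x, y)" "v = (x', y')" by (cases u, cases v)
      have "x j = x' j \<and> y j = y' j" if "j \<in> J" for j
        using key[of x y j] key[of x' y' j] u uv that fun_cong[OF eq, of j] by simp
      then show "u = v"
        using u by (auto simp: uv sum_mod_simps module_direct_sum_simps intro: extensionalityI)
    qed
    fix z assume z: "z \<in> carrier (sum_mod R J (\<lambda>_. \<one>))"
    then have zc: "\<And>j. j \<in> J \<Longrightarrow> z j \<in> carrier R" "z \<in> extensional J" by (auto simp: sum_mod_simps)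
    have f'f': "f' j \<otimes> f' j = f' j" if "j \<in> J" for j
      using sum1[OF that f'(1)[OF that]] f'[OF that] by simp
    have "(\<lambda>j\<in>J. z j \<otimes> f j, \<lambda>j\<in>J. z j \<otimes> f' j) \<in> carrier ?P"
      using zc fi' f' f'f' by (auto simp: sum_mod_simps module_direct_sum_simps m_assoc)
    moreover have "?h (\<lambda>j\<in>J. z j \<otimes> f j, \<lambda>j\<in>J. z j \<otimes> f' j) = z"
      using zc sum1 by (auto simp: fun_eq_iff extensional_def)
    ultimately show "\<exists>u\<in>carrier ?P. ?h u = z" by blast
  qed
  note iso1 = this
  have "left_module_isomorphic R (sum_mod R I e) (sum_mod R J f)"
    using left_module_isomorphic_sym[OF left_module_sum_mod_idem[OF fi] sum_mod_reindex[where f = f and e = e, OF b fb]] by simp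
  from left_module_isomorphic_trans[OF module_direct_sum_cong[OF this left_module_isomorphic_refl] iso1]
  have "left_module_isomorphic R (module_direct_sum (sum_mod R I e) (sum_mod R J f'))
      (free_left_module R J)"
    unfolding free_left_module_eq_sum_mod[OF ring_axioms J(1)] .
  then show ?thesis
    using lQ lP fin_gen_sum_mod[OF assms(1,2)] by (auto simp: fgp_module_def projective_module_def)
qed

text \<open>A homomorphism is right multiplication by the matrix of the images of the generators:
  the vectors that satisfy the formula form a submodule containing these generators.\<close>

lemma hom_sum_mod:
  assumes "finite J" "\<forall>j\<in>J. idem R (f j)" "\<forall>i\<in>I. idem R (e i)"
    and h: "h \<in> left_module_hom R (sum_mod R J f) (sum_mod R I e)"
    and y: "y \<in> carrier (sum_mod R J f)" and k: "k \<in> I"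
  shows "h y k = (\<Oplus>j\<in>J. y j \<otimes> h (unit_vec J f j) k)"
proof -
  let ?M = "sum_mod R J f" and ?N = "sum_mod R I e"
  interpret M: left_module R ?M using left_module_sum_mod_idem[OF assms(2)] .
  interpret N: left_module R ?N using left_module_sum_mod_idem[OF assms(3)] .
  note u = unit_vec_in[OF _ assms(2)]
  have hu: "h (unit_vec J f j) k \<in> carrier R" if "j \<in> J" for j
    using left_module_homD(1)[OF h u[OF that]] k by (auto simp: sum_mod_simps)
  let ?H = "{y \<in> carrier ?M. h y k = (\<Oplus>j\<in>J. y j \<otimes> h (unit_vec J f j) k)}"
  have "submodule_set R ?M ?H"
    unfolding submodule_set_def
  proof (intro conjI ballI)
    have "h \<zero>\<^bsub>?M\<^esub> k = \<zero>"
      using left_module_hom_zero[OF M.left_module_axioms N.left_module_axioms h] k by (simp add: sum_mod_simps)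
    moreover have "(\<Oplus>j\<in>J. \<zero>\<^bsub>?M\<^esub> j \<otimes> h (unit_vec J f j) k) = \<zero>"
      by (subst finsum_cong'[where g = "\<lambda>_. \<zero>" and B = J]) (auto simp: sum_mod_simps hu)
    ultimately show "\<zero>\<^bsub>?M\<^esub> \<in> ?H" by simp
  next
    fix x y assume xy: "x \<in> ?H" "y \<in> ?H"
    then have c: "x j \<in> carrier R" "y j \<in> carrier R" if "j \<in> J" for j using that by (auto simp: sum_mod_simps)
    have "h (x \<oplus>\<^bsub>?M\<^esub> y) k = h x k \<oplus> h y k"
      using left_module_homD(2)[OF h, of x y] xy k by (simp add: sum_mod_simps)
    also have "\<dots> = (\<Oplus>j\<in>J. x j \<otimes> h (unit_vec J f j) k \<oplus> y j \<otimes> h (unit_vec J f j) k)"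
      using xy c hu by (simp add: finsum_addf Pi_iff)
    also have "\<dots> = (\<Oplus>j\<in>J. (x \<oplus>\<^bsub>?M\<^esub> y) j \<otimes> h (unit_vec J f j) k)"
      using c hu by (intro finsum_cong') (auto simp: sum_mod_simps l_distr)
    finally show "x \<oplus>\<^bsub>?M\<^esub> y \<in> ?H" using xy M.M.a_closed by auto
  next
    fix a x assume a: "a \<in> carrier R" and x: "x \<in> ?H"
    then have c: "x j \<in> carrier R" if "j \<in> J" for j using that by (auto simp: sum_mod_simps)
    have "h (a \<odot>\<^bsub>?M\<^esub> x) k = a \<otimes> h x k"
      using left_module_homD(3)[OF h a, of x] x k by (simp add: sum_mod_simps)
    also have "\<dots> = (\<Oplus>j\<in>J. a \<otimes> (x j \<otimes> h (unit_vec J f j) k))"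
      using x a c hu assms(1) by (simp add: finsum_rdistr Pi_iff)
    also have "\<dots> = (\<Oplus>j\<in>J. (a \<odot>\<^bsub>?M\<^esub> x) j \<otimes> h (unit_vec J f j) k)"
      using a c hu by (intro finsum_cong') (auto simp: sum_mod_simps m_assoc)
    finally show "a \<odot>\<^bsub>?M\<^esub> x \<in> ?H" using x a M.smult_closed by auto
  qed auto
  moreover have "unit_vec J f i \<in> ?H" if i: "i \<in> J" for i
  proof -
    have fi: "f i \<in> carrier R" "f i \<otimes> f i = f i" using assms(2) i by (auto simp: idem_def)
    \<comment> \<open>The generator is fixed by \<open>f i\<close>, hence so is its image; this
      matches the factor \<open>f i\<close> in the only nonzero term of the sum.\<close>
    have "f i \<odot>\<^bsub>?M\<^esub> unit_vec J f i = unit_vec J f i"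
      using fi by (auto simp: sum_mod_simps unit_vec_def fun_eq_iff)
    then have "h (unit_vec J f i) = f i \<odot>\<^bsub>?N\<^esub> h (unit_vec J f i)"
      using left_module_homD(3)[OF h fi(1) u[OF i]] by metis
    then have "h (unit_vec J f i) k = (f i \<odot>\<^bsub>?N\<^esub> h (unit_vec J f i)) k" by metis
    also have "\<dots> = f i \<otimes> h (unit_vec J f i) k"
      using k by (simp add: sum_mod_simps)
    finally have 1: "h (unit_vec J f i) k = f i \<otimes> h (unit_vec J f i) k" .
    have "(\<Oplus>j\<in>J. unit_vec J f i j \<otimes> h (unit_vec J f j) k)
        = (\<Oplus>j\<in>J. if i = j then f j \<otimes> h (unit_vec J f j) k else \<zero>)"
      using fi hu assms(2) by (intro finsum_cong') (auto simp: unit_vec_def idem_def)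
    also have "\<dots> = f i \<otimes> h (unit_vec J f i) k"
      using i assms(1,2) hu by (subst finsum_singleton) (auto simp: idem_def)
    finally show ?thesis using 1 u[OF i] by simp
  qed
  ultimately show ?thesis using sum_mod_generated[OF assms(1,2)] y by blast
qed

text \<open>The rows of \<open>A\<close> and \<open>B\<close> are the images of the generators under
  the isomorphism and its inverse. Only one composite is recorded; the other one is obtained by
  exchanging the two modules.\<close>

lemma isomorphic_sum_mod_matrices:
  assumes "finite J" "\<forall>j\<in>J. idem R (f j)" "\<forall>i\<in>I. idem R (e i)"
    and "left_module_isomorphic R (sum_mod R I e) (sum_mod R J f)"
  obtains A B where
    "\<And>i j. \<lbrakk>i \<in> I; j \<in> J\<rbrakk> \<Longrightarrow> A i j \<in> carrier R \<and> e i \<otimes> A i j = A i j \<and> A i j \<otimes> f j = A i j"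
    "\<And>i j. \<lbrakk>i \<in> I; j \<in> J\<rbrakk> \<Longrightarrow> B j i \<in> carrier R \<and> f j \<otimes> B j i = B j i \<and> B j i \<otimes> e i = B j i"
    "\<And>i k. \<lbrakk>i \<in> I; k \<in> I\<rbrakk> \<Longrightarrow> (\<Oplus>j\<in>J. A i j \<otimes> B j k) = (if i = k then e i else \<zero>)"
proof -
  let ?M = "sum_mod R I e" and ?N = "sum_mod R J f"
  have lm: "left_module R ?M" "left_module R ?N" using left_module_sum_mod_idem assms(2,3) by auto
  obtain h where h: "h \<in> left_module_hom R ?M ?N" "bij_betw h (carrier ?M) (carrier ?N)"
    using assms(4) by (auto simp: left_module_isomorphic_def)
  obtain k where k: "k \<in> left_module_hom R ?N ?M" "\<And>x. x \<in> carrier ?M \<Longrightarrow> k (h x) = x"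
    using left_module_hom_inverse[OF lm(1) h] by blast
  define A where "A = (\<lambda>i. h (unit_vec I e i))"
  define B where "B = (\<lambda>j. k (unit_vec J f j))"
  note ui = unit_vec_in[OF _ assms(3)] and uj = unit_vec_in[OF _ assms(2)]
  have Ac: "A i \<in> carrier ?N" if "i \<in> I" for i
    using left_module_homD(1)[OF h(1) ui[OF that]] by (simp add: A_def)
  have Bc: "B j \<in> carrier ?M" if "j \<in> J" for j
    using left_module_homD(1)[OF k(1) uj[OF that]] by (simp add: B_def)
  have self: "e i \<odot>\<^bsub>sum_mod R I e\<^esub> unit_vec I e i = unit_vec I e i" if "idem R (e i)" for i I e
    using that by (auto simp: sum_mod_simps unit_vec_def fun_eq_iff idem_def)
  show ?thesis
  proof (rule that[of A B])
    fix i j assume ij: "i \<in> I" "j \<in> J"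
    have "e i \<odot>\<^bsub>?N\<^esub> A i = A i"
      using left_module_homD(3)[OF h(1) _ ui[OF ij(1)], of "e i"] self[of e i] assms(3) ij
      by (auto simp: A_def idem_def)
    from fun_cong[OF this, of j] ij
    show "A i j \<in> carrier R \<and> e i \<otimes> A i j = A i j \<and> A i j \<otimes> f j = A i j"
      using Ac[OF ij(1)] by (simp add: sum_mod_simps)
    have "f j \<odot>\<^bsub>?M\<^esub> B j = B j"
      using left_module_homD(3)[OF k(1) _ uj[OF ij(2)], of "f j"] self[of f j] assms(2) ij
      by (auto simp: B_def idem_def)
    from fun_cong[OF this, of i] ij
    show "B j i \<in> carrier R \<and> f j \<otimes> B j i = B j i \<and> B j i \<otimes> e i = B j i"
      using Bc[OF ij(2)] by (simp add: sum_mod_simps)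
  next
    fix i l assume il: "i \<in> I" "l \<in> I"
    have "(\<Oplus>j\<in>J. A i j \<otimes> B j l) = k (A i) l"
      unfolding B_def using hom_sum_mod[OF assms(1-3) k(1) Ac[OF il(1)] il(2)] by simp
    also have "\<dots> = unit_vec I e i l" using k(2)[OF ui[OF il(1)]] by (simp add: A_def)
    finally show "(\<Oplus>j\<in>J. A i j \<otimes> B j l) = (if i = l then e i else \<zero>)"
      using il by (auto simp: unit_vec_def)
  qed
qed

end

section \<open>Consequences of regularity for ideals and modules\<close>

text \<open>Finitely generated left ideals of a regular ring are generated by idempotents. The
  induction enlarges \<open>u\<close> by what it misses of the new generator, namely b = a(1 -
  u).\<close>

lemma (in ring) left_ideal_idempotent:
  assumes reg: "\<And>a. a \<in> carrier R \<Longrightarrow> \<exists>x\<in>carrier R. a = a \<otimes> x \<otimes> a"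
    and L: "L \<subseteq> carrier R" "\<zero> \<in> L" "\<And>x y. \<lbrakk>x \<in> L; y \<in> L\<rbrakk> \<Longrightarrow> x \<oplus> y \<in> L"
      "\<And>a x. \<lbrakk>a \<in> carrier R; x \<in> L\<rbrakk> \<Longrightarrow> a \<otimes> x \<in> L"
    and "finite S" "S \<subseteq> L"
  shows "\<exists>u\<in>L. u \<otimes> u = u \<and> (\<forall>s\<in>S. s \<otimes> u = s)"
  using assms(6,7)
proof (induction S rule: finite_induct)
  case empty
  then show ?case using L(2) by (intro bexI[of _ \<zero>]) auto
next
  case (insert a S)
  then obtain u where u: "u \<in> L" "u \<otimes> u = u" "\<And>s. s \<in> S \<Longrightarrow> s \<otimes> u = s" by auto
  have a: "a \<in> L" using insert by simp
  have min: "x \<ominus> y \<in> L" if "x \<in> L" "y \<in> L" for x y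
  proof -
    have "\<ominus> y = (\<ominus> \<one>) \<otimes> y" using that L(1) by (auto simp: l_minus)
    then show ?thesis using that L by (simp add: minus_eq)
  qed
  have c: "u \<in> carrier R" "a \<in> carrier R" using u a L by auto
  have dl: "(x \<ominus> y) \<otimes> z = x \<otimes> z \<ominus> y \<otimes> z" "z \<otimes> (x \<ominus> y) = z \<otimes> x \<ominus> z \<otimes> y"
    if "x \<in> carrier R" "y \<in> carrier R" "z \<in> carrier R" for x y z
    using that by (simp_all add: minus_eq l_distr r_distr l_minus r_minus)
  define b where "b = a \<ominus> a \<otimes> u"
  have b: "b \<in> L" unfolding b_def using a u L c by (intro min) auto
  then have bc: "b \<in> carrier R" using L by auto
  have bu: "b \<otimes> u = \<zero>" using c u(2) by (simp add: b_def dl m_assoc)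
  obtain y where y: "y \<in> carrier R" "b = b \<otimes> y \<otimes> b" using reg[OF bc] by blast
  \<comment> \<open>An idempotent with the same left ideal as \<open>b\<close>; it satisfies fu = 0
    because bu = 0.\<close>
  define f where "f = y \<otimes> b"
  have f: "f \<in> L" using y b L by (simp add: f_def)
  then have fc: "f \<in> carrier R" using L by auto
  have ff: "f \<otimes> f = f" using y bc unfolding f_def by (metis m_assoc m_closed)
  have bf: "b \<otimes> f = b" using y bc unfolding f_def by (metis m_assoc)
  have fu: "f \<otimes> u = \<zero>" using y bc c bu by (simp add: f_def m_assoc)
  \<comment> \<open>Subtracting uf makes the product with \<open>u\<close> vanish on the other side
    as well, so that the sum with \<open>u\<close> is again idempotent.\<close>
  define f' where "f' = f \<ominus> u \<otimes> f"
  have f': "f' \<in> L" unfolding f'_def using f u L c by (intro min) auto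
  then have f'c: "f' \<in> carrier R" using L by auto
  have f'u: "f' \<otimes> u = \<zero>" using fc c fu by (simp add: f'_def dl m_assoc)
  have uf': "u \<otimes> f' = \<zero>" using fc c u(2) by (simp add: f'_def dl m_assoc[symmetric])
  have ff': "f \<otimes> f' = f" using fc c ff fu by (simp add: f'_def dl m_assoc[symmetric]) (simp add: minus_eq)
  have f'f': "f' \<otimes> f' = f'"
  proof -
    have "f' \<otimes> f' = f \<otimes> f' \<ominus> (u \<otimes> f) \<otimes> f'" using fc c f'c by (subst f'_def) (simp add: dl)
    also have "\<dots> = f'" using fc c f'c ff' by (simp add: m_assoc f'_def)
    finally show ?thesis .
  qed
  have af': "a \<otimes> f' = b"
  proof -
    have "a \<otimes> f' = b \<otimes> f" using fc c by (simp add: f'_def b_def dl m_assoc)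
    then show ?thesis using bf by simp
  qed
  have sf': "s \<otimes> f' = \<zero>" if "s \<in> S" for s
  proof -
    have "s \<in> carrier R" using that insert L by auto
    then have "s \<otimes> f' = s \<otimes> (u \<otimes> f')" using u(3)[OF that] c f'c by (metis m_assoc)
    then show ?thesis using uf' \<open>s \<in> carrier R\<close> by simp
  qed
  show ?case
  proof (intro bexI[of _ "u \<oplus> f'"] conjI ballI)
    show "(u \<oplus> f') \<otimes> (u \<oplus> f') = u \<oplus> f'"
      using c f'c u(2) uf' f'u f'f' by (simp add: l_distr r_distr)
    show "u \<oplus> f' \<in> L" using L u f' by auto
    fix s assume "s \<in> insert a S"
    then consider "s = a" | "s \<in> S" by blast
    then show "s \<otimes> (u \<oplus> f') = s"
    proof cases
      case 1
      have "a \<otimes> u \<oplus> (a \<ominus> a \<otimes> u) = a" using c by (simp add: minus_eq a_lcomm r_neg)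
      then show ?thesis using 1 c f'c af' by (simp add: r_distr b_def)
    next
      case 2
      then have "s \<in> carrier R" using insert L by auto
      then show ?thesis using 2 c f'c sf' u(3) by (simp add: r_distr)
    qed
  qed
qed

text \<open>One coordinate is split off at a time: its image is a finitely generated left ideal,
  hence generated by an idempotent, and the map onto it splits; the kernel embeds into the remaining
  coordinates. That \<open>e i\<close> lies in the corner of \<open>g i\<close> is what later
  confines these idempotents to cut-offs of p and q.\<close>

lemma (in ring) fin_gen_embedded_sum:
  assumes reg: "\<And>a. a \<in> carrier R \<Longrightarrow> \<exists>x\<in>carrier R. a = a \<otimes> x \<otimes> a"
    and "finite I" "\<forall>i\<in>I. idem R (g i)"
    and "left_module R M" "fin_gen_module R M"
    and "h \<in> left_module_hom R M (sum_mod R I g)" "inj_on h (carrier M)"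
  shows "\<exists>e. (\<forall>i\<in>I. idem R (e i) \<and> g i \<otimes> e i = e i \<and> e i \<otimes> g i = e i) \<and>
             left_module_isomorphic R M (sum_mod R I e)"
  using assms(2-)
proof (induction I arbitrary: M h rule: finite_induct)
  case empty
  interpret M: left_module R M by fact
  have "left_module_isomorphic R M (sum_mod R {} g)"
  proof (rule left_module_isomorphicI[OF empty(4,5)])
    fix y assume "y \<in> carrier (sum_mod R {} g)"
    moreover have "h \<zero>\<^bsub>M\<^esub> \<in> carrier (sum_mod R {} g)"
      using left_module_homD(1)[OF empty(4)] by simp
    ultimately have "h \<zero>\<^bsub>M\<^esub> = y" by (auto simp: sum_mod_simps extensional_def)
    then show "\<exists>x\<in>carrier M. h x = y" by auto
  qed
  then show ?case by auto
next
  case (insert i I)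
  interpret M: left_module R M by fact
  note h = left_module_homD[OF insert.prems(4)]
  have gi: "g i \<in> carrier R" "g i \<otimes> g i = g i" using insert.prems by (auto simp: idem_def)
  define p where "p = (\<lambda>x. h x i)"
  have p: "p x \<in> carrier R" "p x \<otimes> g i = p x" if "x \<in> carrier M" for x
    using h(1)[OF that] by (auto simp: p_def sum_mod_simps)
  have p_add: "p (x \<oplus>\<^bsub>M\<^esub> y) = p x \<oplus> p y" if "x \<in> carrier M" "y \<in> carrier M" for x y
    using h(2)[OF that] by (simp add: p_def sum_mod_simps)
  have p_smult: "p (a \<odot>\<^bsub>M\<^esub> x) = a \<otimes> p x" if "a \<in> carrier R" "x \<in> carrier M" for a x
    using h(3)[OF that] by (simp add: p_def sum_mod_simps)
  have p_zero: "p \<zero>\<^bsub>M\<^esub> = \<zero>"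
    using left_module_hom_zero[OF M.left_module_axioms left_module_sum_mod_idem[OF insert.prems(1)] insert.prems(4)]
    by (simp add: p_def sum_mod_simps)
  obtain S where S: "S \<subseteq> carrier M" "finite S"
    and gen: "\<And>H. submodule_set R M H \<Longrightarrow> S \<subseteq> H \<Longrightarrow> carrier M \<subseteq> H"
    using insert.prems(3) M.fin_gen_iff by blast
  have "\<exists>u\<in>p ` carrier M. u \<otimes> u = u \<and> (\<forall>s\<in>p ` S. s \<otimes> u = s)"
  proof (rule left_ideal_idempotent[OF reg])
    fix a x assume "a \<in> carrier R" "x \<in> p ` carrier M"
    then show "a \<otimes> x \<in> p ` carrier M"
      using M.smult_closed by (auto simp: p_smult[symmetric])
  next
    fix x y assume "x \<in> p ` carrier M" "y \<in> p ` carrier M"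
    then show "x \<oplus> y \<in> p ` carrier M" by (auto simp: p_add[symmetric])
  next
    show "\<zero> \<in> p ` carrier M" using p_zero M.M.zero_closed by (metis imageI)
  qed (use p S in auto)
  then obtain m0 where m0: "m0 \<in> carrier M" "p m0 \<otimes> p m0 = p m0" "\<And>s. s \<in> S \<Longrightarrow> p s \<otimes> p m0 = p s" by auto
  have pu: "p x \<otimes> p m0 = p x" if "x \<in> carrier M" for x
  proof -
    have "submodule_set R M {x \<in> carrier M. p x \<otimes> p m0 = p x}"
      using m0(1) p by (auto simp: submodule_set_def p_zero p_add p_smult l_distr m_assoc M.smult_closed)
    from gen[OF this] S(1) m0(3) have "carrier M \<subseteq> {x \<in> carrier M. p x \<otimes> p m0 = p x}" by blast
    with that show ?thesis by blast
  qed
  \<comment> \<open>\<open>p m0\<close> is fixed by \<open>g i\<close> on the right only.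
    Multiplying by \<open>g i\<close> on the left moves it into the corner, and it stays a right
    unit for the image since \<open>p x\<close> is fixed by \<open>g i\<close> on the right.\<close>
  define u where "u = g i \<otimes> p m0"
  have uc: "u \<in> carrier R" using m0 gi p by (simp add: u_def)
  have ug1: "g i \<otimes> u = u"
    using gi m0(1) p[OF m0(1)] by (simp add: u_def m_assoc[symmetric])
  have ug2: "u \<otimes> g i = u"
    using gi m0(1) p[OF m0(1)] by (simp add: u_def m_assoc)
  note ug = ug1 ug2
  have uu: "u \<otimes> u = u"
  proof -
    have "u \<otimes> u = (u \<otimes> g i) \<otimes> p m0"
      using m_assoc[OF uc gi(1) p(1)[OF m0(1)]] by (simp add: u_def)
    also have "\<dots> = g i \<otimes> (p m0 \<otimes> p m0)"
      unfolding ug2 using gi p(1)[OF m0(1)] by (simp add: u_def m_assoc)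
    finally show ?thesis using m0(2) by (simp add: u_def)
  qed
  have pxu: "p x \<otimes> u = p x" if "x \<in> carrier M" for x
    using p[OF that] pu[OF that] gi p[OF m0(1)] by (simp add: u_def m_assoc[symmetric])
  \<comment> \<open>A preimage of \<open>u\<close>. It splits the coordinate map, and
    \<open>s\<close> below is the resulting projection onto the kernel \<open>K\<close>.\<close>
  define m1 where "m1 = u \<odot>\<^bsub>M\<^esub> m0"
  have m1: "m1 \<in> carrier M" using uc m0 by (simp add: m1_def M.smult_closed)
  have pm1: "p m1 = u" using uc m0 gi p[OF m0(1)] by (simp add: m1_def p_smult u_def m_assoc)
  define K where "K = M\<lparr>carrier := {x \<in> carrier M. p x = \<zero>}\<rparr>"
  have K: "carrier K = {x \<in> carrier M. p x = \<zero>}" "\<zero>\<^bsub>K\<^esub> = \<zero>\<^bsub>M\<^esub>" "add K = add M"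
    "module.smult K = module.smult M" by (simp_all add: K_def)
  have lK: "left_module R K"
  proof (rule left_moduleI)
    fix x assume x: "x \<in> carrier K"
    then have "p (\<ominus>\<^bsub>M\<^esub> x) = \<zero>" by (auto simp: K M.minus_eq_smult p_smult)
    with x show "\<exists>y\<in>carrier K. y \<oplus>\<^bsub>K\<^esub> x = \<zero>\<^bsub>K\<^esub>"
      by (intro bexI[of _ "\<ominus>\<^bsub>M\<^esub> x"]) (auto simp: K M.M.l_neg)
  next
    fix x y assume "x \<in> carrier K" "y \<in> carrier K"
    then show "x \<oplus>\<^bsub>K\<^esub> y = y \<oplus>\<^bsub>K\<^esub> x" by (auto simp: K M.M.a_comm)
  qed (auto simp: K ring_axioms p_zero p_add p_smult M.smult_closed M.M.a_assoc M.smult_l_distr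
      M.smult_r_distr M.smult_assoc M.smult_one)
  define s where "s = (\<lambda>x. x \<oplus>\<^bsub>M\<^esub> (\<ominus> p x) \<odot>\<^bsub>M\<^esub> m1)"
  have sc: "s x \<in> carrier K" if "x \<in> carrier M" for x
    using that p[OF that] uc m1 pxu[OF that]
    by (simp add: s_def K M.smult_closed p_add p_smult pm1 l_minus r_neg)
  have s_split: "x = s x \<oplus>\<^bsub>M\<^esub> p x \<odot>\<^bsub>M\<^esub> m1" if "x \<in> carrier M" for x
    using that p[OF that] m1
    by (simp add: s_def M.smult_closed M.M.a_assoc M.smult_l_minus M.M.l_neg)
  have s_hom: "s \<in> left_module_hom R M K"
  proof (rule left_module_homI)
    fix x y assume xy: "x \<in> carrier M" "y \<in> carrier M"
    have "\<ominus> (p x \<oplus> p y) = \<ominus> p x \<oplus> \<ominus> p y" using xy p by (simp add: minus_add)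
    then show "s (x \<oplus>\<^bsub>M\<^esub> y) = s x \<oplus>\<^bsub>K\<^esub> s y"
      using xy p m1 by (simp add: s_def K p_add M.smult_l_distr M.smult_closed M.M.a_ac)
  next
    fix a x assume "a \<in> carrier R" "x \<in> carrier M"
    then show "s (a \<odot>\<^bsub>M\<^esub> x) = a \<odot>\<^bsub>K\<^esub> s x"
      using p m1 by (simp add: s_def K p_smult M.smult_r_distr M.smult_closed M.smult_assoc[symmetric] r_minus)
  qed (rule sc)
  have sK: "s x = x" if "x \<in> carrier K" for x
    using that m1 by (simp add: s_def K M.smult_l_zero)
  have "fin_gen_module R K"
  proof (rule fin_gen_surj[OF M.left_module_axioms lK s_hom _ insert.prems(3)])
    show "s ` carrier M = carrier K" using sc sK K(1) by (auto simp: image_iff) metis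
  qed
  moreover have "(\<lambda>x. restrict (h x) I) \<in> left_module_hom R K (sum_mod R I g)"
  proof (rule left_module_homI)
    fix x assume "x \<in> carrier K"
    then show "restrict (h x) I \<in> carrier (sum_mod R I g)" using h(1)[of x] by (simp add: K sum_mod_simps)
  qed (auto simp: K h sum_mod_simps fun_eq_iff)
  moreover have "inj_on (\<lambda>x. restrict (h x) I) (carrier K)"
  proof (rule inj_onI)
    fix x y assume xy: "x \<in> carrier K" "y \<in> carrier K" and eq: "restrict (h x) I = restrict (h y) I"
    have "h x = h y"
    proof (rule extensionalityI[of _ "insert i I"])
      fix j assume "j \<in> insert i I"
      then show "h x j = h y j" using xy fun_cong[OF eq, of j] by (auto simp: K p_def)
    qed (use xy h(1) in \<open>auto simp: K sum_mod_simps\<close>)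
    then show "x = y" using insert.prems(5) xy by (auto simp: K inj_on_def)
  qed
  ultimately obtain e where e: "\<forall>i\<in>I. idem R (e i) \<and> g i \<otimes> e i = e i \<and> e i \<otimes> g i = e i"
    and "left_module_isomorphic R K (sum_mod R I e)"
    using insert.IH[OF _ lK, of "\<lambda>x. restrict (h x) I"] insert.prems(1) by blast
  then obtain k where k: "k \<in> left_module_hom R K (sum_mod R I e)" "bij_betw k (carrier K) (carrier (sum_mod R I e))"
    by (auto simp: left_module_isomorphic_def)
  note kh = left_module_homD[OF k(1)]
  let ?e = "e(i := u)"
  have eq: "sum_mod R I ?e = sum_mod R I e"
    using insert.hyps by (auto simp: sum_mod_def)
  have "left_module_isomorphic R M (module_direct_sum (cyc_mod R u) (sum_mod R I e))"
  proof (rule left_module_isomorphicI[of "\<lambda>x. (p x, k (s x))"])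
    show "(\<lambda>x. (p x, k (s x))) \<in> left_module_hom R M (module_direct_sum (cyc_mod R u) (sum_mod R I e))"
      by (rule left_module_homI)
        (simp_all add: module_direct_sum_simps cyc_mod_simps p pxu kh sc p_add p_smult left_module_homD[OF s_hom])
    show "inj_on (\<lambda>x. (p x, k (s x))) (carrier M)"
    proof (rule inj_onI)
      fix x y assume xy: "x \<in> carrier M" "y \<in> carrier M" "(p x, k (s x)) = (p y, k (s y))"
      then have "s x = s y" using k(2) sc by (auto simp: bij_betw_def inj_on_def)
      then show "x = y" using s_split[OF xy(1)] s_split[OF xy(2)] xy(3) by simp
    qed
    fix y assume y: "y \<in> carrier (module_direct_sum (cyc_mod R u) (sum_mod R I e))"
    obtain r z where rz: "y = (r, z)" by (cases y)
    have r: "r \<in> carrier R" "r \<otimes> u = r" and z: "z \<in> carrier (sum_mod R I e)"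
      using y by (auto simp: rz module_direct_sum_simps cyc_mod_simps)
    obtain t where t: "t \<in> carrier K" "k t = z" using k(2) z unfolding bij_betw_def by (metis imageE)
    let ?x = "t \<oplus>\<^bsub>M\<^esub> r \<odot>\<^bsub>M\<^esub> m1"
    have tM: "t \<in> carrier M" "p t = \<zero>" using t by (auto simp: K)
    have x: "?x \<in> carrier M" using tM r m1 by (simp add: M.smult_closed)
    have px: "p ?x = r" using tM r m1 by (simp add: p_add p_smult pm1 M.smult_closed)
    have "s ?x = t"
      using tM r m1 by (simp add: s_def px M.smult_closed M.M.a_assoc M.smult_l_minus M.M.r_neg)
    then show "\<exists>x\<in>carrier M. (p x, k (s x)) = y" using x px t rz by auto
  qed
  moreover have "left_module_isomorphic R (module_direct_sum (cyc_mod R u) (sum_mod R I e)) (sum_mod R (insert i I) ?e)"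
  proof (rule left_module_isomorphic_sym)
    show "left_module R (sum_mod R (insert i I) ?e)"
      using e uc uu by (intro left_module_sum_mod) (auto simp: idem_def)
    show "left_module_isomorphic R (sum_mod R (insert i I) ?e) (module_direct_sum (cyc_mod R u) (sum_mod R I e))"
      using sum_mod_insert[OF insert.hyps(2), of ?e] by (simp add: eq)
  qed
  ultimately have "left_module_isomorphic R M (sum_mod R (insert i I) ?e)"
    by (rule left_module_isomorphic_trans)
  moreover have "\<forall>j\<in>insert i I. idem R (?e j) \<and> g j \<otimes> ?e j = ?e j \<and> ?e j \<otimes> g j = ?e j"
    using e uc uu ug insert.hyps by (auto simp: idem_def)
  ultimately show ?case by blast
qed

text \<open>The basis of the free module may be infinite, but finitely many generators involve only
  finitely many coordinates, so the module embeds into a finite sum of copies of R.\<close>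

lemma (in ring) fgp_decompose:
  assumes reg: "\<And>a. a \<in> carrier R \<Longrightarrow> \<exists>x\<in>carrier R. a = a \<otimes> x \<otimes> a"
    and P: "fgp_module R (P :: ('a, 'm) module)"
  shows "\<exists>(I :: 'm set) e. finite I \<and> (\<forall>i\<in>I. idem R (e i)) \<and> left_module_isomorphic R P (sum_mod R I e)"
proof -
  interpret P: left_module R P using P by (simp add: fgp_module_def)
  obtain I :: "'m set" and Q :: "('a, 'm \<Rightarrow> 'a) module"
    where Q: "left_module R Q" and iso: "left_module_isomorphic R (module_direct_sum P Q) (free_left_module R I)"
    using P by (auto simp: fgp_module_def projective_module_def)
  interpret Q: left_module R Q by fact
  obtain f where f: "f \<in> left_module_hom R (module_direct_sum P Q) (free_left_module R I)"
    "inj_on f (carrier (module_direct_sum P Q))"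
    using iso by (auto simp: left_module_isomorphic_def bij_betw_def)
  note fh = left_module_homD[OF f(1)]
  define h where "h = (\<lambda>x. f (x, \<zero>\<^bsub>Q\<^esub>))"
  have hc: "h x \<in> I \<rightarrow>\<^sub>E carrier R" "finite {i \<in> I. h x i \<noteq> \<zero>}" if "x \<in> carrier P" for x
    using fh(1)[of "(x, \<zero>\<^bsub>Q\<^esub>)"] that by (auto simp: h_def module_direct_sum_simps free_left_module_def)
  have hadd: "h (x \<oplus>\<^bsub>P\<^esub> y) = (\<lambda>i\<in>I. h x i \<oplus> h y i)" if "x \<in> carrier P" "y \<in> carrier P" for x y
    using fh(2)[of "(x, \<zero>\<^bsub>Q\<^esub>)" "(y, \<zero>\<^bsub>Q\<^esub>)"] that by (auto simp: h_def module_direct_sum_simps free_left_module_def)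
  have hsmult: "h (a \<odot>\<^bsub>P\<^esub> x) = (\<lambda>i\<in>I. a \<otimes> h x i)" if "a \<in> carrier R" "x \<in> carrier P" for a x
    using fh(3)[of a "(x, \<zero>\<^bsub>Q\<^esub>)"] that
    by (auto simp: h_def module_direct_sum_simps free_left_module_def Q.smult_r_zero)
  obtain S where S: "S \<subseteq> carrier P" "finite S"
    and gen: "\<And>H. submodule_set R P H \<Longrightarrow> S \<subseteq> H \<Longrightarrow> carrier P \<subseteq> H"
    using P P.fin_gen_iff by (auto simp: fgp_module_def)
  define J where "J = (\<Union>s\<in>S. {i \<in> I. h s i \<noteq> \<zero>})"
  have J: "finite J" "J \<subseteq> I" using S hc(2) by (auto simp: J_def)
  let ?H = "{x \<in> carrier P. \<forall>i\<in>I - J. h x i = \<zero>}"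
  have "h \<zero>\<^bsub>P\<^esub> i = \<zero>" if "i \<in> I" for i
  proof -
    have "h \<zero>\<^bsub>P\<^esub> i \<in> carrier R" using that hc(1)[of "\<zero>\<^bsub>P\<^esub>"] by (simp add: PiE_iff)
    moreover have "h (\<zero> \<odot>\<^bsub>P\<^esub> \<zero>\<^bsub>P\<^esub>) i = \<zero> \<otimes> h \<zero>\<^bsub>P\<^esub> i"
      using that by (simp add: hsmult)
    ultimately show ?thesis by (metis P.smult_l_zero P.M.zero_closed l_null)
  qed
  then have "submodule_set R P ?H"
    by (auto simp: submodule_set_def hadd hsmult P.smult_closed)
  moreover have "S \<subseteq> ?H" using S by (auto simp: J_def)
  ultimately have supp: "h x i = \<zero>" if "x \<in> carrier P" "i \<in> I" "i \<notin> J" for x i using gen that by blast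
  have "(\<lambda>x. restrict (h x) J) \<in> left_module_hom R P (sum_mod R J (\<lambda>_. \<one>))"
    using J(2) hc(1) by (intro left_module_homI) (auto simp: sum_mod_simps hadd hsmult PiE_iff fun_eq_iff subset_iff)
  moreover have "inj_on (\<lambda>x. restrict (h x) J) (carrier P)"
  proof (rule inj_onI)
    fix x y assume xy: "x \<in> carrier P" "y \<in> carrier P" and eq: "restrict (h x) J = restrict (h y) J"
    have "h x = h y"
    proof (rule extensionalityI[of _ I])
      fix j assume "j \<in> I"
      then show "h x j = h y j" using xy supp fun_cong[OF eq, of j] by (cases "j \<in> J") auto
    qed (use xy hc(1) in \<open>auto simp: PiE_iff\<close>)
    then show "x = y" using inj_onD[OF f(2), of "(x, \<zero>\<^bsub>Q\<^esub>)" "(y, \<zero>\<^bsub>Q\<^esub>)"] xy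
      by (simp add: h_def module_direct_sum_simps)
  qed
  moreover have "fin_gen_module R P" using P by (simp add: fgp_module_def)
  moreover have "\<forall>i\<in>J. idem R \<one>" by (simp add: idem_def)
  ultimately obtain e where "\<forall>i\<in>J. idem R (e i)" "left_module_isomorphic R P (sum_mod R J e)"
    using fin_gen_embedded_sum[OF reg J(1), of "\<lambda>_. \<one>" P "\<lambda>x. restrict (h x) J"] P.left_module_axioms
    by blast
  then show ?thesis using J(1) by blast
qed

section \<open>A criterion for computing V(R)\<close>

lemma sum_mod_cong: "(\<And>i. i \<in> I \<Longrightarrow> e i = e' i) \<Longrightarrow> sum_mod R I e = sum_mod R I e'"
  by (auto simp: sum_mod_def)

locale idem_family = ring R for R :: "('a, 's) ring_scheme" (structure) +
  fixes E :: "'g \<Rightarrow> 'a"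
  assumes regular: "a \<in> carrier R \<Longrightarrow> \<exists>x\<in>carrier R. a = a \<otimes> x \<otimes> a"
    and idem_E: "idem R (E g)"
    and one_not_zero: "\<one> \<noteq> \<zero>"
begin

definition list_mod :: "'g list \<Rightarrow> ('a, nat \<Rightarrow> 'a) module" where
  "list_mod xs = sum_mod R {..<length xs} (\<lambda>i. E (xs ! i))"

text \<open>A multiset carries no order of its elements, so one is chosen; by
  \<open>list_mod_perm\<close> the isomorphism class does not depend on it.\<close>

definition std_mod :: "'g multiset \<Rightarrow> ('a, nat \<Rightarrow> 'a) module" where
  "std_mod u = list_mod (SOME xs. mset xs = u)"

definition rep :: "'a \<Rightarrow> 'g multiset \<Rightarrow> bool" where
  "rep e u \<longleftrightarrow> left_module_isomorphic R (cyc_mod R e) (std_mod u)"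

lemma left_module_list_mod: "left_module R (list_mod xs)"
  unfolding list_mod_def using idem_E by (intro left_module_sum_mod_idem) auto

lemma left_module_std_mod: "left_module R (std_mod u)"
  unfolding std_mod_def by (rule left_module_list_mod)

lemma fgp_std_mod: "fgp_module R (std_mod u)"
  unfolding std_mod_def list_mod_def using idem_E one_not_zero by (intro fgp_sum_mod) auto

lemma list_mod_perm:
  assumes "mset xs = mset ys"
  shows "left_module_isomorphic R (list_mod ys) (list_mod xs)"
proof -
  obtain p where p: "p permutes {..<length ys}" "permute_list p ys = xs"
    using mset_eq_permutation[OF assms] by blast
  have len: "length xs = length ys" using assms mset_eq_length by blast
  have b: "bij_betw p {..<length xs} {..<length ys}" using permutes_imp_bij[OF p(1)] len by simp
  have nth: "E (ys ! p i) = E (xs ! i)" if "i \<in> {..<length xs}" for i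
    using permute_list_nth[OF p(1)] p(2) that len by auto
  show ?thesis
    unfolding list_mod_def by (rule sum_mod_reindex[where b = p, OF b]) (use nth in auto)
qed

lemma std_mod_mset: "left_module_isomorphic R (list_mod xs) (std_mod (mset xs))"
  unfolding std_mod_def by (rule list_mod_perm) (metis (mono_tags, lifting) someI)

lemma list_mod_append:
  "left_module_isomorphic R (list_mod (xs @ ys)) (module_direct_sum (list_mod xs) (list_mod ys))"
proof -
  let ?m = "length xs" and ?n = "length ys"
  let ?e = "\<lambda>i. E ((xs @ ys) ! i)"
  have I: "{..<length (xs @ ys)} = {..<?m} \<union> {?m..<?m + ?n}" by auto
  have 1: "left_module_isomorphic R (list_mod (xs @ ys))
      (module_direct_sum (sum_mod R {..<?m} ?e) (sum_mod R {?m..<?m + ?n} ?e))"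
    unfolding list_mod_def I by (rule sum_mod_append) auto
  have 2: "sum_mod R {..<?m} ?e = list_mod xs"
    unfolding list_mod_def by (rule sum_mod_cong) (auto simp: nth_append)
  have b: "bij_betw (\<lambda>i. i + ?m) {..<?n} {?m..<?m + ?n}"
    by (rule bij_betwI[where g = "\<lambda>i. i - ?m"]) auto
  have 3: "left_module_isomorphic R (sum_mod R {?m..<?m + ?n} ?e) (list_mod ys)"
    unfolding list_mod_def by (rule sum_mod_reindex[OF b]) (simp add: nth_append)
  show ?thesis
    using left_module_isomorphic_trans[OF 1 module_direct_sum_cong[OF left_module_isomorphic_refl 3]]
    by (simp add: 2)
qed

lemma std_mod_add:
  "left_module_isomorphic R (module_direct_sum (std_mod u) (std_mod v)) (std_mod (u + v))"
proof -
  obtain xs ys where u: "u = mset xs" "v = mset ys" using ex_mset by metis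
  have a: "left_module_isomorphic R (std_mod (u + v)) (list_mod (xs @ ys))"
    using left_module_isomorphic_sym[OF left_module_list_mod std_mod_mset[of "xs @ ys"]] by (simp add: u)
  have b: "left_module_isomorphic R (std_mod (u + v)) (module_direct_sum (std_mod u) (std_mod v))"
    using left_module_isomorphic_trans[OF left_module_isomorphic_trans[OF a list_mod_append]
        module_direct_sum_cong[OF std_mod_mset std_mod_mset]] by (simp add: u)
  show ?thesis by (rule left_module_isomorphic_sym[OF left_module_std_mod b])
qed

lemma rep_gen: "rep (E g) {#g#}"
proof -
  have "left_module_isomorphic R (list_mod [g]) (cyc_mod R (E g))"
    using sum_mod_singleton[of 0 "\<lambda>i. E ([g] ! i)"] by (simp add: list_mod_def lessThan_Suc)
  from left_module_isomorphic_trans[OF left_module_isomorphic_sym[OF left_module_list_mod this] std_mod_mset]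
  show ?thesis by (simp add: rep_def)
qed

lemma rep_zero: "rep \<zero> {#}"
proof -
  have "left_module_isomorphic R (cyc_mod R \<zero>) (list_mod [])"
    using cyc_mod_zero[of "\<lambda>i. E ([] ! i)"] by (simp add: list_mod_def)
  from left_module_isomorphic_trans[OF this std_mod_mset] show ?thesis by (simp add: rep_def)
qed

lemma rep_equiv:
  assumes "a \<in> carrier R" "b \<in> carrier R" "a \<otimes> b = e" "e \<otimes> e = e" "b \<otimes> a = f" "f \<otimes> f = f" "rep f u"
  shows "rep e u"
  using left_module_isomorphic_trans[OF cyc_mod_equiv[OF assms(1-6)]] assms(7) by (simp add: rep_def)

lemma rep_add:
  assumes "e \<in> carrier R" "f \<in> carrier R" "e \<otimes> e = e" "f \<otimes> f = f" "e \<otimes> f = \<zero>" "f \<otimes> e = \<zero>"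
    and "rep e u" "rep f v"
  shows "rep (e \<oplus> f) (u + v)"
  using left_module_isomorphic_trans[OF left_module_isomorphic_trans[OF cyc_mod_add[OF assms(1-6)]
        module_direct_sum_cong[OF assms(7,8)[unfolded rep_def]]] std_mod_add]
  by (simp add: rep_def)

lemma sum_mod_rep:
  assumes "finite I" "\<And>i. i \<in> I \<Longrightarrow> \<exists>u. rep (e i) u"
  shows "\<exists>u. left_module_isomorphic R (sum_mod R I e) (std_mod u)"
  using assms
proof (induction I rule: finite_induct)
  case empty
  have "left_module_isomorphic R (sum_mod R {} e) (list_mod [])"
    using sum_mod_empty_isomorphic by (simp add: list_mod_def)
  from left_module_isomorphic_trans[OF this std_mod_mset] show ?case by blast
next
  case (insert i I)
  then obtain u where u: "left_module_isomorphic R (sum_mod R I e) (std_mod u)" by auto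
  obtain v where v: "rep (e i) v" using insert.prems by auto
  show ?case
    using left_module_isomorphic_trans[OF left_module_isomorphic_trans[OF sum_mod_insert[OF insert.hyps(2)]
        module_direct_sum_cong[OF v[unfolded rep_def] u]] std_mod_add] by blast
qed

text \<open>If xe = x, then x is the sum of the x r_i g_i c_i, so the vector of the x r_i g_i
  determines x. This embeds Re into the sum of the R g_i, where finitely generated submodules are
  sums of modules given by idempotents in the corners of the g_i.\<close>

lemma rep_embedded:
  assumes "finite I" and e: "idem R e" and g: "\<And>i. i \<in> I \<Longrightarrow> idem R (g i)"
    and rc: "\<And>i. i \<in> I \<Longrightarrow> r i \<in> carrier R \<and> c i \<in> carrier R"
    and sum: "e = (\<Oplus>i\<in>I. r i \<otimes> g i \<otimes> c i)"
    and reps: "\<And>i h. \<lbrakk>i \<in> I; idem R h; g i \<otimes> h = h; h \<otimes> g i = h\<rbrakk> \<Longrightarrow> \<exists>u. rep h u"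
  shows "\<exists>u. rep e u"
proof -
  have ec: "e \<in> carrier R" "e \<otimes> e = e" using e by (auto simp: idem_def)
  have gc: "g i \<in> carrier R" "g i \<otimes> g i = g i" if "i \<in> I" for i using g[OF that] by (auto simp: idem_def)
  interpret C: left_module R "cyc_mod R e" by (rule left_module_cyc_mod[OF ec(1)])
  let ?h = "\<lambda>x. \<lambda>i\<in>I. x \<otimes> r i \<otimes> g i"
  have hom: "?h \<in> left_module_hom R (cyc_mod R e) (sum_mod R I g)"
    using rc gc by (intro left_module_homI) (auto simp: cyc_mod_simps sum_mod_simps fun_eq_iff l_distr m_assoc)
  have inj: "inj_on ?h (carrier (cyc_mod R e))"
  proof (rule inj_onI)
    fix x y assume xy: "x \<in> carrier (cyc_mod R e)" "y \<in> carrier (cyc_mod R e)" and eq: "?h x = ?h y"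
    have exp: "x = (\<Oplus>i\<in>I. (x \<otimes> r i \<otimes> g i) \<otimes> c i)" if "x \<in> carrier (cyc_mod R e)" for x
    proof -
      have x: "x \<in> carrier R" "x \<otimes> e = x" using that by (auto simp: cyc_mod_simps)
      have "x \<otimes> e = (\<Oplus>i\<in>I. x \<otimes> (r i \<otimes> g i \<otimes> c i))"
        unfolding sum using x(1) rc gc assms(1) by (intro finsum_rdistr) auto
      also have "\<dots> = (\<Oplus>i\<in>I. (x \<otimes> r i \<otimes> g i) \<otimes> c i)"
        using x(1) rc gc by (intro finsum_cong') (auto simp: m_assoc)
      finally show ?thesis using x by simp
    qed
    have "x = (\<Oplus>i\<in>I. (x \<otimes> r i \<otimes> g i) \<otimes> c i)" by (rule exp[OF xy(1)])
    also have "\<dots> = (\<Oplus>i\<in>I. (y \<otimes> r i \<otimes> g i) \<otimes> c i)"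
    proof (intro finsum_cong')
      fix i assume i: "i \<in> I"
      then show "x \<otimes> r i \<otimes> g i \<otimes> c i = y \<otimes> r i \<otimes> g i \<otimes> c i"
        using fun_cong[OF eq, of i] by simp
    qed (use xy rc gc in \<open>auto simp: cyc_mod_simps\<close>)
    also have "\<dots> = y" by (rule exp[OF xy(2), symmetric])
    finally show "x = y" .
  qed
  have "fin_gen_module R (cyc_mod R e)"
    unfolding C.fin_gen_iff
  proof (intro exI[of _ "{e}"] conjI allI impI subsetI)
    fix H x assume H: "submodule_set R (cyc_mod R e) H" "{e} \<subseteq> H" and x: "x \<in> carrier (cyc_mod R e)"
    then show "x \<in> H" using submodule_setD(2)[OF H(1), of x e] by (simp add: cyc_mod_simps)
  qed (use ec in \<open>auto simp: cyc_mod_simps\<close>)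
  moreover have "\<forall>i\<in>I. idem R (g i)" using g by blast
  ultimately obtain e' where e': "\<forall>i\<in>I. idem R (e' i) \<and> g i \<otimes> e' i = e' i \<and> e' i \<otimes> g i = e' i"
    and iso: "left_module_isomorphic R (cyc_mod R e) (sum_mod R I e')"
    using fin_gen_embedded_sum[OF regular assms(1) _ C.left_module_axioms _ hom inj] by blast
  have "\<exists>u. rep (e' i) u" if "i \<in> I" for i using reps[OF that] e' that by blast
  then show ?thesis
    using sum_mod_rep[OF assms(1)] left_module_isomorphic_trans[OF iso] unfolding rep_def by blast
qed

lemma std_mod_cong:
  assumes rels: "\<And>u v. (u, v) \<in> rels \<Longrightarrow> \<exists>e\<in>carrier R. rep e u \<and> rep e v"
    and "pres_cong rels u v"
  shows "left_module_isomorphic R (std_mod u) (std_mod v)"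
  using assms(2)
proof (induction rule: pres_cong.induct)
  case (rel u v)
  then obtain e where e: "e \<in> carrier R" "rep e u" "rep e v" using rels by blast
  then show ?case
    using left_module_isomorphic_sym[OF left_module_cyc_mod[OF e(1)]] left_module_isomorphic_trans
    unfolding rep_def by blast
next
  case (refl u)
  show ?case by (rule left_module_isomorphic_refl)
next
  case (sym u v)
  then show ?case using left_module_isomorphic_sym[OF left_module_std_mod] by blast
next
  case (trans u v t)
  then show ?case using left_module_isomorphic_trans by blast
next
  case (add u v t)
  show ?case
    by (rule left_module_isomorphic_trans[OF left_module_isomorphic_sym[OF
        left_module_direct_sum[OF left_module_std_mod left_module_std_mod] std_mod_add]
        left_module_isomorphic_trans[OF module_direct_sum_cong[OF add.IH left_module_isomorphic_refl] std_mod_add]])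
qed

text \<open>The assumptions say in turn that the map from words to isomorphism classes is well
  defined on the presented monoid, surjective and injective.\<close>

theorem V_monoid_iso:
  assumes rels: "\<And>u v. (u, v) \<in> rels \<Longrightarrow> \<exists>e\<in>carrier R. rep e u \<and> rep e v"
    and gen: "\<And>e. idem R e \<Longrightarrow> \<exists>u. rep e u"
    and inj: "\<And>u v. left_module_isomorphic R (std_mod u) (std_mod v) \<Longrightarrow> pres_cong rels u v"
  shows "V_monoid R \<cong> presented_comm_monoid rels"
proof -
  note cong_iso = std_mod_cong[OF rels]
  define cl where "cl = (\<lambda>u. iso_class R (std_mod u))"
  have class_eq: "iso_class R P = iso_class R Q" if "left_module R P" "left_module_isomorphic R P Q"
    for P :: "('a, 'm) module" and Q :: "('a, 'n) module"
    using left_module_isomorphic_trans[OF left_module_isomorphic_sym[OF that]]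
      left_module_isomorphic_trans[OF that(2)] by (auto simp: iso_class_def)
  have cl_eq: "cl u = cl v \<longleftrightarrow> pres_cong rels u v" for u v
  proof
    assume "cl u = cl v"
    moreover have "std_mod v \<in> cl v"
      using fgp_std_mod left_module_isomorphic_refl by (simp add: cl_def iso_class_def)
    ultimately have "std_mod v \<in> cl u" by simp
    then have "left_module_isomorphic R (std_mod u) (std_mod v)" by (simp add: cl_def iso_class_def)
    then show "pres_cong rels u v" by (rule inj)
  next
    assume "pres_cong rels u v"
    then show "cl u = cl v" unfolding cl_def by (intro class_eq left_module_std_mod cong_iso)
  qed
  have carrier_V: "carrier (V_monoid R) = range cl"
  proof -
    have "\<exists>u. iso_class R P = cl u" if "fgp_module R P" for P :: "('a, nat \<Rightarrow> 'a) module"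
    proof -
      obtain I :: "(nat \<Rightarrow> 'a) set" and e where I: "finite I" "\<forall>i\<in>I. idem R (e i)"
        and iso: "left_module_isomorphic R P (sum_mod R I e)"
        using fgp_decompose[OF regular \<open>fgp_module R P\<close>] by blast
      obtain u where "left_module_isomorphic R (sum_mod R I e) (std_mod u)"
        using sum_mod_rep[OF I(1)] I(2) gen by blast
      then have "iso_class R P = cl u"
        unfolding cl_def using that left_module_isomorphic_trans[OF iso]
        by (intro class_eq) (auto simp: fgp_module_def)
      then show ?thesis ..
    qed
    then have "{iso_class R P |P :: ('a, nat \<Rightarrow> 'a) module. fgp_module R P} \<subseteq> range cl" by blast
    moreover have "cl u \<in> {iso_class R P |P :: ('a, nat \<Rightarrow> 'a) module. fgp_module R P}" for u
      unfolding cl_def using fgp_std_mod by blast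
    then have "range cl \<subseteq> {iso_class R P |P :: ('a, nat \<Rightarrow> 'a) module. fgp_module R P}" by blast
    ultimately show ?thesis by (simp add: V_monoid_def)
  qed
  have mult_V: "cl u \<otimes>\<^bsub>V_monoid R\<^esub> cl v = cl (u + v)" for u v
  proof -
    have ds: "iso_class R (module_direct_sum P Q) = cl (u + v)" if "P \<in> cl u" "Q \<in> cl v" for P Q
    proof -
      have PQ: "left_module R P" "left_module R Q" "left_module_isomorphic R P (std_mod u)"
        "left_module_isomorphic R Q (std_mod v)"
        using that left_module_isomorphic_sym[OF left_module_std_mod]
        by (auto simp: cl_def iso_class_def fgp_module_def)
      show ?thesis
        unfolding cl_def
        by (rule class_eq[OF left_module_direct_sum[OF PQ(1,2)]
            left_module_isomorphic_trans[OF module_direct_sum_cong[OF PQ(3,4)] std_mod_add]])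
    qed
    have "std_mod u \<in> cl u" "std_mod v \<in> cl v"
      using fgp_std_mod left_module_isomorphic_refl by (auto simp: cl_def iso_class_def)
    \<comment> \<open>All representatives give the same class, so the union in the definition of the
      product collapses, provided that the classes are inhabited.\<close>
    have "(\<Union>P\<in>cl u. \<Union>Q\<in>cl v. iso_class R (module_direct_sum P Q)) = (\<Union>P\<in>cl u. \<Union>Q\<in>cl v. cl (u + v))"
      by (intro SUP_cong) (simp_all add: ds)
    also have "\<dots> = cl (u + v)" proof -
      have "cl u \<noteq> {}" "cl v \<noteq> {}" using \<open>std_mod u \<in> cl u\<close> \<open>std_mod v \<in> cl v\<close> by blast+
      then show ?thesis by (simp only: UN_constant if_False)
    qed
    finally show ?thesis by (simp add: V_monoid_def)
  qed
  \<comment> \<open>The words that represent a given class; by \<open>cl_eq\<close> they form a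
    congruence class.\<close>
  define f where "f = (\<lambda>X. {u. cl u = X})"
  have f_cl: "f (cl u) = {v. pres_cong rels u v}" for u
    unfolding f_def cl_eq[symmetric] by (rule Collect_cong) (rule eq_commute)
  have carrier_P: "carrier (presented_comm_monoid rels) = range (\<lambda>u. {v. pres_cong rels u v})"
    by (auto simp: presented_comm_monoid_def quotient_def)
  have mult_P: "{t. pres_cong rels u t} \<otimes>\<^bsub>presented_comm_monoid rels\<^esub> {t. pres_cong rels v t}
      = {t. pres_cong rels (u + v) t}" for u v
  proof -
    have "cl (u' + v') = cl (u + v)" if "pres_cong rels u u'" "pres_cong rels v v'" for u' v'
      using that mult_V cl_eq by metis
    then have "pres_cong rels (u' + v') t \<longleftrightarrow> pres_cong rels (u + v) t"
      if "pres_cong rels u u'" "pres_cong rels v v'" for u' v' t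
      using that cl_eq by metis
    then have "(\<Union>u'\<in>{t. pres_cong rels u t}. \<Union>v'\<in>{t. pres_cong rels v t}. {t. pres_cong rels (u' + v') t})
      = (\<Union>u'\<in>{t. pres_cong rels u t}. \<Union>v'\<in>{t. pres_cong rels v t}. {t. pres_cong rels (u + v) t})"
      by (intro SUP_cong refl) auto
    also have "\<dots> = {t. pres_cong rels (u + v) t}" proof -
      have "{t. pres_cong rels w t} \<noteq> {}" for w using pres_cong.refl by blast
      then show ?thesis by (simp only: UN_constant if_False)
    qed
    finally show ?thesis by (simp add: presented_comm_monoid_def)
  qed
  have "f \<in> hom (V_monoid R) (presented_comm_monoid rels)"
    unfolding hom_def carrier_V carrier_P by (auto simp only: mult_V f_cl mult_P mem_Collect_eq Pi_iff image_iff)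
  moreover have "bij_betw f (carrier (V_monoid R)) (carrier (presented_comm_monoid rels))"
  proof (rule bij_betw_imageI)
    show "inj_on f (carrier (V_monoid R))"
      unfolding carrier_V by (rule inj_onI) (auto simp: f_def)
    show "f ` carrier (V_monoid R) = carrier (presented_comm_monoid rels)"
      unfolding carrier_V carrier_P image_image f_cl ..
  qed
  ultimately have "f \<in> iso (V_monoid R) (presented_comm_monoid rels)" by (simp add: iso_def)
  then show ?thesis by (auto simp: is_iso_def)
qed

end

section \<open>Normal forms in the presented monoid\<close>

abbreviation M_cong :: "gen multiset \<Rightarrow> gen multiset \<Rightarrow> bool" (infix "\<approx>" 50) where
  "u \<approx> v \<equiv> pres_cong M_relations u v"

lemma pres_cong_add2:
  assumes "pres_cong rels u v" "pres_cong rels s t"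
  shows "pres_cong rels (u + s) (v + t)"
  using pres_cong.trans[OF pres_cong.add[OF assms(1), of s] pres_cong.add[OF assms(2), of v, unfolded add.commute[of _ v]]] .

lemma pres_cong_replicate:
  "pres_cong rels {#g#} v \<Longrightarrow> pres_cong rels (replicate_mset n g) (repeat_mset n v)"
proof (induction n)
  case (Suc n)
  then show ?case using pres_cong_add2[of rels "{#g#}" v] by simp
qed (simp add: pres_cong.refl)

text \<open>The rank at level \<open>n\<close> of the idempotent \<open>E g\<close> that will represent the generator \<open>g\<close>.\<close>

fun gen_rank :: "nat \<Rightarrow> gen \<Rightarrow> nat" where
  "gen_rank n (gen_x l) = n - 1 - l"
| "gen_rank n (gen_y l) = (if l < n then 1 else 0)"
| "gen_rank n (gen_z l) = (if l < n then 1 else 0)"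
| "gen_rank n (gen_a l) = (if n = Suc l then 1 else 0)"

definition rank_at :: "nat \<Rightarrow> gen multiset \<Rightarrow> nat" where
  "rank_at n u = sum_mset (image_mset (gen_rank n) u)"

lemma rank_at_simps [simp]:
  "rank_at n {#} = 0" "rank_at n (add_mset g u) = gen_rank n g + rank_at n u"
  "rank_at n (u + v) = rank_at n u + rank_at n v"
  "rank_at n (replicate_mset k g) = k * gen_rank n g"
  by (simp_all add: rank_at_def)

lemma rank_at_sum: "rank_at n (\<Sum>l\<in>S. f l) = (\<Sum>l\<in>S. rank_at n (f l))"
  by (induction S rule: infinite_finite_induct) simp_all

lemma rank_at_cong: "u \<approx> v \<Longrightarrow> rank_at n u = rank_at n v"
proof (induction rule: pres_cong.induct)
  case (rel u v)
  then show ?case by (auto simp: M_relations_def)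
qed auto

text \<open>Every relation but the first trades a generator for generators of higher index, so a
  word can be pushed to a common index \<open>L\<close>. What remains below are copies of a_1, ...,
  a_L, which \<open>k\<close> counts as \<open>gen_a 0\<close> up to
  \<open>gen_a (L - 1)\<close>.\<close>

definition normal_form :: "nat \<Rightarrow> nat \<Rightarrow> nat \<Rightarrow> nat \<Rightarrow> (nat \<Rightarrow> nat) \<Rightarrow> gen multiset" where
  "normal_form L m b c k = replicate_mset m (gen_x L) + replicate_mset b (gen_y L)
     + replicate_mset c (gen_z L) + (\<Sum>l<L. replicate_mset (k l) (gen_a l))"

lemma normal_form_add:
  "normal_form L m b c k + normal_form L m' b' c' k'
     = normal_form L (m + m') (b + b') (c + c') (\<lambda>l. k l + k' l)"
proof -
  have "replicate_mset (i + j) g = replicate_mset i g + replicate_mset j g" for i j and g :: gen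
    by (induction i) simp_all
  then show ?thesis by (simp add: normal_form_def sum.distrib)
qed

lemma normal_form_zero: "normal_form L 0 0 0 (\<lambda>_. 0) = {#}"
  by (simp add: normal_form_def)

text \<open>Of the two ways to expand x_L the one with y is always taken. Each y_L and each z_L
  leaves one copy of a_(L+1), whence the new value b + c of \<open>k\<close> at
  \<open>L\<close>.\<close>

lemma normal_form_step:
  "normal_form L m b c k \<approx> normal_form (Suc L) m (b + m) c (k(L := b + c))"
proof -
  have x: "{#gen_x L#} \<approx> {#gen_x (Suc L), gen_y (Suc L)#}"
    and y: "{#gen_y L#} \<approx> {#gen_y (Suc L), gen_a L#}"
    and z: "{#gen_z L#} \<approx> {#gen_z (Suc L), gen_a L#}"
    by (rule pres_cong.rel, force simp: M_relations_def)+
  have rep: "repeat_mset n {#g, h#} = replicate_mset n g + replicate_mset n h" for n and g h :: gen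
    by (induction n) simp_all
  have "normal_form L m b c k \<approx> repeat_mset m {#gen_x (Suc L), gen_y (Suc L)#}
      + repeat_mset b {#gen_y (Suc L), gen_a L#} + repeat_mset c {#gen_z (Suc L), gen_a L#}
      + (\<Sum>l<L. replicate_mset (k l) (gen_a l))"
    unfolding normal_form_def
    by (intro pres_cong_add2 pres_cong_replicate x y z pres_cong.refl)
  moreover have "(\<Sum>l<Suc L. replicate_mset ((k(L := b + c)) l) (gen_a l))
      = (\<Sum>l<L. replicate_mset (k l) (gen_a l)) + replicate_mset (b + c) (gen_a L)"
    by simp
  moreover have "replicate_mset (i + j) g = replicate_mset i g + replicate_mset j g" for i j and g :: gen
    by (induction i) simp_all
  ultimately show ?thesis by (simp add: normal_form_def rep ac_simps)
qed

text \<open>The side condition records that only an x produces new y's.\<close>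

lemma normal_form_raise:
  assumes "L \<le> L'"
  shows "\<exists>b' c' k'. normal_form L m b c k \<approx> normal_form L' m b' c' k' \<and> (m = 0 \<longrightarrow> b' = b \<and> c' = c)"
  using assms
proof (induction L' rule: dec_induct)
  case base
  show ?case using pres_cong.refl by blast
next
  case (step L')
  then obtain b' c' k' where "normal_form L m b c k \<approx> normal_form L' m b' c' k'" "m = 0 \<longrightarrow> b' = b \<and> c' = c"
    by blast
  then have "normal_form L m b c k \<approx> normal_form (Suc L') m (b' + m) c' (k'(L' := b' + c'))"
    "m = 0 \<longrightarrow> b' + m = b \<and> c' = c"
    using pres_cong.trans[OF _ normal_form_step[of L' m b' c' k']] by auto
  then show ?case by blast
qed

text \<open>The least \<open>L\<close> whose normal form has room for the generator; for a_(l+1)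
  this is l + 1.\<close>

fun gen_index :: "gen \<Rightarrow> nat" where
  "gen_index (gen_x l) = l" | "gen_index (gen_y l) = l" | "gen_index (gen_z l) = l"
| "gen_index (gen_a l) = Suc l"

fun gen_type :: "gen \<Rightarrow> nat" where
  "gen_type (gen_x l) = 0" | "gen_type (gen_y l) = 1" | "gen_type (gen_z l) = 2" | "gen_type (gen_a l) = 3"

definition type_count :: "nat \<Rightarrow> gen multiset \<Rightarrow> nat" where
  "type_count t u = size (filter_mset (\<lambda>g. gen_type g = t) u)"

lemma type_count_simps [simp]:
  "type_count t {#} = 0" "type_count t (add_mset g u) = (if gen_type g = t then 1 else 0) + type_count t u"
  by (simp_all add: type_count_def)

lemma gen_normal_form:
  assumes "gen_index g \<le> L"
  shows "\<exists>b c k. {#g#} \<approx> normal_form L (type_count 0 {#g#}) b c k \<and>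
           (type_count 0 {#g#} = 0 \<longrightarrow> b = type_count 1 {#g#} \<and> c = type_count 2 {#g#})"
proof -
  have "\<exists>k. {#g#} = normal_form (gen_index g) (type_count 0 {#g#}) (type_count 1 {#g#}) (type_count 2 {#g#}) k"
  proof (cases g)
    case (gen_a l)
    have "(\<Sum>i<Suc l. replicate_mset (if i = l then 1 else 0) (gen_a i)) = {#gen_a l#}" by simp
    then show ?thesis using gen_a by (intro exI[of _ "\<lambda>i. if i = l then 1 else 0"]) (simp add: normal_form_def)
  qed (auto intro!: exI[of _ "\<lambda>_. 0"] simp: normal_form_def)
  then show ?thesis using normal_form_raise[OF assms] by metis
qed

lemma exists_normal_form:
  assumes "\<And>g. g \<in># u \<Longrightarrow> gen_index g \<le> L"
  shows "\<exists>b c k. u \<approx> normal_form L (type_count 0 u) b c k \<and>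
           (type_count 0 u = 0 \<longrightarrow> b = type_count 1 u \<and> c = type_count 2 u)"
  using assms
proof (induction u)
  case empty
  show ?case using normal_form_zero pres_cong.refl by (intro exI[of _ 0] exI[of _ "\<lambda>_. 0"]) simp
next
  case (add g u)
  then obtain b c k where u: "u \<approx> normal_form L (type_count 0 u) b c k"
    "type_count 0 u = 0 \<longrightarrow> b = type_count 1 u \<and> c = type_count 2 u" by auto
  obtain b' c' k' where g: "{#g#} \<approx> normal_form L (type_count 0 {#g#}) b' c' k'"
    "type_count 0 {#g#} = 0 \<longrightarrow> b' = type_count 1 {#g#} \<and> c' = type_count 2 {#g#}"
    using gen_normal_form[of g L] add.prems by auto
  have "add_mset g u \<approx> normal_form L (type_count 0 (add_mset g u)) (b' + b) (c' + c) (\<lambda>l. k' l + k l)"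
    using pres_cong_add2[OF g(1) u(1)] by (simp add: normal_form_add)
  then show ?case using u(2) g(2)
    by (intro exI[of _ "b' + b"] exI[of _ "c' + c"] exI[of _ "\<lambda>l. k' l + k l"]) auto
qed

text \<open>Up to level L only the a's have rank, at level L + 1 only the y's and z's do, and at
  level L + 2 each x adds one. The ranks thus recover \<open>k\<close>, then b + c, then
  \<open>m\<close>.\<close>

lemma rank_at_normal_form:
  "n \<le> L \<Longrightarrow> 1 \<le> n \<Longrightarrow> rank_at n (normal_form L m b c k) = k (n - 1)"
  "rank_at (Suc L) (normal_form L m b c k) = b + c"
  "rank_at (Suc (Suc L)) (normal_form L m b c k) = m + b + c"
proof -
  have a: "rank_at n (\<Sum>l<L. replicate_mset (k l) (gen_a l)) = (if 1 \<le> n \<and> n \<le> L then k (n - 1) else 0)" for n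
  proof -
    have "(\<Sum>l<L. k l * (if n = Suc l then 1 else 0)) = (\<Sum>l<L. if l = n - 1 then (if 1 \<le> n then k (n - 1) else 0) else 0)"
      by (rule sum.cong) auto
    then show ?thesis by (auto simp: rank_at_sum)
  qed
  show "n \<le> L \<Longrightarrow> 1 \<le> n \<Longrightarrow> rank_at n (normal_form L m b c k) = k (n - 1)"
    "rank_at (Suc L) (normal_form L m b c k) = b + c"
    "rank_at (Suc (Suc L)) (normal_form L m b c k) = m + b + c"
    by (simp_all add: normal_form_def a)
qed

text \<open>x_L + y_L = x_L + z_L holds for every L: it is the first relation for L = 0, and
  otherwise both sides equal x_(L-1). Hence a single x turns every z into a y.\<close>

lemma normal_form_absorb: "normal_form L (Suc m) b c k \<approx> normal_form L (Suc m) (b + c) 0 k"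
proof -
  have yz: "{#gen_x L, gen_z L#} \<approx> {#gen_x L, gen_y L#}"
  proof (cases L)
    case 0
    have "{#gen_x L, gen_y L#} \<approx> {#gen_x L, gen_z L#}"
      unfolding 0 by (rule pres_cong.rel) (simp add: M_relations_def)
    then show ?thesis by (rule pres_cong.sym)
  next
    case (Suc l)
    have "{#gen_x l#} \<approx> {#gen_x L, gen_y L#}" "{#gen_x l#} \<approx> {#gen_x L, gen_z L#}"
      unfolding Suc by (rule pres_cong.rel, force simp: M_relations_def)+
    then show ?thesis using pres_cong.sym pres_cong.trans by blast
  qed
  show ?thesis
  proof (induction c arbitrary: b)
    case 0
    show ?case by (simp add: pres_cong.refl)
  next
    case (Suc c)
    let ?t = "replicate_mset m (gen_x L) + replicate_mset b (gen_y L) + replicate_mset c (gen_z L)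
      + (\<Sum>l<L. replicate_mset (k l) (gen_a l))"
    have "normal_form L (Suc m) b (Suc c) k \<approx> normal_form L (Suc m) (Suc b) c k"
      using pres_cong.add[OF yz, of ?t] by (simp add: normal_form_def ac_simps add_mset_commute)
    then show ?case using pres_cong.trans[OF _ Suc.IH[of "Suc b"]] by simp
  qed
qed

text \<open>The ranks determine the normal form up to the distribution of b + c over y and z. In the
  presence of an x this distribution does not matter; in its absence raising does not change the
  number of y's.\<close>

lemma M_cong_of_rank:
  assumes rank: "\<And>n. 1 \<le> n \<Longrightarrow> rank_at n u = rank_at n v"
    and y: "\<lbrakk>type_count 0 u = 0; type_count 0 v = 0\<rbrakk> \<Longrightarrow> type_count 1 u = type_count 1 v"
  shows "u \<approx> v"
proof -
  obtain L where "\<forall>g\<in>set_mset (u + v). gen_index g \<le> L"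
    using finite_nat_set_iff_bounded_le[of "gen_index ` set_mset (u + v)"] by auto
  then have L: "\<And>g. g \<in># u \<Longrightarrow> gen_index g \<le> L" "\<And>g. g \<in># v \<Longrightarrow> gen_index g \<le> L" by auto
  obtain b c k where u: "u \<approx> normal_form L (type_count 0 u) b c k"
    "type_count 0 u = 0 \<longrightarrow> b = type_count 1 u" using exists_normal_form[OF L(1)] by blast
  obtain b' c' k' where v: "v \<approx> normal_form L (type_count 0 v) b' c' k'"
    "type_count 0 v = 0 \<longrightarrow> b' = type_count 1 v" using exists_normal_form[OF L(2)] by blast
  have eq: "rank_at n (normal_form L (type_count 0 u) b c k) = rank_at n (normal_form L (type_count 0 v) b' c' k')"
    if "1 \<le> n" for n
    using rank[OF that] rank_at_cong[OF u(1)] rank_at_cong[OF v(1)] by simp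
  have "k l = k' l" if "l < L" for l
    using eq[of "Suc l"] that by (simp add: rank_at_normal_form(1))
  then have k: "normal_form L m b c k = normal_form L m b c k'" for m b c
    by (simp add: normal_form_def)
  have bc: "b + c = b' + c'" using eq[of "Suc L"] by (simp add: rank_at_normal_form)
  have m: "type_count 0 u = type_count 0 v"
    using eq[of "Suc (Suc L)"] bc by (simp add: rank_at_normal_form)
  have "normal_form L (type_count 0 u) b c k \<approx> normal_form L (type_count 0 v) b' c' k'"
  proof (cases "type_count 0 u")
    case 0
    then have "b = b'" using u(2) v(2) m y by simp
    then show ?thesis using bc k m pres_cong.refl by simp
  next
    case (Suc j)
    show ?thesis
      using pres_cong.trans[OF normal_form_absorb[of L j b c k']
          pres_cong.sym[OF normal_form_absorb[of L j b' c' k', folded bc]]] Suc m k by simp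
  qed
  then show ?thesis using u(1) v(1) pres_cong.sym pres_cong.trans by blast
qed

section \<open>The product of matrix algebras as a type\<close>

text \<open>Matrix indices count from 0 here, as those of \<^const>\<open>mat\<close>.\<close>

typedef (overloaded) 'a tm = "{f :: nat \<Rightarrow> nat \<Rightarrow> nat \<Rightarrow> 'a::zero. \<forall>n i j. f n i j \<noteq> 0 \<longrightarrow> i < n \<and> j < n}"
  morphisms entry Tm
  by (rule exI[of _ "\<lambda>_ _ _. 0"]) simp

definition mk :: "(nat \<Rightarrow> nat \<Rightarrow> nat \<Rightarrow> 'a::zero) \<Rightarrow> 'a tm" where
  "mk f = Tm (\<lambda>n i j. if i < n \<and> j < n then f n i j else 0)"

lemma entry_mk [simp]: "entry (mk f) n i j = (if i < n \<and> j < n then f n i j else 0)"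
  by (simp add: mk_def Tm_inverse)

lemma entry_zero: "\<not> (i < n \<and> j < n) \<Longrightarrow> entry x n i j = 0"
  using entry[of x] by blast

lemma tm_eqI: "(\<And>n i j. i < n \<Longrightarrow> j < n \<Longrightarrow> entry x n i j = entry y n i j) \<Longrightarrow> x = y"
  by (metis entry_inject entry_zero ext)

instantiation tm :: (comm_ring_1) ring_1
begin

definition zero_tm :: "'a tm" where "0 = mk (\<lambda>_ _ _. 0)"
definition one_tm :: "'a tm" where "1 = mk (\<lambda>_ i j. if i = j then 1 else 0)"
definition plus_tm :: "'a tm \<Rightarrow> 'a tm \<Rightarrow> 'a tm" where "x + y = mk (\<lambda>n i j. entry x n i j + entry y n i j)"
definition minus_tm :: "'a tm \<Rightarrow> 'a tm \<Rightarrow> 'a tm" where "x - y = mk (\<lambda>n i j. entry x n i j - entry y n i j)"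
definition uminus_tm :: "'a tm \<Rightarrow> 'a tm" where "- x = mk (\<lambda>n i j. - entry x n i j)"
definition times_tm :: "'a tm \<Rightarrow> 'a tm \<Rightarrow> 'a tm" where
  "x * y = mk (\<lambda>n i j. \<Sum>k<n. entry x n i k * entry y n k j)"

lemma entry_simps [simp]:
  "entry (0 :: 'a tm) n i j = 0"
  "entry (1 :: 'a tm) n i j = (if i = j \<and> i < n then 1 else 0)"
  "entry (x + y) n i j = entry x n i j + entry (y :: 'a tm) n i j"
  "entry (x - y) n i j = entry x n i j - entry (y :: 'a tm) n i j"
  "entry (- x) n i j = - entry (x :: 'a tm) n i j"
  by (auto simp: zero_tm_def one_tm_def plus_tm_def minus_tm_def uminus_tm_def entry_zero)

lemma entry_times: "entry (x * y) n i j = (\<Sum>k<n. entry x n i k * entry (y :: 'a tm) n k j)"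
  by (auto simp: times_tm_def entry_zero)

instance
proof
  fix x y z :: "'a tm"
  show "x * y * z = x * (y * z)"
  proof (rule tm_eqI)
    fix n i j
    have "entry (x * y * z) n i j = (\<Sum>k<n. \<Sum>l<n. entry x n i l * entry y n l k * entry z n k j)"
      by (simp add: entry_times sum_distrib_right)
    also have "\<dots> = (\<Sum>l<n. \<Sum>k<n. entry x n i l * entry y n l k * entry z n k j)" by (rule sum.swap)
    also have "\<dots> = entry (x * (y * z)) n i j"
      by (simp add: entry_times sum_distrib_left mult.assoc)
    finally show "entry (x * y * z) n i j = entry (x * (y * z)) n i j" .
  qed
  show "1 * x = x" "x * 1 = x"
    by (rule tm_eqI, simp add: entry_times if_distrib[of "\<lambda>c. c * _"] if_distrib[of "\<lambda>c. _ * c"] cong: if_cong conj_cong)+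
  show "(x + y) * z = x * z + y * z" "x * (y + z) = x * y + x * z"
    by (rule tm_eqI, simp add: entry_times algebra_simps sum.distrib)+
  have "entry (0 :: 'a tm) 1 0 0 \<noteq> entry (1 :: 'a tm) 1 0 0" by simp
  then show "(0 :: 'a tm) \<noteq> 1" by metis
qed (rule tm_eqI, simp add: algebra_simps)+

end

lemma entry_sum: "entry (\<Sum>i\<in>S. f i :: 'a::comm_ring_1 tm) n r c = (\<Sum>i\<in>S. entry (f i) n r c)"
  by (induction S rule: infinite_finite_induct) simp_all

text \<open>A central element of T with its own scalar at each level. It serves for the constants of
  F, for cut-offs by levels, and for the scalars that occur in the corners of p and q.\<close>

definition diag :: "(nat \<Rightarrow> 'a::comm_ring_1) \<Rightarrow> 'a tm" where
  "diag s = mk (\<lambda>n i j. if i = j then s n else 0)"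

lemma entry_diag [simp]: "entry (diag s) n i j = (if i = j \<and> i < n then s n else 0)"
  by (simp add: diag_def)

lemma entry_diag_times [simp]:
  "entry (diag s * x) n i j = s n * entry x n i j"
  "entry (x * diag s) n i j = s n * entry x n i j"
proof -
  show "entry (diag s * x) n i j = s n * entry x n i j"
    by (cases "i < n") (simp_all add: entry_times if_distrib[of "\<lambda>c. c * _"] entry_zero cong: if_cong)
  have "entry (x * diag s) n i j = (\<Sum>k<n. if k = j then s n * entry x n i j else 0)"
    unfolding entry_times by (rule sum.cong) auto
  then show "entry (x * diag s) n i j = s n * entry x n i j"
    by (cases "j < n") (simp_all add: entry_zero)
qed

lemma diag_commute: "x * diag s = diag s * x"
  by (rule tm_eqI) simp

lemma diag_mult: "diag s * diag t = diag (\<lambda>n. s n * t n)"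
  by (rule tm_eqI) simp

lemma diag_add: "diag s + diag t = diag (\<lambda>n. s n + t n)"
  by (rule tm_eqI) simp

lemma diag_one: "diag (\<lambda>_. 1) = 1"
  by (rule tm_eqI) simp

definition ev_eq :: "'a::comm_ring_1 tm \<Rightarrow> 'a tm \<Rightarrow> bool" where
  "ev_eq x y \<longleftrightarrow> (\<exists>N. \<forall>n\<ge>N. \<forall>i j. entry x n i j = entry y n i j)"

lemma ev_eqI: "(\<And>n i j. N \<le> n \<Longrightarrow> entry x n i j = entry y n i j) \<Longrightarrow> ev_eq x y"
  unfolding ev_eq_def by blast

text \<open>The ring operations act level by level, which is what the last premise
  expresses.\<close>

lemma ev_eq_cong2:
  assumes "ev_eq x x'" "ev_eq y y'"
    and "\<And>n i j. \<lbrakk>\<And>i j. entry x n i j = entry x' n i j; \<And>i j. entry y n i j = entry y' n i j\<rbrakk> \<Longrightarrow>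
           entry z n i j = entry z' n i j"
  shows "ev_eq z z'"
proof -
  obtain N1 N2 where "\<forall>n\<ge>N1. \<forall>i j. entry x n i j = entry x' n i j" "\<forall>n\<ge>N2. \<forall>i j. entry y n i j = entry y' n i j"
    using assms(1,2) by (auto simp: ev_eq_def)
  then show ?thesis using assms(3) by (intro ev_eqI[of "max N1 N2"]) simp
qed

text \<open>Agreement from some level on is congruence modulo the socle of $T$.\<close>

quotient_type (overloaded) 'a germ = "'a::comm_ring_1 tm" / ev_eq
proof (rule equivpI)
  show "reflp (ev_eq :: 'a tm \<Rightarrow> _)" by (auto simp: reflp_def ev_eq_def)
  show "symp (ev_eq :: 'a tm \<Rightarrow> _)" unfolding symp_def ev_eq_def by metis
  show "transp (ev_eq :: 'a tm \<Rightarrow> _)"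
  proof (rule transpI)
    fix x y z :: "'a tm" assume "ev_eq x y" "ev_eq y z"
    then show "ev_eq x z" by (rule ev_eq_cong2) simp
  qed
qed

instantiation germ :: (comm_ring_1) ring_1
begin

lift_definition zero_germ :: "'a germ" is 0 .
lift_definition one_germ :: "'a germ" is 1 .
lift_definition plus_germ :: "'a germ \<Rightarrow> 'a germ \<Rightarrow> 'a germ" is "(+)"
  by (erule (1) ev_eq_cong2) simp
lift_definition minus_germ :: "'a germ \<Rightarrow> 'a germ \<Rightarrow> 'a germ" is "(-)"
  by (erule (1) ev_eq_cong2) simp
lift_definition uminus_germ :: "'a germ \<Rightarrow> 'a germ" is "uminus"
  by (auto simp: ev_eq_def)
lift_definition times_germ :: "'a germ \<Rightarrow> 'a germ \<Rightarrow> 'a germ" is "(*)"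
  by (erule (1) ev_eq_cong2) (simp add: entry_times)

lemma not_ev_eq_zero_one: "\<not> ev_eq 0 (1 :: 'a tm)"
proof
  assume "ev_eq 0 (1 :: 'a tm)"
  then obtain N where "\<forall>n\<ge>N. \<forall>i j. entry (0 :: 'a tm) n i j = entry 1 n i j" by (auto simp: ev_eq_def)
  from this[rule_format, of "Suc N" 0 0] show False by simp
qed

instance
  by standard (transfer, simp add: algebra_simps not_ev_eq_zero_one ev_eqI)+

end

lift_definition germ :: "'a::comm_ring_1 tm \<Rightarrow> 'a germ" is "\<lambda>x. x" .

lemma germ_simps [simp]:
  "germ (x + y) = germ x + germ y" "germ (x - y) = germ x - germ y" "germ (- x) = - germ x"
  "germ (x * y) = germ x * germ y" "germ 0 = 0" "germ 1 = 1"
  by (transfer, simp add: ev_eqI)+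

lemma germ_power [simp]: "germ (x ^ n) = germ x ^ n"
  by (induction n) simp_all

lemma germ_eq_iff: "germ x = germ y \<longleftrightarrow> (\<exists>N. \<forall>n\<ge>N. \<forall>i j. entry x n i j = entry y n i j)"
  unfolding ev_eq_def[symmetric] by transfer simp

lemma germ_eqI: "(\<And>n i j. N \<le> n \<Longrightarrow> entry x n i j = entry y n i j) \<Longrightarrow> germ x = germ y"
  unfolding germ_eq_iff by blast

section \<open>Toeplitz matrices\<close>

text \<open>At level n this is g_n(w), the truncation of the power series g_n modulo x^n. The series
  may change with the level because F_k does.\<close>

definition toep :: "(nat \<Rightarrow> 'a::comm_ring_1 fps) \<Rightarrow> 'a tm" where
  "toep g = mk (\<lambda>n i j. if j \<le> i then fps_nth (g n) (i - j) else 0)"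

lemma entry_toep: "entry (toep g) n i j = (if i < n \<and> j \<le> i then fps_nth (g n) (i - j) else 0)"
  by (auto simp: toep_def)

lemma toep_mult: "toep g * toep h = toep (\<lambda>n. g n * h n)"
proof (rule tm_eqI)
  fix n i j :: nat assume ij: "i < n" "j < n"
  have "entry (toep g * toep h) n i j
      = (\<Sum>k\<in>{..<n}. if j \<le> k \<and> k \<le> i then fps_nth (g n) (i - k) * fps_nth (h n) (k - j) else 0)"
    unfolding entry_times using ij by (intro sum.cong) (auto simp: entry_toep)
  also have "\<dots> = (\<Sum>k\<in>{j..i}. fps_nth (g n) (i - k) * fps_nth (h n) (k - j))"
    using ij by (intro sum.mono_neutral_cong_right) auto
  also have "\<dots> = (if j \<le> i then \<Sum>l=0..i - j. fps_nth (g n) l * fps_nth (h n) (i - j - l) else 0)"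
    by (auto intro!: sum.reindex_bij_witness[of _ "\<lambda>l. i - l" "\<lambda>k. i - k"])
  also have "\<dots> = entry (toep (\<lambda>n. g n * h n)) n i j"
    using ij by (simp add: entry_toep fps_mult_nth)
  finally show "entry (toep g * toep h) n i j = entry (toep (\<lambda>n. g n * h n)) n i j" .
qed

lemma toep_add: "toep g + toep h = toep (\<lambda>n. g n + h n)"
  by (rule tm_eqI) (simp add: entry_toep)

lemma toep_diff: "toep g - toep h = toep (\<lambda>n. g n - h n)"
  by (rule tm_eqI) (simp add: entry_toep)

lemma toep_const: "toep (\<lambda>_. fps_const c) = diag (\<lambda>_. c)"
  by (rule tm_eqI) (auto simp: entry_toep)

definition ser :: "'a::comm_ring_1 fps \<Rightarrow> 'a tm" where
  "ser g = toep (\<lambda>_. g)"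

lemma ser_simps:
  "ser (g * h) = ser g * ser h" "ser (g + h) = ser g + ser h" "ser (g - h) = ser g - ser h"
  "ser (fps_const c) = diag (\<lambda>_. c)" "ser 1 = 1"
  using toep_const[of 1]
  by (simp_all add: ser_def toep_mult toep_add toep_diff toep_const diag_one)

lemma ser_power: "ser (g ^ n) = ser g ^ n"
  by (induction n) (simp_all add: ser_simps)

definition "shift = (ser fps_X :: 'a::comm_ring_1 tm)"

lemma entry_shift: "entry shift n i j = (if i < n \<and> i = Suc j then 1 else 0)"
  by (auto simp: shift_def ser_def entry_toep)

lemma entry_shift_power: "entry (shift ^ l) n i j = (if i < n \<and> i = j + l then 1 else 0)"
proof -
  have "shift ^ l = (toep (\<lambda>_. fps_X ^ l) :: 'a tm)" by (simp only: shift_def ser_power ser_def[symmetric])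
  then show ?thesis by (auto simp: entry_toep fps_X_power_nth)
qed

section \<open>Localization of the polynomials at the origin\<close>

text \<open>F[x] localized at the origin, realized inside the power series: w is nilpotent at every
  level, so any series can be evaluated at it.\<close>

definition loc :: "'a::field fps set" where
  "loc = {g. \<exists>a b. coeff b 0 = 1 \<and> g * fps_of_poly b = fps_of_poly a}"

lemma loc_poly: "fps_of_poly a \<in> loc"
  unfolding loc_def by (auto intro!: exI[of _ a] exI[of _ 1])

lemma loc_inverse: "coeff b 0 = 1 \<Longrightarrow> inverse (fps_of_poly b) \<in> loc"
  using inverse_mult_eq_1[of "fps_of_poly b"] unfolding loc_def mem_Collect_eq
  by (intro exI[of _ 1] exI[of _ b]) simp

lemma loc_mult: assumes "g \<in> loc" "h \<in> loc" shows "g * h \<in> loc"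
proof -
  obtain a b where 1: "coeff b 0 = 1" "g * fps_of_poly b = fps_of_poly a" using assms by (auto simp: loc_def)
  obtain c d where 2: "coeff d 0 = 1" "h * fps_of_poly d = fps_of_poly c" using assms by (auto simp: loc_def)
  have "g * h * fps_of_poly (b * d) = fps_of_poly (a * c)"
    by (simp add: fps_of_poly_mult 1(2)[symmetric] 2(2)[symmetric] algebra_simps)
  moreover have "coeff (b * d) 0 = 1" using 1 2 by (simp add: coeff_mult)
  ultimately show ?thesis by (auto simp: loc_def)
qed

lemma loc_add: assumes "g \<in> loc" "h \<in> loc" shows "g + h \<in> loc"
proof -
  obtain a b where 1: "coeff b 0 = 1" "g * fps_of_poly b = fps_of_poly a" using assms by (auto simp: loc_def)
  obtain c d where 2: "coeff d 0 = 1" "h * fps_of_poly d = fps_of_poly c" using assms by (auto simp: loc_def)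
  have "(g + h) * fps_of_poly (b * d) = fps_of_poly (a * d + b * c)"
    by (simp add: fps_of_poly_mult fps_of_poly_add 1(2)[symmetric] 2(2)[symmetric] algebra_simps)
  moreover have "coeff (b * d) 0 = 1" using 1 2 by (simp add: coeff_mult)
  ultimately show ?thesis by (auto simp: loc_def)
qed

lemma loc_const: "fps_const c \<in> loc"
  using loc_poly[of "[:c:]"] by (simp add: fps_of_poly_const)

lemma loc_X: "fps_X \<in> loc"
  using loc_poly[of "monom 1 1"] by (simp add: fps_of_poly_monom)

lemma loc_one: "1 \<in> loc" and loc_zero: "0 \<in> loc"
  using loc_const[of 1] loc_const[of 0] by simp_all

lemma loc_power: "g \<in> loc \<Longrightarrow> g ^ n \<in> loc"
  by (induction n) (simp_all add: loc_one loc_mult)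

lemma loc_shift:
  assumes "g \<in> loc" "fps_nth g 0 = 0"
  shows "\<exists>h\<in>loc. g = fps_X * h"
proof -
  obtain a b where ab: "coeff b 0 = 1" "g * fps_of_poly b = fps_of_poly a" using assms by (auto simp: loc_def)
  have g: "g = fps_X * fps_shift 1 g"
    using assms(2) by (simp add: fps_eq_iff fps_mult_fps_X_commute)
  have "coeff a 0 = 0" using arg_cong[OF ab(2), of "\<lambda>f. fps_nth f 0"] assms(2) by (simp add: fps_mult_nth)
  then obtain a' where a: "a = pCons 0 a'" by (cases a) auto
  have "fps_X * (fps_shift 1 g * fps_of_poly b) = fps_X * fps_of_poly a'"
    using ab(2) g by (metis a fps_of_poly_pCons fps_const_0_eq_0 add_0_left mult.assoc mult.commute)
  then have "fps_shift 1 g * fps_of_poly b = fps_of_poly a'" by simp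
  then have "fps_shift 1 g \<in> loc" using ab(1) by (auto simp: loc_def)
  then show ?thesis using g by blast
qed

lemma loc_unit:
  assumes "g \<in> loc" "fps_nth g 0 \<noteq> 0"
  shows "inverse g \<in> loc"
proof -
  obtain a b where ab: "coeff b 0 = 1" "g * fps_of_poly b = fps_of_poly a" using assms by (auto simp: loc_def)
  define c where "c = fps_nth g 0"
  have a0: "coeff a 0 = c" using arg_cong[OF ab(2), of "\<lambda>f. fps_nth f 0"] ab(1) by (simp add: fps_mult_nth c_def)
  have inv: "inverse g * g = 1" using assms(2) by (rule inverse_mult_eq_1)
  have "inverse g * fps_of_poly (smult (inverse c) a) = fps_const (inverse c) * ((inverse g * g) * fps_of_poly b)"
    by (simp add: fps_of_poly_smult ab(2)[symmetric] algebra_simps)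
  also have "\<dots> = fps_of_poly (smult (inverse c) b)" by (simp add: inv fps_of_poly_smult)
  finally show ?thesis using a0 assms(2) unfolding loc_def mem_Collect_eq
    by (intro exI[of _ "smult (inverse c) b"] exI[of _ "smult (inverse c) a"]) (simp add: c_def)
qed

text \<open>The localization is a discrete valuation ring with uniformizer x. This is what makes
  every nonzero g invertible up to a power of w.\<close>

lemma loc_decompose:
  assumes "g \<in> loc" "g \<noteq> 0"
  shows "\<exists>s. \<exists>u\<in>loc. inverse u \<in> loc \<and> inverse u * u = 1 \<and> g = fps_X ^ s * u"
  using assms
proof (induction "subdegree g" arbitrary: g)
  case 0
  then have "fps_nth g 0 \<noteq> 0" by (metis nth_subdegree_nonzero)
  then show ?case using 0 loc_unit inverse_mult_eq_1 by (intro exI[of _ 0] bexI[of _ g]) auto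
next
  case (Suc k)
  then have "fps_nth g 0 = 0" by (metis nth_less_subdegree_zero zero_less_Suc)
  then obtain h where h: "h \<in> loc" "g = fps_X * h" using loc_shift Suc.prems by blast
  then have "h \<noteq> 0" "k = subdegree h" using Suc by (auto simp: subdegree_mult)
  then obtain s u where "u \<in> loc" "inverse u \<in> loc" "inverse u * u = 1" "h = fps_X ^ s * u"
    using Suc.hyps(1) h(1) by blast
  then show ?case using h(2) by (intro exI[of _ "Suc s"] bexI[of _ u]) (auto simp: mult.assoc)
qed

section \<open>The matrices w and w*\<close>

text \<open>\<open>F n\<close> stands for the polynomial $F_k$ with $M(k) \le n < M(k+1)$.\<close>

locale levels =
  fixes F :: "nat \<Rightarrow> 'a::field poly"
  assumes coeff_0 [simp]: "coeff (F n) 0 = 1"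
    and degree_bound: "1 \<le> n \<Longrightarrow> 2 * degree (F n) < n"
    and eventually_dvd: "coeff b 0 = 1 \<Longrightarrow> \<exists>n0. \<forall>n\<ge>n0. b dvd F n \<and> 2 * degree (F n) + d < n"
begin

text \<open>Counting from 0, a_j e_(j,1) lies in row j - 1 of column 0, and a_j e_(n,n-j+1) in
  column n - j of the last row. Both corrections vanish when F_n = 1.\<close>

definition v :: "'a tm" where
  "v = mk (\<lambda>n i j. (if j = Suc i then 1 else 0) - (if j = 0 then coeff (F n) (Suc i) else 0)
         - (if Suc i = n then coeff (F n) (n - j) else 0))"

text \<open>This is F_n(w) e_11, the first column of F_n(w); likewise \<open>q\<close> is e_nn
  F_n(w), its last row. The constant term 1 of F_n makes both idempotent.\<close>

definition p :: "'a tm" where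
  "p = mk (\<lambda>n i j. if j = 0 then coeff (F n) i else 0)"

definition q :: "'a tm" where
  "q = mk (\<lambda>n i j. if Suc i = n then coeff (F n) (n - Suc j) else 0)"

abbreviation w :: "'a tm" where "w \<equiv> shift"

lemma v_w: "v * w = 1 - q"
proof (rule tm_eqI)
  fix n i j :: nat assume ij: "i < n" "j < n"
  have "entry (v * w) n i j = (\<Sum>k<n. if k = Suc j then entry v n i k else 0)"
    unfolding entry_times by (rule sum.cong) (auto simp: entry_shift)
  also have "\<dots> = entry (1 - q) n i j"
    using ij by (auto simp: v_def q_def)
  finally show "entry (v * w) n i j = entry (1 - q) n i j" .
qed

lemma w_v: "w * v = 1 - p"
proof (rule tm_eqI)
  fix n i j :: nat assume ij: "i < n" "j < n"
  have "entry (w * v) n i j = (\<Sum>k<n. if i = Suc k then entry v n k j else 0)"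
    unfolding entry_times using ij by (intro sum.cong) (auto simp: entry_shift)
  also have "\<dots> = entry (1 - p) n i j"
  proof (cases i)
    case 0
    then show ?thesis using ij by (auto simp: p_def)
  next
    case (Suc k)
    have "(\<Sum>l<n. if i = Suc l then entry v n l j else 0) = (\<Sum>l<n. if l = k then entry v n l j else 0)"
      using Suc by (intro sum.cong) auto
    then show ?thesis using ij Suc by (auto simp: p_def v_def)
  qed
  finally show "entry (w * v) n i j = entry (1 - p) n i j" .
qed

lemma p_w: "p * w = 0"
  by (rule tm_eqI) (auto simp: entry_times p_def entry_shift intro!: sum.neutral)

lemma coeff_prod_zero: "k < n \<Longrightarrow> coeff (F n) (n - k) * coeff (F n) k = 0"
proof -
  assume k: "k < n"
  then have "degree (F n) < n - k \<or> degree (F n) < k" using degree_bound[of n] by linarith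
  then show ?thesis by (auto simp: coeff_eq_0)
qed

text \<open>The superdiagonal moves the column of coefficients up by one, and the correction in
  column 0 subtracts the moved column again. The correction in the last row contributes products of
  two coefficients whose indices add up to n, which vanish because 2 deg F_n < n.\<close>

lemma v_p: "v * p = 0"
proof (rule tm_eqI)
  fix n i j :: nat assume ij: "i < n" "j < n"
  have "entry (v * p) n i j = (\<Sum>k<n. (if k = Suc i then if j = 0 then coeff (F n) k else 0 else 0)
      - (if k = 0 then if j = 0 then coeff (F n) (Suc i) else 0 else 0)
      - (if Suc i = n \<and> j = 0 then coeff (F n) (n - k) * coeff (F n) k else 0))"
    unfolding entry_times using ij by (intro sum.cong) (auto simp: v_def p_def)
  also have "\<dots> = (\<Sum>k<n. (if k = Suc i then if j = 0 then coeff (F n) k else 0 else 0))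
      - (\<Sum>k<n. if k = 0 then if j = 0 then coeff (F n) (Suc i) else 0 else 0)"
  proof -
    have "(\<Sum>k<n. if Suc i = n \<and> j = 0 then coeff (F n) (n - k) * coeff (F n) k else 0) = 0"
      by (rule sum.neutral) (simp add: coeff_prod_zero)
    then show ?thesis by (simp add: sum_subtractf)
  qed
  also have "\<dots> = 0"
  proof (cases "Suc i < n")
    case True
    then show ?thesis by simp
  next
    case False
    then have "Suc i = n" using ij by simp
    moreover from this have "coeff (F n) n = 0" using degree_bound[of n] by (intro coeff_eq_0) simp
    ultimately show ?thesis by auto
  qed
  finally show "entry (v * p) n i j = entry 0 n i j" by simp
qed

text \<open>Both \<open>q * v\<close> and \<open>v * p\<close> equal v - vwv; in the same way
  \<open>w * q\<close> and \<open>p * w\<close> below both equal w - wvw.\<close>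

lemma q_v: "q * v = 0"
proof -
  have "q * v = (1 - v * w) * v" by (simp add: v_w)
  also have "\<dots> = v * (1 - w * v)" by (simp add: algebra_simps)
  also have "\<dots> = v * p" by (simp add: w_v)
  finally show ?thesis by (simp add: v_p)
qed

lemma w_q: "w * q = 0"
proof -
  have "w * q = w * (1 - v * w)" by (simp add: v_w)
  also have "\<dots> = (1 - w * v) * w" by (simp add: algebra_simps)
  also have "\<dots> = p * w" by (simp add: w_v)
  finally show ?thesis by (simp add: p_w)
qed

lemma p_p: "p * p = p"
proof -
  have "(1 - p) * p = w * (v * p)" by (simp add: w_v[symmetric] mult.assoc)
  then show ?thesis by (simp add: v_p algebra_simps)
qed

lemma q_q: "q * q = q"
proof -
  have "(1 - q) * q = v * (w * q)" by (simp add: v_w[symmetric] mult.assoc)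
  then show ?thesis by (simp add: w_q algebra_simps)
qed

lemma entry_p: "entry p n i j = (if i < n \<and> j = 0 then coeff (F n) i else 0)"
  by (auto simp: p_def)

lemma entry_q: "entry q n i j = (if Suc i = n \<and> j < n then coeff (F n) (n - Suc j) else 0)"
  by (auto simp: q_def)

lemma entry_v_power_high: "i + l < j \<Longrightarrow> entry (v ^ l) n i j = 0"
proof (induction l arbitrary: j)
  case (Suc l)
  have "entry (v ^ l) n i k * entry v n k j = 0" for k
    using Suc by (cases "i + l < k") (auto simp: v_def)
  then show ?case unfolding power_Suc2 entry_times by (intro sum.neutral) blast
qed auto

text \<open>\<open>p\<close> lives in column 0 and \<open>q\<close> in the last row, so only the
  entry (0, n - 1) of \<open>v ^ l\<close> matters. Each factor \<open>v\<close> raises the column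
  index by at most one, hence this entry is zero once l < n - 1.\<close>

lemma entry_p_v_q: "l + 2 \<le> n \<Longrightarrow> entry (p * v ^ l * q) n i j = 0"
proof -
  assume n: "l + 2 \<le> n"
  have "entry p n i k * entry (v ^ l) n k m * entry q n m j = 0" for k m
    using n entry_v_power_high[of k l m n] by (auto simp: entry_p entry_q)
  then have "(\<Sum>m<n. \<Sum>k<n. entry p n i k * entry (v ^ l) n k m * entry q n m j) = 0"
    by (intro sum.neutral ballI) blast
  then show ?thesis by (simp add: entry_times sum_distrib_right)
qed

text \<open>At level n the only entry that can be nonzero is the coefficient of x^(n-1) in F_n g
  F_n. Once the denominator of g divides F_n, this series is a polynomial of degree at most 2 deg
  F_n + deg a.\<close>

lemma q_ser_p:
  assumes "g \<in> loc"
  shows "germ (q * ser g * p) = 0"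
proof -
  obtain a b where ab: "coeff b 0 = 1" "g * fps_of_poly b = fps_of_poly a" using assms by (auto simp: loc_def)
  \<comment> \<open>The margin \<open>degree a + 1\<close> brings the degree of that polynomial
    below n - 1.\<close>
  obtain n0 where n0: "\<And>n. n \<ge> n0 \<Longrightarrow> b dvd F n \<and> 2 * degree (F n) + (degree a + 1) < n"
    using eventually_dvd[OF ab(1)] by blast
  have "entry (q * ser g * p) n i j = 0" if n: "n \<ge> n0" for n i j
  proof -
    have "entry (q * (ser g * p)) n i j
        = (\<Sum>k<n. \<Sum>l<n. entry q n i k * entry (ser g) n k l * entry p n l j)"
      by (simp add: entry_times sum_distrib_left mult.assoc)
    also have "\<dots> = (if Suc i = n \<and> j = 0 then (\<Sum>k<n. \<Sum>l<n. coeff (F n) (n - Suc k) * entry (ser g) n k l * coeff (F n) l) else 0)"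
      by (auto simp: entry_q entry_p)
    also have "(\<Sum>k<n. \<Sum>l<n. coeff (F n) (n - Suc k) * entry (ser g) n k l * coeff (F n) l)
        = entry (toep (\<lambda>n. fps_of_poly (F n)) * (ser g * toep (\<lambda>n. fps_of_poly (F n)))) n (n - 1) 0"
      using n0[OF n] unfolding entry_times
      by (auto simp: entry_toep sum_distrib_left mult.assoc intro!: sum.cong)
    also have "\<dots> = fps_nth (fps_of_poly (F n) * (g * fps_of_poly (F n))) (n - 1)"
      using n0[OF n] by (simp add: ser_def toep_mult entry_toep)
    also have "\<dots> = 0"
    proof -
      obtain c where c: "F n = b * c" using n0[OF n] by auto
      have "fps_of_poly (F n) * (g * fps_of_poly (F n)) = fps_of_poly (F n) * ((g * fps_of_poly b) * fps_of_poly c)"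
        by (simp add: c fps_of_poly_mult mult.assoc)
      also have "\<dots> = fps_of_poly (F n * (a * c))" by (simp add: ab(2) fps_of_poly_mult)
      finally have eq: "fps_of_poly (F n) * (g * fps_of_poly (F n)) = fps_of_poly (F n * (a * c))" .
      have "b \<noteq> 0" using ab(1) by auto
      have "c \<noteq> 0" using coeff_0[of n] c by auto
      then have "degree c \<le> degree (F n)" using c \<open>b \<noteq> 0\<close> by (simp add: degree_mult_eq)
      moreover have "degree (F n * (a * c)) \<le> degree (F n) + (degree a + degree c)"
        using degree_mult_le[of "F n" "a * c"] degree_mult_le[of a c] by linarith
      ultimately have "degree (F n * (a * c)) < n - 1" using n0[OF n] by linarith
      then show ?thesis by (simp add: eq coeff_eq_0)
    qed
    finally show ?thesis by (simp add: mult.assoc)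
  qed
  then show ?thesis using germ_eqI[of n0 "q * ser g * p" 0] by simp
qed

text \<open>Rank one at every level makes the corner consist of scalars, one for each level, and
  exactly so, not only modulo the socle.\<close>

lemma p_t_p: "p * t * p = diag (\<lambda>n. entry (t * p) n 0 0) * p"
proof (rule tm_eqI)
  fix n i j :: nat assume ij: "i < n" "j < n"
  have 0: "entry (t * p) n 0 j = 0" if "j \<noteq> 0" using that by (simp add: entry_times entry_p)
  have "entry (p * (t * p)) n i j = (\<Sum>k<n. if k = 0 then coeff (F n) i * entry (t * p) n 0 j else 0)"
    unfolding entry_times[of p] using ij by (intro sum.cong) (auto simp: entry_p)
  then show "entry (p * t * p) n i j = entry (diag (\<lambda>n. entry (t * p) n 0 0) * p) n i j"
    using ij 0 by (auto simp: mult.assoc entry_p)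
qed

lemma q_t_q: "q * t * q = diag (\<lambda>n. entry (q * t) n (n - 1) (n - 1)) * q"
proof (rule tm_eqI)
  fix n i j :: nat assume ij: "i < n" "j < n"
  have 0: "entry (q * t) n i k = 0" if "Suc i \<noteq> n" for k using that by (simp add: entry_times entry_q)
  have "entry (q * t * q) n i j = (\<Sum>k<n. if k = n - 1 then entry (q * t) n i k * entry q n k j else 0)"
    unfolding entry_times[of "q * t"] using ij by (intro sum.cong) (auto simp: entry_q)
  then have "entry (q * t * q) n i j = entry (q * t) n i (n - 1) * entry q n (n - 1) j" using ij by simp
  then show "entry (q * t * q) n i j = entry (diag (\<lambda>n. entry (q * t) n (n - 1) (n - 1)) * q) n i j"
    using ij 0 by (cases "Suc i = n") (auto simp: entry_q)
qed

end

text \<open>McCoy's lemma: a quasi-inverse of the defect a - aya corrects \<open>y\<close> to a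
  quasi-inverse of \<open>a\<close>. Every regularity proof below reduces the defect in this
  way.\<close>

lemma regular_of_regular_diff:
  fixes a y z :: "'b::ring_1"
  assumes "1 \<in> A" "\<And>x y. \<lbrakk>x \<in> A; y \<in> A\<rbrakk> \<Longrightarrow> x + y \<in> A" "\<And>x y. \<lbrakk>x \<in> A; y \<in> A\<rbrakk> \<Longrightarrow> x - y \<in> A"
    "\<And>x y. \<lbrakk>x \<in> A; y \<in> A\<rbrakk> \<Longrightarrow> x * y \<in> A"
    and "a \<in> A" "y \<in> A" "z \<in> A"
    and z: "(a - a * y * a) * z * (a - a * y * a) = a - a * y * a"
  shows "\<exists>x\<in>A. a * x * a = a"
proof (rule bexI)
  have "a * (y + (1 - y * a) * z * (1 - a * y)) * a = a * y * a + (a - a * y * a) * z * (a - a * y * a)"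
    by (simp add: algebra_simps)
  then show "a * (y + (1 - y * a) * z * (1 - a * y)) * a = a" using z by simp
  show "y + (1 - y * a) * z * (1 - a * y) \<in> A" by (intro assms(1-7))
qed

context levels
begin

section \<open>The algebra modulo its socle\<close>

text \<open>Sums, products and scalars suffice, as negation is multiplication by the scalar
  -1.\<close>

inductive_set alg :: "'a tm set" where
  soc: "germ x = 0 \<Longrightarrow> x \<in> alg"
| w: "w \<in> alg"
| v: "v \<in> alg"
| inv: "coeff b 0 = 1 \<Longrightarrow> ser (inverse (fps_of_poly b)) \<in> alg"
| const: "diag (\<lambda>_. c) \<in> alg"
| add: "x \<in> alg \<Longrightarrow> y \<in> alg \<Longrightarrow> x + y \<in> alg"
| mult: "x \<in> alg \<Longrightarrow> y \<in> alg \<Longrightarrow> x * y \<in> alg"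

lemma alg_one: "1 \<in> alg"
  using alg.const[of 1] by (simp add: diag_one)

lemma alg_zero: "0 \<in> alg"
  by (rule alg.soc) simp

lemma uminus_eq_diag: "- x = diag (\<lambda>_. - 1) * x"
  by (rule tm_eqI) simp

lemma alg_uminus: "x \<in> alg \<Longrightarrow> - x \<in> alg"
  unfolding uminus_eq_diag by (intro alg.mult alg.const)

lemma alg_diff: "x \<in> alg \<Longrightarrow> y \<in> alg \<Longrightarrow> x - y \<in> alg"
  using alg.add[of x "- y"] alg_uminus by simp

lemma alg_power: "x \<in> alg \<Longrightarrow> x ^ n \<in> alg"
  by (induction n) (auto intro: alg_one alg.mult)

lemma alg_p: "p \<in> alg" and alg_q: "q \<in> alg"
proof -
  have "p = 1 - w * v" "q = 1 - v * w" by (simp_all add: w_v v_w)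
  then show "p \<in> alg" "q \<in> alg" by (auto intro: alg_diff alg_one alg.mult alg.w alg.v)
qed

lemma alg_ser:
  assumes "g \<in> loc"
  shows "ser g \<in> alg"
proof -
  obtain a b where ab: "coeff b 0 = 1" "g * fps_of_poly b = fps_of_poly a" using assms by (auto simp: loc_def)
  have "ser (fps_of_poly a) \<in> alg"
  proof (induction a)
    case 0
    then show ?case using ser_simps(4)[of "0 :: 'a"] alg.const[of 0] by simp
  next
    case (pCons c a)
    then show ?case
      by (auto simp: fps_of_poly_pCons ser_simps shift_def[symmetric] intro: alg.add alg.const alg.mult alg.w)
  qed
  moreover have "fps_of_poly b * inverse (fps_of_poly b) = 1"
    using ab(1) inverse_mult_eq_1[of "fps_of_poly b"] by (simp add: mult.commute)
  then have "g = fps_of_poly a * inverse (fps_of_poly b)"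
    unfolding ab(2)[symmetric] by (simp add: mult.assoc)
  ultimately show ?thesis using alg.inv[OF ab(1)] by (simp add: ser_simps alg.mult)
qed

definition "GA = germ ` alg"
abbreviation W :: "'a germ" where "W \<equiv> germ w"
abbreviation V :: "'a germ" where "V \<equiv> germ v"
abbreviation P :: "'a germ" where "P \<equiv> germ p"
abbreviation Q :: "'a germ" where "Q \<equiv> germ q"
abbreviation S :: "'a fps \<Rightarrow> 'a germ" where "S g \<equiv> germ (ser g)"
abbreviation C :: "'a \<Rightarrow> 'a germ" where "C c \<equiv> germ (diag (\<lambda>_. c))"

lemma GA_basic: "0 \<in> GA" "1 \<in> GA" "W \<in> GA" "V \<in> GA" "P \<in> GA" "Q \<in> GA" "C c \<in> GA"
  "g \<in> loc \<Longrightarrow> S g \<in> GA"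
  unfolding GA_def using imageI[OF alg_zero, of germ] imageI[OF alg_one, of germ]
  by (auto intro: alg.w alg.v alg_p alg_q alg.const alg_ser)

lemma GA_closed: "x \<in> GA \<Longrightarrow> y \<in> GA \<Longrightarrow> x + y \<in> GA" "x \<in> GA \<Longrightarrow> y \<in> GA \<Longrightarrow> x * y \<in> GA"
  "x \<in> GA \<Longrightarrow> y \<in> GA \<Longrightarrow> x - y \<in> GA"
  unfolding GA_def
  by (auto simp: germ_simps[symmetric] simp del: germ_simps intro: alg.add alg.mult alg_diff)

lemma GA_power: "x \<in> GA \<Longrightarrow> x ^ n \<in> GA"
  by (induction n) (auto intro: GA_basic GA_closed)

lemmas GA_intros = GA_basic GA_closed GA_power

lemma GA_induct [consumes 1, case_names zero W V inv C add mult]: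
  assumes "t \<in> GA" "Pr 0" "Pr W" "Pr V" "\<And>b. coeff b 0 = 1 \<Longrightarrow> Pr (S (inverse (fps_of_poly b)))"
    "\<And>c. Pr (C c)" "\<And>x y. \<lbrakk>x \<in> GA; y \<in> GA; Pr x; Pr y\<rbrakk> \<Longrightarrow> Pr (x + y)"
    "\<And>x y. \<lbrakk>x \<in> GA; y \<in> GA; Pr x; Pr y\<rbrakk> \<Longrightarrow> Pr (x * y)"
  shows "Pr t"
proof -
  have "Pr (germ x)" if "x \<in> alg" for x
    using that by (induction rule: alg.induct) (use assms in \<open>auto simp: GA_def\<close>)
  then show ?thesis using assms(1) by (auto simp: GA_def)
qed

lemma germ_rel: "W * V = 1 - P" "V * W = 1 - Q" "P * W = 0" "V * P = 0" "Q * V = 0" "W * Q = 0"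
  "P * P = P" "Q * Q = Q"
  using w_v v_w p_w v_p q_v w_q p_p q_q by (metis germ_simps)+

lemma germ_rel_assoc: "W * (V * x) = x - P * x" "V * (W * x) = x - Q * x" "P * (W * x) = 0"
  "V * (P * x) = 0" "Q * (V * x) = 0" "W * (Q * x) = 0" "P * (P * x) = P * x" "Q * (Q * x) = Q * x"
  by (simp_all add: mult.assoc[symmetric] germ_rel left_diff_distrib)

lemma C_commute: "x * C c = C c * x"
  by transfer (rule ev_eqI, simp)

lemma C_left_commute: "x * (C c * y) = C c * (x * y)"
  by (simp add: mult.assoc[symmetric] C_commute)

lemma C_simps: "C (a + b) = C a + C b" "C (a * b) = C a * C b" "C 1 = 1" "C 0 = 0" "C (- a) = - C a"
proof -
  have "diag (\<lambda>_. 0 :: 'a) = 0" "diag (\<lambda>_. - a) = - diag (\<lambda>_. a)" by (rule tm_eqI, simp)+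
  then show "C 0 = 0" "C (- a) = - C a" by simp_all
  show "C (a + b) = C a + C b" by (simp add: diag_add[symmetric])
  show "C (a * b) = C a * C b" by (simp add: diag_mult[symmetric])
qed (simp add: diag_one)

lemma S_simps: "S (g * h) = S g * S h" "S (g + h) = S g + S h" "S (fps_const c) = C c" "S 1 = 1"
  "S fps_X = W" "S (g ^ n) = S g ^ n" "S 0 = 0"
  using ser_simps(4)[of "0 :: 'a"] C_simps(4)
  by (simp_all add: ser_simps shift_def ser_power)

text \<open>The relations simplify \<open>V\<close> only next to \<open>W\<close>, so the constant
  term of g has to be split off before \<open>V\<close> can be moved past g.\<close>

lemma loc_split:
  assumes "g \<in> loc"
  obtains h where "h \<in> loc" "g = fps_const (fps_nth g 0) + fps_X * h"
proof -
  have "g + fps_const (- fps_nth g 0) \<in> loc" using assms by (intro loc_add loc_const)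
  then obtain h where "h \<in> loc" "g + fps_const (- fps_nth g 0) = fps_X * h"
    using loc_shift[of "g + fps_const (- fps_nth g 0)"] by auto
  moreover from this(2) have "g = fps_const (fps_nth g 0) + fps_X * h"
    by (simp add: algebra_simps fps_const_neg[symmetric] del: fps_const_neg)
  ultimately show ?thesis using that by blast
qed

section \<open>One-sided ideals of P and Q modulo the socle\<close>

lemma QSP: "g \<in> loc \<Longrightarrow> Q * (S g * P) = 0"
  using q_ser_p[of g] by (simp add: mult.assoc)

text \<open>On the elements g(W)P, \<open>W\<close> acts as multiplication by x and \<open>V\<close>
  as the difference quotient sending g to (g - g(0))/x: the constant term is killed by VP = 0, and
  VW = 1 - Q acts as 1 because Q h(W) P = 0.\<close>

lemma t_P:
  assumes "t \<in> GA" "h \<in> loc"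
  shows "\<exists>g\<in>loc. t * (S h * P) = S g * P"
  using assms
proof (induction arbitrary: h rule: GA_induct)
  case zero
  then show ?case by (intro bexI[of _ 0]) (auto simp: loc_zero S_simps)
next
  case W
  then show ?case by (intro bexI[of _ "fps_X * h"]) (auto simp: loc_mult loc_X S_simps mult.assoc)
next
  case V
  then obtain k where k: "k \<in> loc" "h = fps_const (fps_nth h 0) + fps_X * k" by (rule loc_split)
  have "V * (S h * P) = V * (C (fps_nth h 0) * P) + V * (W * (S k * P))"
    by (subst k(2)) (simp add: S_simps algebra_simps)
  also have "V * (C (fps_nth h 0) * P) = C (fps_nth h 0) * (V * P)"
    by (metis C_commute mult.assoc)
  finally have "V * (S h * P) = S k * P" by (simp add: germ_rel germ_rel_assoc QSP k(1))
  then show ?case using k(1) by blast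
next
  case (inv b)
  then show ?case
    by (intro bexI[of _ "inverse (fps_of_poly b) * h"]) (auto simp: loc_mult loc_inverse S_simps mult.assoc)
next
  case (C c)
  then show ?case by (intro bexI[of _ "fps_const c * h"]) (auto simp: loc_mult loc_const S_simps mult.assoc)
next
  case (add x y)
  then obtain g g' where "g \<in> loc" "g' \<in> loc" "x * (S h * P) = S g * P" "y * (S h * P) = S g' * P" by metis
  then show ?case by (intro bexI[of _ "g + g'"]) (auto simp: loc_add S_simps algebra_simps)
next
  case (mult x y)
  then obtain g where g: "g \<in> loc" "y * (S h * P) = S g * P" by blast
  then obtain g' where "g' \<in> loc" "x * (S g * P) = S g' * P" using mult by blast
  then show ?case using g by (metis mult.assoc)
qed

lemma GA_P: "t \<in> GA \<Longrightarrow> \<exists>g\<in>loc. t * P = S g * P"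
  using t_P[of t 1] loc_one by (simp add: S_simps)

text \<open>By QV = 0, WV = 1 - P and Q h(W) P = 0, right multiplication by \<open>V\<close> acts on
  Q g(W) as the same difference quotient.\<close>

lemma Q_t:
  assumes "t \<in> GA" "h \<in> loc"
  shows "\<exists>g\<in>loc. Q * S h * t = Q * S g"
  using assms
proof (induction arbitrary: h rule: GA_induct)
  case zero
  then show ?case by (intro bexI[of _ 0]) (auto simp: loc_zero S_simps)
next
  case W
  then show ?case by (intro bexI[of _ "h * fps_X"]) (auto simp: loc_mult loc_X S_simps mult.assoc)
next
  case V
  then obtain k where k: "k \<in> loc" "h = fps_const (fps_nth h 0) + fps_X * k" by (rule loc_split)
  then have "h = fps_const (fps_nth h 0) + k * fps_X" by (simp add: mult.commute)
  then have "Q * S h * V = Q * (C (fps_nth h 0) + S k * W) * V" by (metis S_simps(1,2,3,5))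
  also have "\<dots> = Q * C (fps_nth h 0) * V + Q * (S k * (1 - P))"
    by (simp add: algebra_simps germ_rel)
  also have "Q * C (fps_nth h 0) * V = C (fps_nth h 0) * (Q * V)"
    by (metis C_commute mult.assoc)
  finally have "Q * S h * V = Q * S k" by (simp add: germ_rel right_diff_distrib QSP k(1))
  then show ?case using k(1) by blast
next
  case (inv b)
  then show ?case
    by (intro bexI[of _ "h * inverse (fps_of_poly b)"]) (auto simp: loc_mult loc_inverse S_simps mult.assoc)
next
  case (C c)
  then show ?case by (intro bexI[of _ "h * fps_const c"]) (auto simp: loc_mult loc_const S_simps mult.assoc)
next
  case (add x y)
  then obtain g g' where "g \<in> loc" "g' \<in> loc" "Q * S h * x = Q * S g" "Q * S h * y = Q * S g'" by metis
  then show ?case by (intro bexI[of _ "g + g'"]) (auto simp: loc_add S_simps distrib_left)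
next
  case (mult x y)
  then obtain g where g: "g \<in> loc" "Q * S h * x = Q * S g" by blast
  then obtain g' where "g' \<in> loc" "Q * S g * y = Q * S g'" using mult by blast
  then show ?case using g by (metis mult.assoc)
qed

lemma GA_Q: "t \<in> GA \<Longrightarrow> \<exists>g\<in>loc. Q * t = Q * S g"
  using Q_t[of t 1] loc_one by (simp add: S_simps)

text \<open>All terms of g but the constant one contribute a factor PW = 0.\<close>

lemma P_S_P: assumes "g \<in> loc" shows "P * (S g * P) = C (fps_nth g 0) * P"
proof -
  obtain h where h: "h \<in> loc" "g = fps_const (fps_nth g 0) + fps_X * h" using loc_split[OF assms] .
  have "P * (S g * P) = P * (C (fps_nth g 0) * P) + P * (W * (S h * P))"
    by (subst h(2)) (simp add: S_simps algebra_simps)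
  also have "P * (C (fps_nth g 0) * P) = C (fps_nth g 0) * (P * P)" by (metis C_commute mult.assoc)
  finally show ?thesis by (simp add: germ_rel germ_rel_assoc)
qed

lemma Q_S_Q: assumes "g \<in> loc" shows "Q * (S g * Q) = C (fps_nth g 0) * Q"
proof -
  obtain h where h: "h \<in> loc" "g = fps_const (fps_nth g 0) + fps_X * h" using loc_split[OF assms] .
  then have "g = fps_const (fps_nth g 0) + h * fps_X" by (simp add: mult.commute)
  then have "Q * (S g * Q) = Q * ((C (fps_nth g 0) + S h * W) * Q)" by (metis S_simps(1,2,3,5))
  also have "\<dots> = Q * (C (fps_nth g 0) * Q) + Q * (S h * (W * Q))"
    by (simp add: algebra_simps)
  also have "Q * (C (fps_nth g 0) * Q) = C (fps_nth g 0) * (Q * Q)" by (metis C_commute mult.assoc)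
  finally show ?thesis by (simp add: germ_rel)
qed

lemma P_GA_P: assumes "t \<in> GA" shows "\<exists>c. P * (t * P) = C c * P"
  using GA_P[OF assms] P_S_P by metis

lemma Q_GA_Q: assumes "t \<in> GA" shows "\<exists>c. Q * (t * Q) = C c * Q"
  using GA_Q[OF assms] Q_S_Q by (metis mult.assoc)

lemma Q_GA_P: assumes "t \<in> GA" shows "Q * (t * P) = 0"
  using GA_P[OF assms] QSP by metis

lemma P_V_Q: "P * (V ^ j * Q) = 0"
proof -
  have "germ (p * v ^ j * q) = germ 0" by (rule germ_eqI[of "j + 2"]) (simp add: entry_p_v_q)
  then show ?thesis by (simp add: mult.assoc)
qed

text \<open>\<open>V\<close> commutes with g(W) up to terms in the ideal of \<open>P\<close> and
  \<open>Q\<close>; h is the difference quotient (g - g(0))/x.\<close>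

lemma V_S_commutator:
  assumes "g \<in> loc"
  obtains h where "h \<in> loc" "V * S g = S g * V + S h * P - Q * S h"
proof -
  obtain h where h: "h \<in> loc" "g = fps_const (fps_nth g 0) + fps_X * h" using loc_split[OF assms] .
  then have h': "g = fps_const (fps_nth g 0) + h * fps_X" by (simp add: mult.commute)
  have "V * S g = V * C (fps_nth g 0) + V * (W * S h)" by (subst h(2)) (simp add: S_simps algebra_simps)
  moreover have "S g * V = C (fps_nth g 0) * V + S h * (W * V)" by (subst h') (simp add: S_simps distrib_right mult.assoc)
  ultimately have "V * S g = S g * V + S h * P - Q * S h"
    by (simp add: C_commute germ_rel germ_rel_assoc algebra_simps)
  then show ?thesis using h(1) that by blast
qed

text \<open>The span of the P V^j, which turns out to be the right ideal of \<open>P\<close>.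
  Closing under right multiplication by \<open>V\<close> keeps the coefficients implicit.\<close>

inductive_set ps :: "'a germ set" where
  P: "P \<in> ps"
| V: "x \<in> ps \<Longrightarrow> x * V \<in> ps"
| C: "x \<in> ps \<Longrightarrow> C c * x \<in> ps"
| add: "x \<in> ps \<Longrightarrow> y \<in> ps \<Longrightarrow> x + y \<in> ps"

lemma ps_GA: "x \<in> ps \<Longrightarrow> x \<in> GA"
  by (induction rule: ps.induct) (auto intro: GA_intros)

lemma ps_zero: "0 \<in> ps"
  using ps.C[OF ps.P, of 0] by (simp add: C_simps)

lemma P_ps: "x \<in> ps \<Longrightarrow> P * x = x"
  by (induction rule: ps.induct) (simp_all add: germ_rel distrib_left C_left_commute, simp add: mult.assoc[symmetric])

lemma ps_V_Q: "x \<in> ps \<Longrightarrow> x * (V ^ j * Q) = 0"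
proof (induction arbitrary: j rule: ps.induct)
  case P
  show ?case by (rule P_V_Q)
next
  case (V x)
  then show ?case using V.IH[of "Suc j"] by (simp add: mult.assoc)
qed (simp_all add: mult.assoc distrib_right)

lemma ps_Q: "x \<in> ps \<Longrightarrow> x * Q = 0"
  using ps_V_Q[of x 0] by simp

lemma ps_W: "x \<in> ps \<Longrightarrow> x * W \<in> ps"
proof (induction rule: ps.induct)
  case P
  show ?case by (simp add: germ_rel ps_zero)
next
  case (V x)
  then show ?case by (simp add: mult.assoc germ_rel right_diff_distrib ps_Q)
qed (auto simp: mult.assoc distrib_right intro: ps.intros)

text \<open>Moving g past the \<open>V\<close> of xV produces x h P and x Q h. The latter is zero as
  xQ = 0; the former equals P(xh)P, a multiple of \<open>P\<close>.\<close>

lemma ps_S: "x \<in> ps \<Longrightarrow> g \<in> loc \<Longrightarrow> x * S g \<in> ps"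
proof (induction rule: ps.induct)
  case P
  then obtain h where h: "h \<in> loc" "g = fps_const (fps_nth g 0) + fps_X * h" using loc_split by blast
  have "P * S g = P * C (fps_nth g 0) + P * (W * S h)" by (subst h(2)) (simp add: S_simps algebra_simps)
  then have "P * S g = C (fps_nth g 0) * P" by (simp add: germ_rel_assoc C_commute)
  then show ?case by (simp add: ps.intros)
next
  case (V x)
  obtain h where h: "h \<in> loc" "V * S g = S g * V + S h * P - Q * S h"
    using V_S_commutator[OF V.prems] .
  have "x * (S h * P) \<in> ps"
  proof -
    obtain c where "P * ((x * S h) * P) = C c * P"
      using P_GA_P[of "x * S h"] V.hyps h(1) by (auto intro: GA_intros ps_GA)
    moreover have "x * (S h * P) = (P * x) * (S h * P)" using P_ps[OF V.hyps] by simp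
    then have "x * (S h * P) = P * ((x * S h) * P)" by (simp only: mult.assoc)
    ultimately show ?thesis by (simp add: ps.intros)
  qed
  moreover have "x * (Q * S h) = 0" using ps_Q[OF V.hyps] by (simp add: mult.assoc[symmetric])
  moreover have "x * V * S g = x * S g * V + x * (S h * P) - x * (Q * S h)"
    by (simp add: mult.assoc h(2) algebra_simps)
  ultimately show ?case using V.IH V.prems by (auto intro: ps.intros)
qed (auto simp: mult.assoc distrib_right intro: ps.intros)

lemma ps_GA_closed: "t \<in> GA \<Longrightarrow> x \<in> ps \<Longrightarrow> x * t \<in> ps"
proof (induction arbitrary: x rule: GA_induct)
  case (inv b)
  then show ?case by (intro ps_S loc_inverse)
next
  case (mult y z)
  then show ?case by (simp add: mult.assoc[symmetric])
next
  case (C c)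
  then show ?case by (simp add: C_commute ps.intros)
qed (auto simp: ps_zero ps_W distrib_left intro: ps.intros)

lemma P_GA: "t \<in> GA \<Longrightarrow> P * t \<in> ps"
  using ps_GA_closed ps.P by blast

lemma P_GA_Q: "t \<in> GA \<Longrightarrow> P * (t * Q) = 0"
  using ps_Q[OF P_GA] by (simp add: mult.assoc)

lemma power_mult_zero: "x * W ^ n = 0 \<Longrightarrow> n \<le> m \<Longrightarrow> x * W ^ m = 0" for x :: "'a germ"
  by (auto simp: le_iff_add power_add mult.assoc[symmetric])

lemma power_mult_zero': "W ^ n * x = 0 \<Longrightarrow> n \<le> m \<Longrightarrow> W ^ m * x = 0" for x :: "'a germ"
  by (auto simp: le_iff_add power_add mult.assoc add.commute[of n])

text \<open>Since xQ = 0, the product xVW is x again, so each \<open>V\<close> is cancelled by one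
  \<open>W\<close>, and at the end PW = 0.\<close>

lemma ps_nilpotent: "x \<in> ps \<Longrightarrow> \<exists>n. x * W ^ n = 0"
proof (induction rule: ps.induct)
  case P
  show ?case by (rule exI[of _ 1]) (simp add: germ_rel)
next
  case (V x)
  then obtain n where "x * W ^ n = 0" by blast
  moreover have "x * V * W ^ Suc n = x * W ^ n - (x * Q) * W ^ n"
    by (simp add: mult.assoc germ_rel_assoc algebra_simps)
  ultimately show ?case using ps_Q[OF V.hyps] by (intro exI[of _ "Suc n"]) simp
next
  case (C x c)
  then obtain n where "x * W ^ n = 0" by blast
  then show ?case by (intro exI[of _ n]) (simp add: mult.assoc)
next
  case (add x y)
  then obtain n m where "x * W ^ n = 0" "y * W ^ m = 0" by blast
  then show ?case
    using power_mult_zero[of x n "max n m"] power_mult_zero[of y m "max n m"]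
    by (intro exI[of _ "max n m"]) (simp add: distrib_right)
qed

text \<open>The span of the V^j Q, the counterpart of \<open>ps\<close> for the left ideal of
  \<open>Q\<close>.\<close>

inductive_set qs :: "'a germ set" where
  Q: "Q \<in> qs"
| V: "x \<in> qs \<Longrightarrow> V * x \<in> qs"
| C: "x \<in> qs \<Longrightarrow> C c * x \<in> qs"
| add: "x \<in> qs \<Longrightarrow> y \<in> qs \<Longrightarrow> x + y \<in> qs"

lemma qs_GA: "x \<in> qs \<Longrightarrow> x \<in> GA"
  by (induction rule: qs.induct) (auto intro: GA_intros)

lemma qs_zero: "0 \<in> qs"
  using qs.C[OF qs.Q, of 0] by (simp add: C_simps)

lemma qs_Q: "x \<in> qs \<Longrightarrow> x * Q = x"
  by (induction rule: qs.induct) (simp_all add: germ_rel distrib_right mult.assoc)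

lemma P_qs: assumes "x \<in> qs" shows "P * x = 0"
  using P_GA_Q[OF qs_GA[OF assms]] qs_Q[OF assms] by simp

lemma qs_W: "x \<in> qs \<Longrightarrow> W * x \<in> qs"
proof (induction rule: qs.induct)
  case (V x)
  then show ?case by (simp add: germ_rel_assoc P_qs)
next
  case (C x c)
  then show ?case by (simp add: C_left_commute qs.intros)
qed (auto simp: germ_rel qs_zero distrib_left intro: qs.intros)

lemma qs_S: "x \<in> qs \<Longrightarrow> g \<in> loc \<Longrightarrow> S g * x \<in> qs"
proof (induction rule: qs.induct)
  case Q
  then obtain h where h: "h \<in> loc" "g = fps_const (fps_nth g 0) + fps_X * h" using loc_split by blast
  then have "g = fps_const (fps_nth g 0) + h * fps_X" by (simp add: mult.commute)
  then have "S g * Q = (C (fps_nth g 0) + S h * W) * Q" by (metis S_simps(1,2,3,5))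
  then have "S g * Q = C (fps_nth g 0) * Q" by (simp add: distrib_right mult.assoc germ_rel)
  then show ?case by (simp add: qs.intros)
next
  case (V x)
  obtain h where h: "h \<in> loc" "V * S g = S g * V + S h * P - Q * S h"
    using V_S_commutator[OF V.prems] .
  obtain c where "Q * ((S h * x) * Q) = C c * Q"
    using Q_GA_Q[of "S h * x"] V.hyps h(1) by (auto intro: GA_intros qs_GA)
  moreover have "Q * (S h * x) = Q * (S h * (x * Q))" using qs_Q[OF V.hyps] by simp
  then have "Q * (S h * x) = Q * ((S h * x) * Q)" by (simp only: mult.assoc)
  ultimately have "Q * (S h * x) = C c * Q" by simp
  moreover have "S g * V = V * S g - S h * P + Q * S h" using h(2) by (simp add: algebra_simps)
  then have "S g * V * x = (V * S g - S h * P + Q * S h) * x" by simp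
  then have "S g * V * x = V * (S g * x) - S h * (P * x) + Q * (S h * x)"
    by (simp add: left_diff_distrib distrib_right mult.assoc)
  ultimately have "S g * (V * x) = V * (S g * x) + C c * Q"
    using P_qs[OF V.hyps] by (simp add: mult.assoc)
  then show ?case using V.IH V.prems by (auto intro: qs.intros)
next
  case (C x c)
  then show ?case by (simp add: C_left_commute qs.intros)
qed (auto simp: distrib_left intro: qs.intros)

lemma qs_GA_closed: "t \<in> GA \<Longrightarrow> x \<in> qs \<Longrightarrow> t * x \<in> qs"
proof (induction arbitrary: x rule: GA_induct)
  case (inv b)
  then show ?case by (intro qs_S loc_inverse)
next
  case (mult y z)
  then show ?case by (simp add: mult.assoc)
qed (auto simp: qs_zero qs_W distrib_right intro: qs.intros)

lemma qs_nilpotent: "x \<in> qs \<Longrightarrow> \<exists>n. W ^ n * x = 0"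
proof (induction rule: qs.induct)
  case Q
  show ?case by (rule exI[of _ 1]) (simp add: germ_rel)
next
  case (V x)
  then obtain n where "W ^ n * x = 0" by blast
  moreover have "W ^ Suc n * (V * x) = W ^ n * x - W ^ n * (P * x)"
    by (simp add: power_Suc2 mult.assoc germ_rel_assoc right_diff_distrib del: power_Suc)
  ultimately show ?case using P_qs[OF V.hyps] by (intro exI[of _ "Suc n"]) simp
next
  case (C x c)
  then obtain n where "W ^ n * x = 0" by blast
  then show ?case by (intro exI[of _ n]) (simp add: C_left_commute)
next
  case (add x y)
  then obtain n m where "W ^ n * x = 0" "W ^ m * y = 0" by blast
  then show ?case
    using power_mult_zero'[of n x "max n m"] power_mult_zero'[of m y "max n m"]
    by (intro exI[of _ "max n m"]) (simp add: distrib_left)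
qed

section \<open>Regularity\<close>

inductive_set J :: "'a germ set" where
  P: "r \<in> GA \<Longrightarrow> s \<in> GA \<Longrightarrow> r * P * s \<in> J"
| Q: "r \<in> GA \<Longrightarrow> s \<in> GA \<Longrightarrow> r * Q * s \<in> J"
| add: "x \<in> J \<Longrightarrow> y \<in> J \<Longrightarrow> x + y \<in> J"

lemma J_zero: "0 \<in> J"
  using J.P[OF GA_basic(1) GA_basic(1)] by simp

lemma J_left: "x \<in> J \<Longrightarrow> t \<in> GA \<Longrightarrow> t * x \<in> J"
  by (induction rule: J.induct) (auto simp: mult.assoc[symmetric] distrib_left intro: J.intros GA_intros)

lemma J_right: "x \<in> J \<Longrightarrow> t \<in> GA \<Longrightarrow> x * t \<in> J"
  by (induction rule: J.induct) (auto simp: mult.assoc distrib_right intro: J.add J.P[unfolded mult.assoc]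
    J.Q[unfolded mult.assoc] GA_intros)

lemma J_GA: "x \<in> J \<Longrightarrow> x \<in> GA"
  by (induction rule: J.induct) (auto intro: GA_intros)

lemma J_diff: "x \<in> J \<Longrightarrow> y \<in> J \<Longrightarrow> x - y \<in> J"
  using J.add[of x "C (- 1) * y"] J_left[of y "C (- 1)"] GA_basic(7)[of "- 1"] by (simp add: C_simps)

lemma J_diff_trans: "x - y \<in> J \<Longrightarrow> y - z \<in> J \<Longrightarrow> x - z \<in> J"
  using J.add[of "x - y" "y - z"] by simp

text \<open>Ps is killed by a power of \<open>W\<close> on the right, rQ by one on the left, so each
  generator dies between two equal powers. Allowing all larger exponents lets the terms of a sum
  share one.\<close>

lemma J_nilpotent:
  assumes "x \<in> J"
  shows "\<exists>n. \<forall>m\<ge>n. W ^ m * x * W ^ m = 0"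
  using assms
proof (induction rule: J.induct)
  case (P r s)
  obtain n where n: "P * s * W ^ n = 0" using ps_nilpotent[OF P_GA[OF P(2)]] by blast
  have "W ^ m * (r * P * s) * W ^ m = 0" if "m \<ge> n" for m
  proof -
    have "W ^ m * (r * P * s) * W ^ m = W ^ m * r * (P * s * W ^ m)" by (simp only: mult.assoc)
    then show ?thesis using power_mult_zero[OF n that] by simp
  qed
  then show ?case by blast
next
  case (Q r s)
  obtain n where n: "W ^ n * (r * Q) = 0" using qs_nilpotent[OF qs_GA_closed[OF Q(1) qs.Q]] by blast
  have "W ^ m * (r * Q * s) * W ^ m = 0" if "m \<ge> n" for m
  proof -
    have "W ^ m * (r * Q * s) * W ^ m = (W ^ m * (r * Q)) * s * W ^ m" by (simp only: mult.assoc)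
    then show ?thesis using power_mult_zero'[OF n that] by simp
  qed
  then show ?case by blast
next
  case (add x y)
  then obtain n n' where "\<forall>m\<ge>n. W ^ m * x * W ^ m = 0" "\<forall>m\<ge>n'. W ^ m * y * W ^ m = 0" by blast
  then show ?case by (intro exI[of _ "max n n'"]) (simp add: distrib_left distrib_right)
qed

lemma one_minus_VW: "1 - V ^ j * W ^ j \<in> J"
proof (induction j)
  case 0
  show ?case by (simp add: J_zero)
next
  case (Suc j)
  have "V ^ Suc j * W ^ Suc j = V ^ j * (V * W) * W ^ j" by (simp add: power_Suc2 mult.assoc del: power_Suc) (simp add: power_commutes)
  then have eq: "1 - V ^ Suc j * W ^ Suc j = (1 - V ^ j * W ^ j) + V ^ j * Q * W ^ j"
    by (simp add: germ_rel algebra_simps del: power_Suc)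
  show ?case unfolding eq using Suc by (auto intro: J.intros GA_intros)
qed

lemma one_minus_WV: "1 - W ^ j * V ^ j \<in> J"
proof (induction j)
  case 0
  show ?case by (simp add: J_zero)
next
  case (Suc j)
  have "W ^ Suc j * V ^ Suc j = W ^ j * (W * V) * V ^ j" by (simp add: power_Suc2 mult.assoc del: power_Suc) (simp add: power_commutes)
  then have eq: "1 - W ^ Suc j * V ^ Suc j = (1 - W ^ j * V ^ j) + W ^ j * P * V ^ j"
    by (simp add: germ_rel algebra_simps del: power_Suc)
  show ?case unfolding eq using Suc by (auto intro: J.intros GA_intros)
qed

lemma S_V_commute: "g \<in> loc \<Longrightarrow> S g * V ^ j - V ^ j * S g \<in> J"
proof (induction j)
  case 0
  show ?case by (simp add: J_zero)
next
  case (Suc j)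
  obtain h where h: "h \<in> loc" "V * S g = S g * V + S h * P - Q * S h"
    using V_S_commutator[OF Suc.prems] .
  have "S h * P * 1 - 1 * Q * S h \<in> J" using h(1) by (intro J_diff J.intros GA_intros)
  then have 1: "V * S g - S g * V \<in> J" by (simp add: h(2))
  have "S g * V ^ Suc j - V ^ Suc j * S g = V * (S g * V ^ j - V ^ j * S g) - (V * S g - S g * V) * V ^ j"
    by (simp add: algebra_simps)
  moreover have "\<dots> \<in> J"
    using J_diff[OF J_left[OF Suc.IH[OF Suc.prems] GA_basic(4)] J_right[OF 1 GA_power[OF GA_basic(4)]]] .
  ultimately show ?case by metis
qed

text \<open>Modulo \<open>J\<close> the elements \<open>V\<close> and \<open>W\<close> are inverse
  to each other and \<open>V\<close> commutes with g(W), so every element is a fraction with a power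
  of \<open>W\<close> as denominator.\<close>

lemma GA_mod_J:
  assumes "t \<in> GA"
  shows "\<exists>i. \<exists>g\<in>loc. t - V ^ i * S g \<in> J"
  using assms
proof (induction rule: GA_induct)
  case zero
  then show ?case by (intro exI[of _ 0] bexI[of _ 0]) (auto simp: loc_zero S_simps J_zero)
next
  case W
  then show ?case by (intro exI[of _ 0] bexI[of _ fps_X]) (auto simp: loc_X S_simps J_zero)
next
  case V
  then show ?case by (intro exI[of _ 1] bexI[of _ 1]) (auto simp: loc_one S_simps J_zero)
next
  case (inv b)
  then show ?case
    by (intro exI[of _ 0] bexI[of _ "inverse (fps_of_poly b)"]) (auto simp: loc_inverse J_zero)
next
  case (C c)
  then show ?case by (intro exI[of _ 0] bexI[of _ "fps_const c"]) (auto simp: loc_const S_simps J_zero)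
next
  case (add x y)
  then obtain i g j h where g: "g \<in> loc" "x - V ^ i * S g \<in> J" and h: "h \<in> loc" "y - V ^ j * S h \<in> J" by metis
  \<comment> \<open>Passage to a common denominator: V^i g and V^(i+j) x^j g differ by an element of
    \<open>J\<close>.\<close>
  have raise: "V ^ i * S g - V ^ (i + j) * S (fps_X ^ j * g) \<in> J" if "g \<in> loc" for i j g
  proof -
    have "V ^ i * S g - V ^ (i + j) * S (fps_X ^ j * g) = V ^ i * ((1 - V ^ j * W ^ j) * S g)"
      by (simp add: S_simps power_add left_diff_distrib right_diff_distrib mult.assoc)
    moreover have "\<dots> \<in> J"
      using J_left[OF J_right[OF one_minus_VW GA_basic(8)[OF that]] GA_power[OF GA_basic(4)]] .
    ultimately show ?thesis by metis
  qed
  have "x - V ^ (i + j) * S (fps_X ^ j * g) \<in> J" "y - V ^ (j + i) * S (fps_X ^ i * h) \<in> J"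
    using J_diff_trans[OF g(2) raise[OF g(1)]] J_diff_trans[OF h(2) raise[OF h(1)]] by auto
  from J.add[OF this] have "x + y - V ^ (i + j) * S (fps_X ^ j * g + fps_X ^ i * h) \<in> J"
    by (simp add: S_simps algebra_simps)
  moreover have "fps_X ^ j * g + fps_X ^ i * h \<in> loc" using g h by (intro loc_add loc_mult loc_power loc_X)
  ultimately show ?case by blast
next
  case (mult x y)
  then obtain i g j h where g: "g \<in> loc" "x - V ^ i * S g \<in> J" and h: "h \<in> loc" "y - V ^ j * S h \<in> J" by metis
  have "x * y - V ^ (i + j) * S (g * h) = (x - V ^ i * S g) * y + V ^ i * (S g * (y - V ^ j * S h))
      + V ^ i * ((S g * V ^ j - V ^ j * S g) * S h)"
    by (simp add: S_simps power_add algebra_simps)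
  moreover have "\<dots> \<in> J"
    using g h mult.hyps S_V_commute[OF g(1)] by (intro J.add J_left J_right) (auto intro: GA_intros)
  ultimately show ?case using loc_mult[OF g(1) h(1)] by metis
qed

text \<open>Q W^s P = 0 makes WV act as 1 behind Q W^s. This and its counterpart
  \<open>V_W_P\<close> serve to invert the power of x in a decomposition g = x^s u.\<close>

lemma Q_W_V: "Q * (W ^ s * V ^ s) = Q"
proof (induction s)
  case (Suc s)
  have "Q * (W ^ Suc s * V ^ Suc s) = Q * (W ^ s * ((1 - P) * V ^ s))"
    unfolding power_Suc2[of W] power_Suc[of V] germ_rel(1)[symmetric] by (simp only: mult.assoc)
  also have "\<dots> = Q * (W ^ s * V ^ s) - Q * (W ^ s * P) * V ^ s" by (simp add: algebra_simps)
  also have "Q * (W ^ s * P) = 0" using Q_GA_P[of "W ^ s"] by (simp add: GA_intros)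
  finally show ?case using Suc by simp
qed simp

lemma V_W_P: "V ^ s * (W ^ s * P) = P"
proof (induction s)
  case (Suc s)
  have "V ^ Suc s * (W ^ Suc s * P) = V ^ s * ((1 - Q) * (W ^ s * P))"
    unfolding power_Suc2[of V] power_Suc[of W] germ_rel(2)[symmetric] by (simp only: mult.assoc)
  also have "\<dots> = V ^ s * (W ^ s * P) - V ^ s * (Q * (W ^ s * P))" by (simp add: algebra_simps)
  also have "Q * (W ^ s * P) = 0" using Q_GA_P[of "W ^ s"] by (simp add: GA_intros)
  finally show ?case using Suc by simp
qed simp

definition germ_regular :: "'a germ \<Rightarrow> bool" where
  "germ_regular a \<longleftrightarrow> (\<exists>y\<in>GA. a * y * a = a)"

lemma germ_regular_diff:
  assumes "a \<in> GA" "y \<in> GA" "germ_regular (a - a * y * a)"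
  shows "germ_regular a"
proof -
  obtain z where z: "z \<in> GA" "(a - a * y * a) * z * (a - a * y * a) = a - a * y * a"
    using assms(3) by (auto simp: germ_regular_def)
  show ?thesis
    unfolding germ_regular_def
    by (rule regular_of_regular_diff[OF GA_basic(2) GA_closed(1,3,2) assms(1,2) z])
qed

text \<open>Induction on the exponent: b = W^n a satisfies Wb = 0, hence b = Qb = Q g(W), which is
  zero or can be multiplied on the right to give \<open>Q\<close>. The multiplier y makes the defect
  a - a y W^n a be killed already by W^n.\<close>

lemma regular_left_nilpotent:
  "a \<in> GA \<Longrightarrow> W ^ n * a = 0 \<Longrightarrow> germ_regular a"
proof (induction n arbitrary: a)
  case 0
  then show ?case by (auto simp: germ_regular_def intro!: bexI[of _ 0] GA_intros)
next
  case (Suc n)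
  define b where "b = W ^ n * a"
  have bGA: "b \<in> GA" using Suc.prems by (simp add: b_def GA_intros)
  have "W * b = 0" using Suc.prems by (simp add: b_def mult.assoc)
  then have Qb: "Q * b = b" using germ_rel_assoc(2)[of b] by simp
  obtain g where g: "g \<in> loc" "Q * b = Q * S g" using GA_Q[OF bGA] by blast
  show ?case
  proof (cases "g = 0")
    case True
    then have "W ^ n * a = 0" using Qb g by (simp add: S_simps b_def)
    then show ?thesis using Suc by blast
  next
    case False
    then obtain s u where u: "u \<in> loc" "inverse u \<in> loc" "inverse u * u = 1" "g = fps_X ^ s * u"
      using loc_decompose[OF g(1)] by blast
    \<comment> \<open>For g = x^s u this gives by = Q W^s V^s = Q, so that byb = b.\<close>
    define y where "y = S (inverse u) * V ^ s"
    have yGA: "y \<in> GA" using u by (simp add: y_def GA_intros)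
    have "b * y = Q * (S g * S (inverse u)) * V ^ s" using Qb g(2) by (simp add: y_def mult.assoc[symmetric])
    also have "S g * S (inverse u) = W ^ s"
      using u(3) by (simp add: u(4) S_simps(1)[symmetric] mult.assoc mult.commute[of u]) (simp add: S_simps)
    finally have byQ: "b * y = Q" using Q_W_V by (simp add: mult.assoc)
    show ?thesis
    proof (rule germ_regular_diff)
      show "a \<in> GA" "y * W ^ n \<in> GA" using Suc.prems yGA by (simp_all add: GA_intros)
      have "W ^ n * (a - a * (y * W ^ n) * a) = b - b * y * b"
        by (simp add: b_def right_diff_distrib mult.assoc)
      then have "W ^ n * (a - a * (y * W ^ n) * a) = 0" using byQ Qb by simp
      moreover have "a - a * (y * W ^ n) * a \<in> GA" using Suc.prems yGA by (auto intro!: GA_intros)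
      ultimately show "germ_regular (a - a * (y * W ^ n) * a)" by (intro Suc.IH)
    qed
  qed
qed

text \<open>x and V^j W^j x differ by terms V^i Q W^i x with i < j, which Pt annihilates. For j = k
  the second element is zero.\<close>

lemma P_kills_left_nilpotent:
  assumes "t \<in> GA" "W ^ k * x = 0"
  shows "P * (t * x) = 0"
proof -
  have "P * (t * x) = P * (t * (V ^ j * (W ^ j * x)))" for j
  proof (induction j)
    case (Suc j)
    have "V ^ Suc j * (W ^ Suc j * x) = V ^ j * ((1 - Q) * (W ^ j * x))"
      unfolding power_Suc2[of V] power_Suc[of W] germ_rel(2)[symmetric] by (simp only: mult.assoc)
    then have "P * (t * (V ^ Suc j * (W ^ Suc j * x)))
        = P * (t * (V ^ j * (W ^ j * x))) - P * ((t * V ^ j) * Q) * (W ^ j * x)"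
      by (simp only: right_diff_distrib left_diff_distrib mult.assoc mult_1_left)
    moreover have "P * ((t * V ^ j) * Q) = 0" using assms(1) by (intro P_GA_Q) (auto intro: GA_intros)
    ultimately show ?case using Suc by simp
  qed simp
  from this[of k] show ?thesis using assms(2) by simp
qed

text \<open>Induction on the right exponent, with b = a W^n split as bP + bWV. The part bP = g(W)P
  can be inverted up to \<open>P\<close>, while bW is killed by W^k on the left and is thus
  invisible from behind \<open>P\<close>. If bP = 0, the exponent drops at once.\<close>

lemma regular_two_sided_nilpotent:
  "a \<in> GA \<Longrightarrow> W ^ k * a * W ^ n = 0 \<Longrightarrow> germ_regular a"
proof (induction n arbitrary: a)
  case 0
  then show ?case using regular_left_nilpotent[of a k] by simp
next
  case (Suc n)
  define b where "b = a * W ^ n"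
  have bGA: "b \<in> GA" using Suc.prems by (simp add: b_def GA_intros)
  have kb: "W ^ k * (b * W) = 0"
    using Suc.prems by (simp add: b_def mult.assoc power_commutes)
  have split: "b = b * P + b * W * V" by (simp add: mult.assoc germ_rel right_diff_distrib)
  obtain g where g: "g \<in> loc" "b * P = S g * P" using GA_P[OF bGA] by blast
  show ?case
  proof (cases "g = 0")
    case True
    then have "b = b * W * V" using split g(2) by (simp add: S_simps)
    then have "W ^ k * b = (W ^ k * (b * W)) * V" by (metis mult.assoc)
    then have "W ^ k * b = 0" using kb by simp
    then have "W ^ k * a * W ^ n = 0" by (simp add: b_def mult.assoc)
    then show ?thesis using Suc by blast
  next
    case False
    then obtain s u where u: "u \<in> loc" "inverse u \<in> loc" "inverse u * u = 1" "g = fps_X ^ s * u"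
      using loc_decompose[OF g(1)] by blast
    \<comment> \<open>The inverse of g = x^s u on \<open>P\<close>. Its leading factor
      \<open>P\<close> makes y(bW) vanish, so that yb = P.\<close>
    define y where "y = P * (V ^ s * S (inverse u))"
    have yGA: "y \<in> GA" using u by (simp add: y_def GA_intros)
    have "inverse u * g = fps_X ^ s" using u(3) by (simp add: u(4) mult.left_commute)
    then have "S (inverse u) * S g = S (fps_X ^ s)" by (simp only: S_simps(1)[symmetric])
    then have "S (inverse u) * S g = W ^ s" by (simp add: S_simps)
    then have "y * (b * P) = P * (V ^ s * (W ^ s * P))"
      unfolding g(2) by (simp add: y_def mult.assoc) (simp add: mult.assoc[symmetric])
    then have ybP: "y * (b * P) = P" by (simp add: V_W_P germ_rel)
    have "y * (b * W) = 0"
      using P_kills_left_nilpotent[OF _ kb, of "V ^ s * S (inverse u)"] u by (simp add: y_def GA_intros mult.assoc)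
    then have "y * (b * W * V) = 0" by (simp add: mult.assoc[symmetric])
    then have yb: "y * b = P" using ybP split by (metis add.right_neutral distrib_left)
    show ?thesis
    proof (rule germ_regular_diff)
      show "a \<in> GA" "W ^ n * y \<in> GA" using Suc.prems yGA by (simp_all add: GA_intros)
      have "(a - a * (W ^ n * y) * a) * W ^ n = b - b * (y * b)"
        by (simp add: b_def left_diff_distrib mult.assoc)
      \<comment> \<open>Only bWV is left of \<open>b\<close>. It is killed by W^k on the left, so
        the induction hypothesis applies with the same \<open>k\<close>.\<close>
      also have "\<dots> = b * W * V" using split by (simp add: yb algebra_simps)
      finally have "W ^ k * (a - a * (W ^ n * y) * a) * W ^ n = W ^ k * (b * W) * V"
        by (simp add: mult.assoc)
      then have "W ^ k * (a - a * (W ^ n * y) * a) * W ^ n = 0" using kb by simp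
      moreover have "a - a * (W ^ n * y) * a \<in> GA" using Suc.prems yGA by (auto intro!: GA_intros)
      ultimately show "germ_regular (a - a * (W ^ n * y) * a)" by (intro Suc.IH)
    qed
  qed
qed

lemma J_regular: "a \<in> J \<Longrightarrow> germ_regular a"
  using J_nilpotent[of a] regular_two_sided_nilpotent[OF J_GA] by blast

lemma inverse_mod_J:
  assumes "a \<in> GA" "a \<notin> J"
  obtains y where "y \<in> GA" "1 - y * a \<in> J"
proof -
  obtain i g where g: "g \<in> loc" "a - V ^ i * S g \<in> J" using GA_mod_J[OF assms(1)] by blast
  have "g \<noteq> 0" using g(2) assms(2) by (auto simp: S_simps)
  then obtain s u where u: "u \<in> loc" "inverse u \<in> loc" "inverse u * u = 1" "g = fps_X ^ s * u"
    using loc_decompose[OF g(1)] by blast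
  \<comment> \<open>\<open>a\<close> is V^i x^s u modulo \<open>J\<close>, with inverse u^(-1) V^s
    W^i.\<close>
  define y where "y = S (inverse u) * (V ^ s * W ^ i)"
  have yGA: "y \<in> GA" using u by (simp add: y_def GA_intros)
  have Suu: "S (inverse u) * S u = 1" by (simp add: S_simps(1)[symmetric] u(3)) (simp add: S_simps)
  have "1 - y * a = S (inverse u) * (1 - V ^ s * W ^ s) * S u
      + S (inverse u) * (V ^ s * ((1 - W ^ i * V ^ i) * S g)) - y * (a - V ^ i * S g)"
    using Suu by (simp add: y_def u(4) S_simps(1,5,6) left_diff_distrib right_diff_distrib mult.assoc)
  also have "\<dots> \<in> J"
    by (intro J_diff J.add J_left[OF g(2) yGA] J_right[OF J_left[OF one_minus_VW GA_basic(8)[OF u(2)]] GA_basic(8)[OF u(1)]]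
        J_left[OF J_left[OF J_right[OF one_minus_WV GA_basic(8)[OF g(1)]] GA_power[OF GA_basic(4)]] GA_basic(8)[OF u(2)]])
  finally show ?thesis using that yGA by blast
qed

text \<open>With y inverse to \<open>a\<close> modulo \<open>J\<close>, the defect a - aya = a(1 -
  ya) lies in \<open>J\<close>, where regularity is already known.\<close>

lemma GA_regular: assumes "a \<in> GA" shows "germ_regular a"
proof (cases "a \<in> J")
  case False
  then obtain y where y: "y \<in> GA" "1 - y * a \<in> J" using inverse_mod_J[OF assms] by blast
  have "a - a * y * a = a * (1 - y * a)" by (simp add: algebra_simps)
  then show ?thesis
    using germ_regular_diff[OF assms y(1)] J_regular J_left[OF y(2) assms] by simp
qed (rule J_regular)

section \<open>Regularity of the socle and of the whole algebra\<close>

text \<open>bp = b says that only column 0 of \<open>b\<close> can be nonzero. At a level where it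
  is not zero, y reads off one nonzero entry and sends it to the column of F_n; this gives yb = p
  there, and bp = b.\<close>

lemma soc_column_regular:
  assumes "germ b = 0" "b * p = b"
  shows "\<exists>y. germ y = 0 \<and> b * y * b = b"
proof -
  \<comment> \<open>At a level where the column is zero \<open>r n\<close> is arbitrary, and
    \<open>y\<close> is zero there.\<close>
  define r where "r = (\<lambda>n. SOME r. entry b n r 0 \<noteq> 0)"
  define y where "y = mk (\<lambda>n i j. if entry b n (r n) 0 \<noteq> 0 \<and> j = r n
    then coeff (F n) i / entry b n (r n) 0 else 0)"
  have col: "entry b n i j = 0" if "j \<noteq> 0" for n i j
  proof -
    have "entry (b * p) n i j = 0" using that by (simp add: entry_times entry_p)
    then show ?thesis by (simp add: assms(2))
  qed
  have yb: "entry (y * b) n i j = entry p n i j" if "entry b n (r n) 0 \<noteq> 0" "i < n" for n i j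
  proof -
    have r: "r n < n" using that(1) entry_zero[of "r n" n 0 b] by blast
    have "entry (y * b) n i j = (\<Sum>k<n. if k = r n then coeff (F n) i / entry b n (r n) 0 * entry b n k j else 0)"
      unfolding entry_times using that by (intro sum.cong) (auto simp: y_def)
    also have "\<dots> = entry p n i j" using r that col[of j] by (auto simp: entry_p)
    finally show ?thesis .
  qed
  have "b * (y * b) = b"
  proof (rule tm_eqI)
    fix n i j :: nat assume ij: "i < n" "j < n"
    show "entry (b * (y * b)) n i j = entry b n i j"
    proof (cases "entry b n (r n) 0 \<noteq> 0")
      case True
      then have "entry (b * (y * b)) n i j = entry (b * p) n i j" by (simp add: entry_times[of b] yb)
      then show ?thesis by (simp add: assms(2))
    next
      case False
      then have "entry b n k 0 = 0" for k unfolding r_def by (metis (mono_tags, lifting) someI)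
      then have "entry b n k l = 0" for k l using col by (cases "l = 0") auto
      then show ?thesis by (simp add: entry_times[of b])
    qed
  qed
  moreover have "germ y = 0"
  proof -
    obtain N where "\<forall>n\<ge>N. \<forall>i j. entry b n i j = 0" using assms(1) germ_eq_iff[of b 0] by auto
    then have "germ y = germ 0" by (intro germ_eqI[of N]) (simp add: y_def)
    then show ?thesis by simp
  qed
  ultimately show ?thesis by (metis mult.assoc)
qed

text \<open>x vanishes from some level N on, and \<open>w ^ N\<close> vanishes at the levels up to
  N.\<close>

lemma soc_nilpotent: "germ x = 0 \<Longrightarrow> \<exists>N. x * w ^ N = 0"
proof -
  assume "germ x = 0"
  then obtain N where N: "\<forall>n\<ge>N. \<forall>i j. entry x n i j = 0" using germ_eq_iff[of x 0] by auto
  have "x * w ^ N = 0"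
  proof (rule tm_eqI)
    fix n i j :: nat assume "i < n" "j < n"
    then show "entry (x * w ^ N) n i j = entry 0 n i j"
      using N by (cases "n \<ge> N") (auto simp: entry_times entry_shift_power intro!: sum.neutral)
  qed
  then show ?thesis ..
qed

text \<open>The induction on the nilpotency exponent once more, now with matrices at finitely many
  levels: bw = 0 gives bp = b.\<close>

lemma soc_regular:
  assumes "germ a = 0"
  shows "\<exists>y\<in>alg. a * y * a = a"
proof -
  have *: "germ a = 0 \<Longrightarrow> a * w ^ n = 0 \<Longrightarrow> \<exists>y\<in>alg. a * y * a = a" for n a
  proof (induction n arbitrary: a)
    case 0
    then show ?case by (auto intro!: bexI[of _ 0] alg_zero)
  next
    case (Suc n)
    define b where "b = a * w ^ n"
    have "b * w = 0" using Suc.prems by (simp add: b_def mult.assoc power_commutes)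
    then have "b * (w * v) = 0" by (simp add: mult.assoc[symmetric])
    then have bp: "b * p = b" by (simp add: w_v right_diff_distrib)
    obtain y where y: "germ y = 0" "b * y * b = b"
      using soc_column_regular[OF _ bp] Suc.prems(1) by (auto simp: b_def)
    let ?a = "a - a * (w ^ n * y) * a"
    have "?a * w ^ n = b - b * y * b" by (simp add: b_def left_diff_distrib mult.assoc)
    then have "?a * w ^ n = 0" using y(2) by simp
    moreover have "germ ?a = 0" using Suc.prems(1) by simp
    ultimately obtain z where z: "z \<in> alg" "?a * z * ?a = ?a" using Suc.IH by blast
    show ?case
      by (rule regular_of_regular_diff[OF alg_one alg.add alg_diff alg.mult _ _ z])
        (use y(1) Suc.prems(1) in \<open>auto intro: alg.soc\<close>)
  qed
  obtain N where "a * w ^ N = 0" using soc_nilpotent[OF assms] ..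
  then show ?thesis using *[OF assms] by blast
qed

text \<open>A quasi-inverse of the germ lifts to a y whose defect a - aya lies in the socle.\<close>

theorem alg_regular:
  assumes "a \<in> alg"
  shows "\<exists>y\<in>alg. a * y * a = a"
proof -
  have "germ a \<in> GA" using assms by (simp add: GA_def)
  then obtain y where y: "y \<in> alg" "germ a * germ y * germ a = germ a"
    using GA_regular[of "germ a"] by (auto simp: germ_regular_def GA_def)
  then have "germ (a - a * y * a) = 0" by simp
  then obtain z where z: "z \<in> alg" "(a - a * y * a) * z * (a - a * y * a) = a - a * y * a"
    using soc_regular by blast
  show ?thesis
    by (rule regular_of_regular_diff[OF alg_one alg.add alg_diff alg.mult assms y(1) z])
qed

end

section \<open>Idempotents\<close>

text \<open>The central idempotents of T. They need not belong to the algebra, but for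
  \<open>A\<close> finite or a tail multiplication by \<open>lev A\<close> preserves it.\<close>

definition lev :: "nat set \<Rightarrow> 'a::comm_ring_1 tm" where
  "lev A = diag (\<lambda>n. if n \<in> A then 1 else 0)"

lemma entry_lev: "entry (lev A * x) n i j = (if n \<in> A then entry x n i j else 0)"
  by (simp add: lev_def)

lemma lev_commute: "x * lev A = lev A * x"
  by (simp add: lev_def diag_commute)

lemma lev_left_commute: "x * (lev A * y) = lev A * (x * y)"
  by (metis lev_commute mult.assoc)

lemma lev_lev: "lev A * (lev B * x) = lev (A \<inter> B) * x"
  by (rule tm_eqI) (simp add: entry_lev)

lemma lev_mult: "(lev A * x) * (lev B * y) = lev (A \<inter> B) * (x * y)"
  by (simp only: mult.assoc lev_left_commute[of x] lev_lev)

lemma lev_union: "A \<inter> B = {} \<Longrightarrow> lev (A \<union> B) * x = lev A * x + lev B * x"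
  by (rule tm_eqI) (auto simp: entry_lev)

lemma lev_empty: "lev {} * x = 0"
  by (rule tm_eqI) (simp add: entry_lev)

lemma germ_lev_finite: "finite A \<Longrightarrow> germ (lev A * x) = 0"
proof -
  assume "finite A"
  then obtain N where "\<forall>n\<in>A. n < N" using finite_nat_set_iff_bounded by auto
  then have "germ (lev A * x) = germ 0" by (intro germ_eqI[of N]) (auto simp: entry_lev)
  then show ?thesis by simp
qed

context levels
begin

lemma alg_lev_finite: "finite A \<Longrightarrow> lev A * x \<in> alg"
  by (intro alg.soc germ_lev_finite)

lemma alg_lev_greater: "x \<in> alg \<Longrightarrow> lev {l<..} * x \<in> alg"
proof -
  have "{..l} \<inter> {l<..} = {}" "{..l} \<union> {l<..} = UNIV" by auto
  then have "lev UNIV * x = lev {..l} * x + lev {l<..} * x" by (metis lev_union)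
  moreover have "lev UNIV * x = x" by (rule tm_eqI) (simp add: entry_lev)
  ultimately have "lev {l<..} * x = x - lev {..l} * x" by (simp add: algebra_simps)
  then show "x \<in> alg \<Longrightarrow> lev {l<..} * x \<in> alg" by (simp add: alg_diff alg_lev_finite)
qed

definition D :: "nat \<Rightarrow> 'a tm" where "D l = w ^ l * v ^ l"

text \<open>The idempotent \<open>D 0\<close> is 1 and stands for x_0 + y_0, so x_l corresponds to
  \<open>D (Suc l)\<close>. The rank of the latter at level n is n - 1 - l, in agreement with
  \<open>gen_rank\<close>.\<close>

fun E :: "gen \<Rightarrow> 'a tm" where
  "E (gen_x l) = D (Suc l)"
| "E (gen_y l) = lev {l<..} * p"
| "E (gen_z l) = lev {l<..} * q"
| "E (gen_a l) = lev {Suc l} * p"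

text \<open>A calculus of equivalences and orthogonal sums of idempotents inside the matrices;
  \<open>tmrep_rep\<close> translates it into isomorphisms of modules.\<close>

inductive tmrep :: "'a tm \<Rightarrow> gen multiset \<Rightarrow> bool" where
  gen: "tmrep (E g) {#g#}"
| zero: "tmrep 0 {#}"
| equiv: "\<lbrakk>a \<in> alg; b \<in> alg; a * b = e; e * e = e; b * a = f; f * f = f; tmrep f u\<rbrakk> \<Longrightarrow> tmrep e u"
| add: "\<lbrakk>e \<in> alg; f \<in> alg; e * e = e; f * f = f; e * f = 0; f * e = 0; tmrep e u; tmrep f t\<rbrakk> \<Longrightarrow> tmrep (e + f) (u + t)"

text \<open>w^l is zero at the levels up to l. Multiplication by it turns relations that hold at all
  levels above l into exact ones.\<close>

lemma w_power_lev: "lev {l<..} * (w ^ l * x) = w ^ l * x"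
proof (rule tm_eqI)
  fix n i j :: nat assume "i < n" "j < n"
  then show "entry (lev {l<..} * (w ^ l * x)) n i j = entry (w ^ l * x) n i j"
    by (cases "l < n") (auto simp: entry_lev entry_times[of "w ^ l"] entry_shift_power intro!: sum.neutral)
qed

lemma w_lev: "w ^ l * (lev {l<..} * x) = w ^ l * x"
  by (simp only: lev_left_commute[of "w ^ l"] w_power_lev)

lemma lev_p_v_q: "i < l \<Longrightarrow> lev {l<..} * (p * (v ^ i * q)) = 0"
  using entry_p_v_q[of i] by (intro tm_eqI) (auto simp: entry_lev mult.assoc)

lemma w_p_v_q: assumes "i < l" shows "w ^ l * (p * (v ^ i * q)) = 0"
proof -
  have "w ^ l * (p * (v ^ i * q)) = lev {l<..} * (w ^ l * (p * (v ^ i * q)))" by (simp add: w_power_lev)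
  also have "\<dots> = w ^ l * (lev {l<..} * (p * (v ^ i * q)))" by (simp only: w_lev w_power_lev)
  finally show ?thesis using lev_p_v_q[OF assms] by simp
qed

lemma Suc_wv: "w ^ Suc l * (v ^ Suc j * x) = w ^ l * (v ^ j * x) - w ^ l * (p * (v ^ j * x))"
proof -
  have "w ^ Suc l * (v ^ Suc j * x) = w ^ l * ((w * v) * (v ^ j * x))"
    unfolding power_Suc2[of w] power_Suc[of v] by (simp only: mult.assoc)
  then show ?thesis by (simp add: w_v left_diff_distrib right_diff_distrib)
qed

lemma Suc_vw: "v ^ Suc l * (w ^ Suc j * x) = v ^ l * (w ^ j * x) - v ^ l * (q * (w ^ j * x))"
proof -
  have "v ^ Suc l * (w ^ Suc j * x) = v ^ l * ((v * w) * (w ^ j * x))"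
    unfolding power_Suc2[of v] power_Suc[of w] by (simp only: mult.assoc)
  then show ?thesis by (simp add: v_w left_diff_distrib right_diff_distrib)
qed

text \<open>Cancelling the factors wv one after the other leaves w^(l-i) q = 0 and error terms w^k p
  v^j q with j < k, which are exactly zero.\<close>

lemma w_v_q: "i < l \<Longrightarrow> w ^ l * (v ^ i * q) = 0"
proof (induction i arbitrary: l)
  case 0
  then show ?case by (cases l) (simp_all add: power_Suc2 mult.assoc w_q del: power_Suc)
next
  case (Suc i)
  then obtain k where k: "l = Suc k" "i < k" by (cases l) auto
  then show ?case using Suc.IH[OF k(2)] w_p_v_q[OF k(2)] by (simp add: Suc_wv del: power_Suc)
qed

text \<open>v^j w^j differs from 1 by the terms v^i q w^i with i < j, all of which w^l kills. For j
  = l this makes \<open>D l\<close> idempotent.\<close>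

lemma w_v_w: "j \<le> l \<Longrightarrow> w ^ l * (v ^ j * w ^ j) = w ^ l"
proof (induction j)
  case (Suc j)
  have "v ^ Suc j * w ^ Suc j = v ^ j * w ^ j - v ^ j * (q * w ^ j)"
    using Suc_vw[of j j 1] by (simp del: power_Suc)
  then have "w ^ l * (v ^ Suc j * w ^ Suc j) = w ^ l * (v ^ j * w ^ j) - (w ^ l * (v ^ j * q)) * w ^ j"
    by (simp only: right_diff_distrib mult.assoc)
  then show ?case using Suc w_v_q[of j l] by simp
qed simp

lemma D_w: "D l * w ^ l = w ^ l"
  using w_v_w[of l l] by (simp add: D_def mult.assoc)

lemma D_D: "D l * D l = D l"
proof -
  have "D l * D l = (D l * w ^ l) * v ^ l" by (simp add: D_def mult.assoc)
  then show ?thesis by (simp add: D_w) (simp add: D_def)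
qed

lemma D_Suc: "D (Suc l) = D l - w ^ l * (p * v ^ l)"
  using Suc_wv[of l l 1] by (simp add: D_def)

lemma D_lev: "lev {l<..} * (D l * x) = D l * x"
  using w_power_lev[of l "v ^ l * x"] by (simp add: D_def mult.assoc)

lemma lev_p_v_w: "j \<le> l \<Longrightarrow> lev {l<..} * (p * (v ^ j * (w ^ j * x))) = lev {l<..} * (p * x)"
proof (induction j)
  case (Suc j)
  have "lev {l<..} * (p * (v ^ Suc j * (w ^ Suc j * x)))
      = lev {l<..} * (p * (v ^ j * (w ^ j * x))) - (lev {l<..} * (p * (v ^ j * q))) * (w ^ j * x)"
    by (simp only: Suc_vw right_diff_distrib mult.assoc)
  then show ?case using Suc lev_p_v_q[of j l] by simp
qed simp

lemma D_D_Suc: "D l * D (Suc l) = D (Suc l)"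
proof -
  have "D l * D (Suc l) = (D l * w ^ l) * (w * v ^ Suc l)"
    unfolding D_def power_Suc2[of w] by (simp only: mult.assoc)
  also have "\<dots> = w ^ Suc l * v ^ Suc l" unfolding D_w power_Suc2[of w] by (simp only: mult.assoc)
  finally show ?thesis by (simp add: D_def)
qed

lemma D_Suc_D: "D (Suc l) * D l = D (Suc l)"
proof -
  have "w ^ l * (p * v ^ l) * D l = w ^ l * (p * (v ^ l * (w ^ l * v ^ l)))" by (simp add: D_def mult.assoc)
  also have "\<dots> = w ^ l * (lev {l<..} * (p * (v ^ l * (w ^ l * v ^ l))))"
    by (simp only: w_lev)
  also have "\<dots> = w ^ l * (p * v ^ l)"
    by (simp only: lev_p_v_w[OF order_refl] w_lev)
  finally show ?thesis by (simp add: D_Suc left_diff_distrib D_D)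
qed

text \<open>w^l v^l differs from 1 by terms w^j p v^j with j < l, and p v^j q vanishes at the levels
  above l.\<close>

lemma D_q: "D l * q = lev {l<..} * q"
proof -
  have *: "lev {l<..} * (w ^ j * (v ^ j * q)) = lev {l<..} * q" if "j \<le> l" for j
    using that
  proof (induction j)
    case (Suc j)
    have "lev {l<..} * (w ^ j * (p * (v ^ j * q))) = w ^ j * (lev {l<..} * (p * (v ^ j * q)))"
      by (simp only: lev_left_commute[of "w ^ j"])
    then have "lev {l<..} * (w ^ j * (p * (v ^ j * q))) = 0" using Suc lev_p_v_q[of j l] by simp
    then show ?case using Suc unfolding Suc_wv by (simp add: right_diff_distrib)
  qed simp
  from *[of l] show ?thesis using w_power_lev[of l "v ^ l * q"] by (simp add: D_def mult.assoc)
qed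

lemma alg_D: "D l \<in> alg"
  unfolding D_def by (intro alg.mult alg_power alg.w alg.v)

lemma E_alg: "E g \<in> alg"
  by (cases g) (auto intro: alg_D alg_lev_greater alg_lev_finite alg_p alg_q)

lemma lev_idem: "e * e = e \<Longrightarrow> (lev A * e) * (lev A * e) = lev A * e"
  by (simp add: lev_mult)

lemma lev_orth: "e * e = e \<Longrightarrow> A \<inter> B = {} \<Longrightarrow> (lev A * e) * (lev B * e) = 0"
  by (simp add: lev_mult lev_empty)

lemma E_idem: "E g * E g = E g"
  by (cases g) (simp_all add: D_D lev_idem p_p q_q)

text \<open>\<open>D l\<close> exceeds \<open>D (Suc l)\<close> by w^l p v^l, and this idempotent is
  identified with \<open>p\<close> cut off to n > l by means of w^l p and p v^l.\<close>

lemma tmrep_D_y: "tmrep (D l) {#gen_x l, gen_y l#}"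
proof -
  let ?f = "w ^ l * (p * v ^ l)"
  have f: "?f = D l - D (Suc l)" by (simp add: D_Suc)
  have ff: "?f * ?f = ?f" "?f * D (Suc l) = 0" "D (Suc l) * ?f = 0"
    unfolding f by (simp_all add: algebra_simps D_D D_D_Suc D_Suc_D)
  have "tmrep ?f {#gen_y l#}"
  proof (rule tmrep.equiv)
    show "(p * v ^ l) * (w ^ l * p) = lev {l<..} * p"
    proof -
      have "(p * v ^ l) * (w ^ l * p) = p * (v ^ l * (lev {l<..} * (w ^ l * p)))"
        by (simp add: w_power_lev mult.assoc)
      also have "\<dots> = lev {l<..} * (p * (v ^ l * (w ^ l * p)))"
        by (simp only: lev_left_commute[of "v ^ l"] lev_left_commute[of p])
      finally show ?thesis by (simp add: lev_p_v_w p_p)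
    qed
    show "(w ^ l * p) * (p * v ^ l) = ?f"
      using p_p by (simp add: mult.assoc) (simp add: mult.assoc[symmetric])
    show "tmrep (lev {l<..} * p) {#gen_y l#}" using tmrep.gen[of "gen_y l"] by simp
  qed (auto intro: alg.intros alg_p alg_power simp: ff lev_idem p_p)
  moreover have "tmrep (D (Suc l)) {#gen_x l#}" using tmrep.gen[of "gen_x l"] by simp
  moreover have "?f \<in> alg" by (auto intro: alg.intros alg_p alg_power)
  ultimately have "tmrep (D (Suc l) + ?f) ({#gen_x l#} + {#gen_y l#})"
    using ff by (intro tmrep.add alg_D D_D)
  then show ?thesis by (simp add: f add_mset_commute)
qed

text \<open>A second splitting of the same idempotent. Conjugation by \<open>w\<close> and
  \<open>v\<close> identifies \<open>D (Suc l)\<close> with D v w D = D - D q D, where D is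
  \<open>D l\<close>; the remaining D q D is equivalent to \<open>q\<close> cut off to n >
  l.\<close>

lemma tmrep_D_z: "tmrep (D l) {#gen_x l, gen_z l#}"
proof -
  let ?f = "D l * (q * D l)"
  have DD: "D l * (D l * x) = D l * x" "q * (q * x) = q * x" "D l * (q * x) = lev {l<..} * (q * x)" for x
    using D_D[of l] q_q D_q[of l] by (simp_all add: mult.assoc[symmetric])
  have fD: "?f * D l = ?f" "D l * ?f = ?f" 
    by (simp_all add: mult.assoc DD D_D lev_left_commute[of "D l"] lev_lev)
  have ff: "?f * ?f = ?f" by (simp add: mult.assoc DD lev_left_commute[of "D l"] lev_left_commute[of q] lev_lev D_D)
  have fa: "?f \<in> alg" by (intro alg.mult alg_D alg_q)
  have g: "(D l - ?f) * (D l - ?f) = D l - ?f" "(D l - ?f) * ?f = 0" "?f * (D l - ?f) = 0"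
    by (simp_all add: left_diff_distrib right_diff_distrib D_D fD ff)
  have 1: "tmrep ?f {#gen_z l#}"
  proof (rule tmrep.equiv)
    show "(D l * q) * (q * D l) = ?f" by (simp add: mult.assoc DD)
    show "(q * D l) * (D l * q) = lev {l<..} * q"
      by (simp add: mult.assoc DD D_D D_q lev_left_commute[of q] lev_left_commute[of "D l"] lev_lev q_q)
    show "tmrep (lev {l<..} * q) {#gen_z l#}" using tmrep.gen[of "gen_z l"] by simp
  qed (auto intro: alg.mult alg_q alg_D simp: ff lev_idem q_q)
  have 2: "tmrep (D l - ?f) {#gen_x l#}"
  proof (rule tmrep.equiv)
    have "(D l * v) * (w * D l) = D l * ((v * w) * D l)" by (simp only: mult.assoc)
    then show "(D l * v) * (w * D l) = D l - ?f" by (simp add: v_w left_diff_distrib right_diff_distrib D_D)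
    have "(w * D l) * (D l * v) = w * (D l * D l) * v" by (simp only: mult.assoc)
    then show "(w * D l) * (D l * v) = D (Suc l)"
      unfolding D_D by (simp add: D_def mult.assoc power_commutes)
    show "tmrep (D (Suc l)) {#gen_x l#}" using tmrep.gen[of "gen_x l"] by simp
  qed (auto intro: alg.mult alg.w alg.v alg_D simp: g D_D)
  have "tmrep ((D l - ?f) + ?f) ({#gen_x l#} + {#gen_z l#})"
    using 1 2 g ff fa by (intro tmrep.add alg_diff alg_D)
  then show ?thesis by (simp add: add_mset_commute)
qed

text \<open>At each level \<open>pq\<close> is the column of \<open>p\<close> times the row of \<open>q\<close>, and \<open>qp\<close> conversely.\<close>

definition pq :: "'a tm" where
  "pq = mk (\<lambda>n i j. coeff (F n) i * coeff (F n) (n - Suc j))"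

definition qp :: "'a tm" where
  "qp = mk (\<lambda>n i j. if Suc i = n \<and> j = 0 then 1 else 0)"

lemma pq_qp: "pq * qp = p"
proof (rule tm_eqI)
  fix n i j :: nat assume ij: "i < n" "j < n"
  have "entry (pq * qp) n i j = (\<Sum>k<n. if k = n - 1 then if j = 0 then coeff (F n) i else 0 else 0)"
    unfolding entry_times using ij by (intro sum.cong) (auto simp: pq_def qp_def)
  then show "entry (pq * qp) n i j = entry p n i j" using ij by (simp add: entry_p)
qed

lemma qp_pq: "qp * pq = q"
proof (rule tm_eqI)
  fix n i j :: nat assume ij: "i < n" "j < n"
  have "entry (qp * pq) n i j = (\<Sum>k<n. if k = 0 then if Suc i = n then coeff (F n) (n - Suc j) else 0 else 0)"
    unfolding entry_times using ij by (intro sum.cong) (auto simp: pq_def qp_def)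
  then show "entry (qp * pq) n i j = entry q n i j" using ij by (auto simp: entry_q)
qed

lemma tmrep_p_level: "tmrep (lev {Suc l} * p) {#gen_a l#}"
  using tmrep.gen[of "gen_a l"] by simp

text \<open>At a single level \<open>p\<close> and \<open>q\<close> have rank one and are
  equivalent. The intertwiners are restricted to finitely many levels because P t Q = 0 for all t in
  \<open>GA\<close> excludes \<open>pq\<close> itself from the algebra.\<close>

lemma tmrep_q_level: "tmrep (lev {Suc l} * q) {#gen_a l#}"
proof (rule tmrep.equiv[OF _ _ _ _ _ _ tmrep_p_level])
  show "(lev {Suc l} * qp) * (lev {Suc l} * pq) = lev {Suc l} * q"
    "(lev {Suc l} * pq) * (lev {Suc l} * qp) = lev {Suc l} * p"
    by (simp_all add: lev_mult qp_pq pq_qp)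
qed (auto intro: alg_lev_finite lev_idem p_p q_q)

lemma lev_greater: "lev {l<..} * x = lev {Suc l<..} * x + lev {Suc l} * x"
proof -
  have "{l<..} = {Suc l<..} \<union> {Suc l}" by auto
  then show ?thesis using lev_union[of "{Suc l<..}" "{Suc l}" x] by simp
qed

lemma tmrep_split:
  assumes "e \<in> alg" "e * e = e" "tmrep (lev {Suc l<..} * e) u" "tmrep (lev {Suc l} * e) t"
  shows "tmrep (lev {l<..} * e) (u + t)"
  unfolding lev_greater[of l]
  using assms by (intro tmrep.add lev_idem lev_orth alg_lev_greater alg_lev_finite) auto

text \<open>The relations for y_l and z_l separate level l + 1 from the higher ones. Those for x_l
  are the two splittings of \<open>D (Suc l)\<close>, and the remaining relation comes from the two
  splittings of \<open>D 0\<close>.\<close>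

lemma tmrep_relations:
  assumes "(u, t) \<in> M_relations"
  shows "\<exists>e\<in>alg. tmrep e u \<and> tmrep e t"
proof -
  have y: "tmrep (lev {l<..} * p) {#gen_y l#}" for l using tmrep.gen[of "gen_y l"] by simp
  have z: "tmrep (lev {l<..} * q) {#gen_z l#}" for l using tmrep.gen[of "gen_z l"] by simp
  have x: "tmrep (D (Suc l)) {#gen_x l#}" for l using tmrep.gen[of "gen_x l"] by simp
  have "tmrep (lev {l<..} * p) {#gen_y (Suc l), gen_a l#}" for l
    using tmrep_split[OF alg_p p_p y tmrep_p_level] by (simp add: add_mset_commute)
  moreover have "tmrep (lev {l<..} * q) {#gen_z (Suc l), gen_a l#}" for l
    using tmrep_split[OF alg_q q_q z tmrep_q_level] by (simp add: add_mset_commute)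
  moreover have "lev {l<..} * p \<in> alg" "lev {l<..} * q \<in> alg" for l
    by (intro alg_lev_greater alg_p alg_q)+
  ultimately show ?thesis
    using assms x y z alg_D tmrep_D_y tmrep_D_z unfolding M_relations_def by (auto; blast)
qed

end

lemma diag_left_commute: "x * (diag s * y) = diag s * (x * y)"
  by (simp add: diag_commute mult.assoc[symmetric])

context levels
begin

lemma entry_p_0: "1 \<le> n \<Longrightarrow> entry p n 0 0 = 1"
  by (simp add: entry_p)

lemma entry_q_last: "1 \<le> n \<Longrightarrow> entry q n (n - 1) (n - 1) = 1"
  by (simp add: entry_q)

section \<open>Idempotents in the corners of p and q\<close>

text \<open>\<open>h\<close> is \<open>g\<close> times one scalar per level, and idempotence makes
  each scalar 0 or 1. Membership in the algebra forces the scalars to be eventually constant, so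
  \<open>h\<close> is \<open>g\<close> cut off to a finite or cofinite set of levels.\<close>

lemma corner_idempotent_rep:
  assumes g: "g \<in> alg" "g * g = g"
    and corner: "\<And>t. \<exists>s. g * t * g = diag s * g"
    and germ_corner: "\<And>t. t \<in> GA \<Longrightarrow> \<exists>c. germ g * (t * germ g) = C c * germ g"
    and nonzero: "\<And>n. 1 \<le> n \<Longrightarrow> \<exists>i j. entry g n i j \<noteq> 0"
    and tail: "\<And>l. tmrep (lev {l<..} * g) {#G l#}"
    and level: "\<And>l. tmrep (lev {Suc l} * g) {#gen_a l#}"
    and h: "h \<in> alg" "h * h = h" "g * h = h" "h * g = h"
  shows "\<exists>u. tmrep h u"
proof -
  have ghg: "g * h * g = h" by (simp add: h)
  then obtain s where s: "h = diag s * g" using corner[of h] by auto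
  have "h * h = diag s * (diag s * (g * g))"
    by (simp only: s mult.assoc diag_left_commute[of g])
  then have "entry (diag s * (diag s * g)) n i j = entry (diag s * g) n i j" for n i j
    using h(2) s g(2) by simp
  note ss = this
  have s2: "s n * s n = s n" if n: "1 \<le> n" for n
  proof -
    obtain i j where "entry g n i j \<noteq> 0" using nonzero[OF n] by blast
    then show ?thesis using ss[of n i j] by auto
  qed
  then have s01: "s n = 0 \<or> s n = 1" if "1 \<le> n" for n using that by auto
  \<comment> \<open>Level 0 carries only the empty matrix and is left out, as the a's begin at level
    1.\<close>
  define A where "A = {n. 1 \<le> n \<and> s n = 1}"
  have hA: "h = lev A * g"
  proof (rule tm_eqI)
    fix n i j :: nat assume "i < n" "j < n"
    then show "entry h n i j = entry (lev A * g) n i j"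
      using s01[of n] by (auto simp: s entry_lev A_def)
  qed
  have fin: "\<exists>u. tmrep (lev B * g) u" if "finite B" "B \<subseteq> {1..}" for B
    using that
  proof (induction B rule: finite_induct)
    case empty
    then show ?case using tmrep.zero by (auto simp: lev_empty)
  next
    case (insert n B)
    then obtain u where u: "tmrep (lev B * g) u" by auto
    obtain l where l: "n = Suc l" using insert.prems by (cases n) auto
    have "tmrep (lev {n} * g + lev B * g) ({#gen_a l#} + u)"
      using u level[of l] insert.hyps g l
      by (intro tmrep.add alg_lev_finite lev_idem lev_orth) auto
    moreover have "lev (insert n B) * g = lev {n} * g + lev B * g"
      using lev_union[of "{n}" B g] insert.hyps by simp
    ultimately show ?case by auto
  qed
  obtain c where "germ g * (germ h * germ g) = C c * germ g" using germ_corner h(1) by (auto simp: GA_def)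
  moreover have "germ g * (germ h * germ g) = germ h" using ghg by (metis germ_simps(4) mult.assoc)
  ultimately have "germ (diag s * g) = germ (diag (\<lambda>_. c) * g)" using s by simp
  then obtain N where N: "\<And>n i j. N \<le> n \<Longrightarrow> s n * entry g n i j = c * entry g n i j"
    unfolding germ_eq_iff by auto
  have sc: "s n = c" if n: "N \<le> n" "1 \<le> n" for n
  proof -
    obtain i j where "entry g n i j \<noteq> 0" using nonzero[OF n(2)] by blast
    then show ?thesis using N[OF n(1), of i j] by simp
  qed
  show ?thesis
  proof (cases "c = 1")
    case False
    then have "A \<subseteq> {..N}" using sc unfolding A_def by (auto intro: ccontr)
    then have "finite A" "A \<subseteq> {1..}" using finite_subset by (auto simp: A_def)
    then show ?thesis using fin hA by simp
  next
    case True
    \<comment> \<open>The tail above \<open>N\<close> is one y or z of index \<open>N\<close>; the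
      levels up to \<open>N\<close> give finitely many a's.\<close>
    have A: "A = {N<..} \<union> (A \<inter> {..N})" using sc True by (auto simp: A_def not_le)
    have "finite (A \<inter> {..N})" "A \<inter> {..N} \<subseteq> {1..}" by (auto simp: A_def)
    then obtain u where u: "tmrep (lev (A \<inter> {..N}) * g) u" using fin by blast
    have "tmrep (lev {N<..} * g + lev (A \<inter> {..N}) * g) ({#G N#} + u)"
      using u tail g by (intro tmrep.add alg_lev_finite alg_lev_greater lev_idem lev_orth) auto
    moreover have "h = lev {N<..} * g + lev (A \<inter> {..N}) * g"
      unfolding hA by (subst A, subst lev_union) auto
    ultimately show ?thesis by auto
  qed
qed

lemma p_corner_rep:
  assumes "h \<in> alg" "h * h = h" "p * h = h" "h * p = h"
  shows "\<exists>u. tmrep h u"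
proof (rule corner_idempotent_rep[OF alg_p p_p _ P_GA_P _ _ tmrep_p_level assms, of gen_y])
  show "\<exists>s. p * t * p = diag s * p" for t using p_t_p by blast
  show "\<exists>i j. entry p n i j \<noteq> 0" if "1 \<le> n" for n using entry_p_0[OF that] zero_neq_one by metis
  show "tmrep (lev {l<..} * p) {#gen_y l#}" for l using tmrep.gen[of "gen_y l"] by simp
qed

lemma q_corner_rep:
  assumes "h \<in> alg" "h * h = h" "q * h = h" "h * q = h"
  shows "\<exists>u. tmrep h u"
proof (rule corner_idempotent_rep[OF alg_q q_q _ Q_GA_Q _ _ tmrep_q_level assms, of gen_z])
  show "\<exists>s. q * t * q = diag s * q" for t using q_t_q by blast
  show "\<exists>i j. entry q n i j \<noteq> 0" if "1 \<le> n" for n using entry_q_last[OF that] zero_neq_one by metis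
  show "tmrep (lev {l<..} * q) {#gen_z l#}" for l using tmrep.gen[of "gen_z l"] by simp
qed

section \<open>Idempotents inside and outside the ideal J\<close>

text \<open>The elements of RpR + RqR themselves, not their germs, with the summands displayed in
  the form that \<open>rep_embedded\<close> takes.\<close>

definition corner_sum :: "'a tm \<Rightarrow> bool" where
  "corner_sum x \<longleftrightarrow> (\<exists>(n::nat) r g c. x = (\<Sum>i<n. r i * g i * c i) \<and>
     (\<forall>i<n. r i \<in> alg \<and> c i \<in> alg \<and> (g i = p \<or> g i = q)))"

lemma corner_sum_single: "\<lbrakk>r \<in> alg; c \<in> alg; g = p \<or> g = q\<rbrakk> \<Longrightarrow> corner_sum (r * g * c)"
  unfolding corner_sum_def
  by (intro exI[of _ "Suc 0"] exI[of _ "\<lambda>_. r"] exI[of _ "\<lambda>_. g"] exI[of _ "\<lambda>_. c"]) simp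

lemma corner_sum_zero: "corner_sum 0"
  unfolding corner_sum_def by (intro exI[of _ 0]) simp

lemma corner_sum_add:
  assumes "corner_sum x" "corner_sum y"
  shows "corner_sum (x + y)"
proof -
  obtain n :: nat and r g c where x: "x = (\<Sum>i<n. r i * g i * c i)"
    "\<forall>i<n. r i \<in> alg \<and> c i \<in> alg \<and> (g i = p \<or> g i = q)" using assms(1) unfolding corner_sum_def by blast
  obtain m :: nat and r' g' c' where y: "y = (\<Sum>i<m. r' i * g' i * c' i)"
    "\<forall>i<m. r' i \<in> alg \<and> c' i \<in> alg \<and> (g' i = p \<or> g' i = q)" using assms(2) unfolding corner_sum_def by blast
  let ?j = "\<lambda>f f' i. if i < n then f i else f' (i - n)"
  have I: "{..<n + m} = {..<n} \<union> {n..<n + m}" by auto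
  have "(\<Sum>i<n + m. ?j r r' i * ?j g g' i * ?j c c' i)
      = (\<Sum>i<n. r i * g i * c i) + (\<Sum>i\<in>{n..<n + m}. r' (i - n) * g' (i - n) * c' (i - n))"
    unfolding I by (subst sum.union_disjoint) (auto intro!: arg_cong2[of _ _ _ _ "(+)"] sum.cong)
  also have "(\<Sum>i\<in>{n..<n + m}. r' (i - n) * g' (i - n) * c' (i - n)) = y"
    unfolding y(1) by (rule sum.reindex_bij_witness[of _ "\<lambda>i. i + n" "\<lambda>i. i - n"]) auto
  finally have "x + y = (\<Sum>i<n + m. ?j r r' i * ?j g g' i * ?j c c' i)" by (simp add: x(1))
  then show ?thesis unfolding corner_sum_def
    using x(2) y(2) by (intro exI[of _ "n + m"] exI[of _ "?j r r'"] exI[of _ "?j g g'"] exI[of _ "?j c c'"]) auto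
qed

text \<open>x - x D n telescopes into the terms x w^i p v^i with i < n, and x D n contains the
  factor x w^n = 0.\<close>

lemma corner_sum_nilpotent: "x \<in> alg \<Longrightarrow> x * w ^ n = 0 \<Longrightarrow> corner_sum x"
proof -
  assume x: "x \<in> alg" "x * w ^ n = 0"
  have "corner_sum (x - x * D n)" for n
  proof (induction n)
    case 0
    show ?case by (simp add: D_def corner_sum_zero)
  next
    case (Suc n)
    have eq: "x - x * D (Suc n) = (x - x * D n) + (x * w ^ n) * p * v ^ n"
      by (simp add: D_Suc right_diff_distrib mult.assoc)
    show ?case
      unfolding eq using Suc x(1) by (auto intro!: corner_sum_add corner_sum_single alg.mult alg_power alg.w alg.v)
  qed
  from this[of n] show ?thesis using x(2) by (simp add: D_def mult.assoc[symmetric])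
qed

text \<open>A representation of the germ lifts to the algebra. The error lies in the socle, hence is
  killed by a power of \<open>w\<close> on the right and is itself a sum of terms r p c.\<close>

lemma corner_sum_of_J:
  assumes "x \<in> alg" "germ x \<in> J"
  shows "corner_sum x"
proof -
  have "\<exists>y\<in>alg. corner_sum y \<and> germ y = z" if "z \<in> J" for z
    using that
  proof (induction rule: J.induct)
    case (P r s)
    then obtain r' s' where "r' \<in> alg" "s' \<in> alg" "r = germ r'" "s = germ s'" by (auto simp: GA_def)
    then show ?case by (intro bexI[of _ "r' * p * s'"]) (auto intro: corner_sum_single alg.mult alg_p)
  next
    case (Q r s)
    then obtain r' s' where "r' \<in> alg" "s' \<in> alg" "r = germ r'" "s = germ s'" by (auto simp: GA_def)
    then show ?case by (intro bexI[of _ "r' * q * s'"]) (auto intro: corner_sum_single alg.mult alg_q)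
  next
    case (add x y)
    then obtain x' y' where "x' \<in> alg" "corner_sum x'" "germ x' = x" "y' \<in> alg" "corner_sum y'" "germ y' = y" by blast
    then show ?case by (intro bexI[of _ "x' + y'"]) (auto intro: corner_sum_add alg.add)
  qed
  then obtain y where y: "y \<in> alg" "corner_sum y" "germ y = germ x" using assms(2) by blast
  then have "germ (x - y) = 0" by simp
  then have "corner_sum (x - y)"
    using soc_nilpotent corner_sum_nilpotent alg_diff[OF assms(1) y(1)] by blast
  from corner_sum_add[OF this y(2)] show ?thesis by simp
qed

text \<open>
  Here $1 - e \in J$, so $w^N (1 - e) w^N = 0$ for some $N$, exactly and not only modulo the socle
  because $w^N$ vanishes at the levels up to $N$. Hence $w^N e w^N = w^{2N}$.
\<close>

lemma idempotent_split:
  assumes e: "e \<in> alg" "e * e = e" "germ e \<notin> J"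
  obtains f l where "f \<in> alg" "f * f = f" "e * f = f" "f * e = f" "tmrep f {#gen_x l#}" "germ (e - f) \<in> J"
proof -
  have eGA: "germ e \<in> GA" using e(1) by (simp add: GA_def)
  obtain y where y: "y \<in> GA" "1 - y * germ e \<in> J" using inverse_mod_J[OF eGA e(3)] .
  have ee: "germ e * germ e = germ e" by (simp only: germ_simps(4)[symmetric] e(2))
  \<comment> \<open>As e(1 - e) = 0, multiplying 1 - ye by 1 - e gives back 1 - e, which therefore
    lies in \<open>J\<close>.\<close>
  have "(1 - y * germ e) * (1 - germ e) = (1 - germ e) - y * (germ e - germ e * germ e)"
    by (simp add: algebra_simps)
  then have "(1 - y * germ e) * (1 - germ e) = 1 - germ e" by (simp add: ee)
  then have dJ: "1 - germ e \<in> J" using J_right[OF y(2), of "1 - germ e"] eGA by (simp add: GA_intros)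
  then obtain m where "W ^ m * (1 - germ e) * W ^ m = 0" using J_nilpotent by blast
  then have "germ (w ^ m * (1 - e) * w ^ m) = germ 0" by simp
  then obtain n0 where n0: "\<And>n i j. n \<ge> n0 \<Longrightarrow> entry (w ^ m * (1 - e) * w ^ m) n i j = 0"
    unfolding germ_eq_iff by auto
  \<comment> \<open>The additional one keeps \<open>N\<close> positive, so that N + N - 1 below is
    the index of an x.\<close>
  define N where "N = Suc (max m n0)"
  have N: "m \<le> N" "n0 \<le> N" by (auto simp: N_def)
  have "w ^ N * (1 - e) * w ^ N = 0"
  proof -
    obtain k where k: "N = m + k" using N(1) le_Suc_ex by blast
    have z: "lev {N<..} * (w ^ m * (1 - e) * w ^ m) = 0"
      by (rule tm_eqI) (use n0 N(2) in \<open>auto simp: entry_lev\<close>)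
    have wN: "w ^ k * w ^ m = w ^ N" "w ^ m * w ^ k = w ^ N"
      by (simp_all add: k power_add[symmetric] add.commute)
    have "(w ^ k * w ^ m) * (1 - e) * (w ^ m * w ^ k) = w ^ k * ((w ^ m * (1 - e) * w ^ m) * w ^ k)"
      by (simp only: mult.assoc)
    then have "w ^ N * (1 - e) * w ^ N = w ^ k * ((w ^ m * (1 - e) * w ^ m) * w ^ k)"
      unfolding wN .
    moreover have "lev {N<..} * (w ^ N * (1 - e) * w ^ N) = w ^ N * (1 - e) * w ^ N"
      using w_power_lev[of N "(1 - e) * w ^ N"] by (simp add: mult.assoc)
    moreover have "lev {N<..} * (w ^ k * ((w ^ m * (1 - e) * w ^ m) * w ^ k))
        = w ^ k * ((lev {N<..} * (w ^ m * (1 - e) * w ^ m)) * w ^ k)"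
      by (simp only: mult.assoc lev_left_commute[of "w ^ k"])
    ultimately show ?thesis by (simp add: z)
  qed
  then have wew: "w ^ N * (e * w ^ N) = w ^ (N + N)"
    by (simp add: right_diff_distrib left_diff_distrib power_add mult.assoc)
  let ?D = "D (N + N)"
  \<comment> \<open>Since w^N e w^N = w^(2N), these elements satisfy ab = D (2N). Then ba is
    idempotent because b absorbs D (2N) on the right, and it lies below \<open>e\<close>.\<close>
  define a where "a = ?D * (w ^ N * e)"
  define b where "b = e * (w ^ N * (v ^ (N + N) * ?D))"
  have ab: "a * b = ?D"
  proof -
    have "a * b = ?D * ((w ^ N * ((e * e) * w ^ N)) * (v ^ (N + N) * ?D))"
      by (simp only: a_def b_def mult.assoc)
    also have "\<dots> = ?D * (?D * ?D)" unfolding e(2) wew by (simp add: D_def mult.assoc)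
    finally show ?thesis by (simp add: D_D)
  qed
  define f where "f = b * a"
  have ba: "b * ?D = b" by (simp add: b_def mult.assoc D_D)
  have ff: "f * f = f"
  proof -
    have "f * f = b * (a * b) * a" by (simp only: f_def mult.assoc)
    then show ?thesis by (simp add: ab ba f_def)
  qed
  have alg: "a \<in> alg" "b \<in> alg"
    unfolding a_def b_def by (intro alg.mult alg_D alg_power alg.w alg.v e)+
  have eb: "e * b = b" by (simp only: b_def mult.assoc[symmetric] e(2))
  have ae: "a * e = a" by (simp only: a_def mult.assoc e(2))
  have ef: "e * f = f" "f * e = f"
    by (simp add: f_def mult.assoc[symmetric] eb) (simp add: f_def mult.assoc ae)
  have "tmrep f {#gen_x (N + N - 1)#}"
  proof (rule tmrep.equiv[OF alg(2,1) _ ff ab D_D])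
    have "Suc (N + N - 1) = N + N" by (simp add: N_def)
    then show "tmrep ?D {#gen_x (N + N - 1)#}" using tmrep.gen[of "gen_x (N + N - 1)"] by simp
  qed (simp add: f_def)
  moreover have "germ (e - f) \<in> J"
  proof -
    let ?x = "V ^ (N + N) * W ^ (N + N)"
    let ?y = "V ^ N * W ^ N"
    have fe: "f = e * (w ^ N * (v ^ (N + N) * (w ^ (N + N) * (v ^ (N + N) * (w ^ N * e)))))"
    proof -
      have DD: "?D * (?D * x) = ?D * x" for x by (simp add: mult.assoc[symmetric] D_D)
      show ?thesis by (simp only: f_def a_def b_def mult.assoc DD) (simp only: D_def mult.assoc)
    qed
    \<comment> \<open>Modulo \<open>J\<close> the powers of \<open>V\<close> cancel those of
      \<open>W\<close>, so f agrees with ee = e there.\<close>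
    have 1: "germ e - germ f = germ e * ((1 - W ^ N * (?x * (V ^ N * ?y))) * germ e)"
      by (simp add: fe power_add left_diff_distrib right_diff_distrib mult.assoc ee)
    have "1 - a * (x * (b * y)) = (1 - a * b) + a * ((1 - x) * b) + a * (x * (b * (1 - y)))"
      for a b x y :: "'a germ" by (simp add: algebra_simps)
    then have 2: "1 - W ^ N * (?x * (V ^ N * ?y)) = (1 - W ^ N * V ^ N) + W ^ N * ((1 - ?x) * V ^ N)
        + W ^ N * (?x * (V ^ N * (1 - ?y)))" .
    have VW: "V ^ N \<in> GA" "W ^ N \<in> GA" "?x \<in> GA" by (intro GA_intros)+
    have "1 - W ^ N * (?x * (V ^ N * ?y)) \<in> J"
      unfolding 2
      by (rule J.add[OF J.add[OF one_minus_WV J_left[OF J_right[OF one_minus_VW VW(1)] VW(2)]]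
            J_left[OF J_left[OF J_left[OF one_minus_VW VW(1)] VW(3)] VW(2)]])
    from J_left[OF J_right[OF this eGA] eGA] show ?thesis by (simp only: germ_simps(2) 1)
  qed
  ultimately show ?thesis using that[of f] alg ff ef by (auto simp: f_def intro: alg.mult)
qed

end

section \<open>Rank at a level\<close>

text \<open>Padding with zeros makes both matrices square of size card I. A right inverse of a
  square matrix is also a left inverse, but in the other order the product has a zero row if card J
  is smaller.\<close>

lemma card_le_of_right_inverse:
  fixes \<alpha> :: "'i \<Rightarrow> 'j \<Rightarrow> 'a::field"
  assumes fin: "finite I" "finite J"
    and inv: "\<And>i k. \<lbrakk>i \<in> I; k \<in> I\<rbrakk> \<Longrightarrow> (\<Sum>j\<in>J. \<alpha> i j * \<beta> j k) = (if i = k then 1 else 0)"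
  shows "card I \<le> card J"
proof (rule ccontr)
  let ?m = "card I" and ?n = "card J"
  assume "\<not> ?m \<le> ?n"
  then have n: "?n < ?m" by simp
  obtain a where a: "bij_betw a {0..<?m} I" using ex_bij_betw_nat_finite[OF fin(1)] by blast
  obtain b where b: "bij_betw b {0..<?n} J" using ex_bij_betw_nat_finite[OF fin(2)] by blast
  define A where "A = mat ?m ?m (\<lambda>(i, j). if j < ?n then \<alpha> (a i) (b j) else 0)"
  define B where "B = mat ?m ?m (\<lambda>(j, k). if j < ?n then \<beta> (b j) (a k) else 0)"
  have AB: "A \<in> carrier_mat ?m ?m" "B \<in> carrier_mat ?m ?m" by (simp_all add: A_def B_def)
  have "A * B = 1\<^sub>m ?m"
  proof (rule eq_matI)
    fix i k assume "i < dim_row (1\<^sub>m ?m :: 'a mat)" "k < dim_col (1\<^sub>m ?m :: 'a mat)"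
    then have ik: "i < ?m" "k < ?m" by simp_all
    have "(A * B) $$ (i, k) = (\<Sum>j\<in>{0..<?m}. if j < ?n then \<alpha> (a i) (b j) * \<beta> (b j) (a k) else 0)"
      using ik by (auto simp: A_def B_def scalar_prod_def intro!: sum.cong)
    also have "\<dots> = (\<Sum>j\<in>{0..<?n}. \<alpha> (a i) (b j) * \<beta> (b j) (a k))"
      using n by (intro sum.mono_neutral_cong_right) auto
    also have "\<dots> = (\<Sum>j\<in>J. \<alpha> (a i) j * \<beta> j (a k))"
      by (rule sum.reindex_bij_betw[OF b, of "\<lambda>j. \<alpha> (a i) j * \<beta> j (a k)"])
    also have "\<dots> = (if a i = a k then 1 else 0)"
    proof -
      have "a i \<in> I" "a k \<in> I" using a ik by (auto simp: bij_betw_def)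
      then show ?thesis by (rule inv)
    qed
    also have "a i = a k \<longleftrightarrow> i = k" using a ik by (auto simp: bij_betw_def inj_on_def)
    finally show "(A * B) $$ (i, k) = 1\<^sub>m ?m $$ (i, k)" using ik by simp
  qed (use AB in auto)
  then have "B * A = 1\<^sub>m ?m" by (rule mat_mult_left_right_inverse[OF AB])
  moreover have "(B * A) $$ (?n, ?n) = 0"
    using n by (auto simp: A_def B_def scalar_prod_def intro!: sum.neutral)
  ultimately show False using n by simp
qed

lemma entry_lev_self: "entry (lev {n} * x) n i j = entry x n i j"
  by (simp add: entry_lev)

context levels
begin

text \<open>In T the idempotents \<open>p\<close> and \<open>q\<close> are equivalent. These
  intertwiners carry either of them to \<open>p\<close>, whose corner is read off at position (0,
  0).\<close>

definition to_p :: "'a tm \<Rightarrow> 'a tm" where "to_p k = (if k = p then p else pq)"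
definition of_p :: "'a tm \<Rightarrow> 'a tm" where "of_p k = (if k = p then p else qp)"

lemma to_of_p: "k = p \<or> k = q \<Longrightarrow> to_p k * of_p k = p" "k = p \<or> k = q \<Longrightarrow> of_p k * to_p k = k"
  by (auto simp: to_p_def of_p_def pq_qp qp_pq p_p)

lemma entry_of_p: "j \<noteq> 0 \<Longrightarrow> entry (of_p k) n i j = 0"
  by (simp add: of_p_def entry_p qp_def)

text \<open>The left factor ends in \<open>of_p k\<close>, so only its column 0 can be nonzero and
  the sum for the corner entry has a single term.\<close>

lemma entry_corner_mult:
  assumes "1 \<le> n"
  shows "entry ((x * of_p k) * y) n 0 0 = entry (x * of_p k) n 0 0 * entry y n 0 0"
proof -
  have "entry (x * of_p k) n 0 l = 0" if "l \<noteq> 0" for l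
    using that by (simp add: entry_times entry_of_p)
  then have "entry ((x * of_p k) * y) n 0 0 = (\<Sum>l<n. if l = 0 then entry (x * of_p k) n 0 l * entry y n l 0 else 0)"
    unfolding entry_times[of "x * of_p k"] by (intro sum.cong) auto
  then show ?thesis using assms by simp
qed

text \<open>At level n each e_i and f_j in question is \<open>p\<close> or \<open>q\<close>, so the
  entries of A and B become scalars, and AB = 1 becomes an identity between scalar matrices indexed
  by \<open>I\<close> and \<open>K'\<close>. The columns outside \<open>K'\<close> have to
  contribute nothing at this level.\<close>

lemma card_le_at_level:
  assumes n: "1 \<le> n" and fin: "finite I" "finite K" "K' \<subseteq> K"
    and e: "\<And>i. i \<in> I \<Longrightarrow> (k i = p \<or> k i = q) \<and> lev {n} * e i = lev {n} * k i"
    and f: "\<And>j. j \<in> K' \<Longrightarrow> (k' j = p \<or> k' j = q) \<and> lev {n} * f j = lev {n} * k' j"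
    and A: "\<And>i j. \<lbrakk>i \<in> I; j \<in> K'\<rbrakk> \<Longrightarrow> A i j * f j = A i j"
    and AB: "\<And>i l. \<lbrakk>i \<in> I; l \<in> I\<rbrakk> \<Longrightarrow> (\<Sum>j\<in>K. A i j * B j l) = (if i = l then e i else 0)"
    and rest: "\<And>i j l. \<lbrakk>i \<in> I; j \<in> K - K'; l \<in> I\<rbrakk> \<Longrightarrow> lev {n} * (A i j * B j l) = 0"
  shows "card I \<le> card K'"
proof (rule card_le_of_right_inverse)
  show "finite I" "finite K'" using fin finite_subset by auto
  let ?\<alpha> = "\<lambda>i j. entry (to_p (k i) * A i j * of_p (k' j)) n 0 0"
  let ?\<beta> = "\<lambda>j l. entry (to_p (k' j) * (B j l * of_p (k l))) n 0 0"
  fix i l assume il: "i \<in> I" "l \<in> I"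
  have "?\<alpha> i j * ?\<beta> j l = entry (to_p (k i) * ((A i j * B j l) * of_p (k l))) n 0 0" if j: "j \<in> K'" for j
  proof -
    have "?\<alpha> i j * ?\<beta> j l = entry ((to_p (k i) * A i j * of_p (k' j)) * (to_p (k' j) * (B j l * of_p (k l)))) n 0 0"
      by (rule entry_corner_mult[OF n, symmetric])
    also have "\<dots> = entry (to_p (k i) * (A i j * ((of_p (k' j) * to_p (k' j)) * (B j l * of_p (k l))))) n 0 0"
      by (simp only: mult.assoc)
    also have "of_p (k' j) * to_p (k' j) = k' j" using to_of_p(2) f[OF j] by blast
    \<comment> \<open>An entry at level n does not change when \<open>lev {n}\<close> is inserted,
      and only behind it may \<open>k' j\<close> be replaced by \<open>f j\<close>.\<close>
    also have "entry (to_p (k i) * (A i j * (k' j * (B j l * of_p (k l))))) n 0 0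
        = entry (to_p (k i) * (A i j * ((lev {n} * k' j) * (B j l * of_p (k l))))) n 0 0"
      by (subst entry_lev_self[symmetric])
        (simp only: mult.assoc lev_left_commute[of "to_p _"] lev_left_commute[of "A _ _"])
    also have "lev {n} * k' j = lev {n} * f j" using f[OF j] by simp
    also have "entry (to_p (k i) * (A i j * ((lev {n} * f j) * (B j l * of_p (k l))))) n 0 0
        = entry (to_p (k i) * ((A i j * f j) * (B j l * of_p (k l)))) n 0 0"
      by (subst (2) entry_lev_self[symmetric])
        (simp only: mult.assoc lev_left_commute[of "to_p _"] lev_left_commute[of "A _ _"])
    also have "A i j * f j = A i j" by (rule A[OF il(1) j])
    finally show ?thesis by (simp only: mult.assoc)
  qed
  then have "(\<Sum>j\<in>K'. ?\<alpha> i j * ?\<beta> j l) = entry (\<Sum>j\<in>K'. to_p (k i) * ((A i j * B j l) * of_p (k l))) n 0 0"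
    by (simp add: entry_sum)
  also have "\<dots> = entry (to_p (k i) * ((\<Sum>j\<in>K'. A i j * B j l) * of_p (k l))) n 0 0"
    by (simp add: sum_distrib_left sum_distrib_right)
  also have "\<dots> = entry (to_p (k i) * ((lev {n} * (\<Sum>j\<in>K'. A i j * B j l)) * of_p (k l))) n 0 0"
    by (subst entry_lev_self[symmetric]) (simp only: mult.assoc lev_left_commute[of "to_p _"])
  also have "lev {n} * (\<Sum>j\<in>K'. A i j * B j l) = lev {n} * (\<Sum>j\<in>K. A i j * B j l)"
    unfolding sum_distrib_left using fin il rest by (intro sum.mono_neutral_left) auto
  also have "\<dots> = (if i = l then lev {n} * k i else 0)" using AB[OF il] e[OF il(1)] by (cases "i = l") auto
  also have "entry (to_p (k i) * ((if i = l then lev {n} * k i else 0) * of_p (k l))) n 0 0 = (if i = l then 1 else 0)"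
  proof (cases "i = l")
    case True
    have "to_p (k i) * ((lev {n} * k i) * of_p (k i)) = lev {n} * ((to_p (k i) * k i) * of_p (k i))"
      by (simp only: mult.assoc lev_left_commute[of "to_p _"])
    also have "to_p (k i) * k i = to_p (k i) * (of_p (k i) * to_p (k i))"
      using to_of_p(2)[of "k i"] e[OF il(1)] by simp
    also have "(to_p (k i) * (of_p (k i) * to_p (k i))) * of_p (k i) = (to_p (k i) * of_p (k i)) * (to_p (k i) * of_p (k i))"
      by (simp only: mult.assoc)
    also have "\<dots> = p" using to_of_p(1)[of "k i"] e[OF il(1)] by (simp add: p_p)
    finally show ?thesis using True n by (simp add: entry_lev entry_p_0)
  qed simp
  finally show "(\<Sum>j\<in>K'. ?\<alpha> i j * ?\<beta> j l) = (if i = l then 1 else 0)" .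
qed

fun kind :: "gen \<Rightarrow> 'a tm" where
  "kind (gen_z l) = q" | "kind g = p"

lemma kind_cases: "kind g = p \<or> kind g = q"
  by (cases g) auto

lemma lev_E_zero: "gen_rank n g = 0 \<Longrightarrow> lev {n} * E g = 0"
proof (cases g)
  case (gen_x l)
  assume "gen_rank n g = 0"
  then have "{n} \<inter> {Suc l<..} = {}" using gen_x by auto
  then have "lev {n} * (lev {Suc l<..} * (D (Suc l) * 1)) = 0" unfolding lev_lev by (simp add: lev_empty)
  then show ?thesis using gen_x D_lev[of "Suc l" 1] by simp
qed (auto simp: lev_lev lev_empty split: if_splits)

lemma lev_E_kind: "gen_type g \<noteq> 0 \<Longrightarrow> gen_rank n g \<noteq> 0 \<Longrightarrow> lev {n} * E g = lev {n} * kind g"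
  by (cases g) (auto simp: lev_lev Int_absorb2 split: if_splits)

end

lemma rank_at_mset: "rank_at n (mset xs) = (\<Sum>i<length xs. gen_rank n (xs ! i))"
  by (simp add: rank_at_def sum_mset_sum_list sum_list_sum_nth atLeast0LessThan flip: mset_map)

lemma type_count_mset: "type_count t (mset xs) = card {i. i < length xs \<and> gen_type (xs ! i) = t}"
  by (simp add: type_count_def length_filter_conv_card flip: mset_filter)

lemma normal_form_gen_x:
  assumes "g \<in># normal_form L m b c k" "gen_type g = 0"
  shows "g = gen_x L"
proof -
  have "set_mset (\<Sum>l\<in>S. replicate_mset (k l) (gen_a l)) \<subseteq> range gen_a" for S :: "nat set"
    by (induction S rule: infinite_finite_induct) (auto split: if_splits)
  then have "gen_type g = 3" if "g \<in># (\<Sum>l<L. replicate_mset (k l) (gen_a l))"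
    using that by fastforce
  then show ?thesis using assms by (auto simp: normal_form_def split: if_splits)
qed

section \<open>V of a ring isomorphic to the algebra\<close>

text \<open>Any ring identified with \<open>alg\<close> by \<open>psi\<close>; this separates the
  computations with matrices from the concrete form of the ring.\<close>

locale alg_ring = levels F + R?: ring R
  for F :: "nat \<Rightarrow> 'a::field poly" and R :: "('r, 's) ring_scheme" (structure) +
  fixes psi :: "'r \<Rightarrow> 'a tm"
  assumes psi_bij: "bij_betw psi (carrier R) alg"
    and psi_mult: "\<lbrakk>x \<in> carrier R; y \<in> carrier R\<rbrakk> \<Longrightarrow> psi (x \<otimes> y) = psi x * psi y"
    and psi_add: "\<lbrakk>x \<in> carrier R; y \<in> carrier R\<rbrakk> \<Longrightarrow> psi (x \<oplus> y) = psi x + psi y"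
    and psi_one: "psi \<one> = 1"
begin

definition phi :: "'a tm \<Rightarrow> 'r" where "phi = inv_into (carrier R) psi"

lemma psi_alg: "x \<in> carrier R \<Longrightarrow> psi x \<in> alg"
  using psi_bij by (auto simp: bij_betw_def)

lemma phi_carrier: "x \<in> alg \<Longrightarrow> phi x \<in> carrier R"
  using psi_bij unfolding phi_def bij_betw_def by (metis inv_into_into)

lemma psi_phi: "x \<in> alg \<Longrightarrow> psi (phi x) = x"
  using bij_betw_inv_into_right[OF psi_bij] by (simp add: phi_def)

lemma phi_psi: "x \<in> carrier R \<Longrightarrow> phi (psi x) = x"
  using bij_betw_inv_into_left[OF psi_bij] by (simp add: phi_def)

lemma psi_zero: "psi \<zero> = 0"
  using psi_add[of \<zero> \<zero>] by simp

lemma phi_mult: "x \<in> alg \<Longrightarrow> y \<in> alg \<Longrightarrow> phi (x * y) = phi x \<otimes> phi y"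
  using phi_psi[of "phi x \<otimes> phi y"] by (simp add: psi_mult phi_carrier psi_phi)

lemma phi_mult_eq: "\<lbrakk>x \<in> alg; y \<in> alg; x * y = z\<rbrakk> \<Longrightarrow> phi x \<otimes> phi y = phi z"
  by (auto simp: phi_mult)

lemma phi_add: "x \<in> alg \<Longrightarrow> y \<in> alg \<Longrightarrow> phi (x + y) = phi x \<oplus> phi y"
  using phi_psi[of "phi x \<oplus> phi y"] by (simp add: psi_add phi_carrier psi_phi)

lemma phi_zero: "phi 0 = \<zero>"
  using phi_psi[of \<zero>] by (simp add: psi_zero)

lemma psi_finsum: "f \<in> I \<rightarrow> carrier R \<Longrightarrow> psi (\<Oplus>i\<in>I. f i) = (\<Sum>i\<in>I. psi (f i))"
proof (induction I rule: infinite_finite_induct)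
  case (insert i I)
  then show ?case by (simp add: finsum_insert Pi_iff psi_add)
qed (simp_all add: psi_zero)

lemma phi_idem: "e \<in> alg \<Longrightarrow> e * e = e \<Longrightarrow> idem R (phi e)"
  by (simp add: idem_def phi_carrier phi_mult[symmetric])

lemma R_regular: "a \<in> carrier R \<Longrightarrow> \<exists>x\<in>carrier R. a = a \<otimes> x \<otimes> a"
proof -
  assume a: "a \<in> carrier R"
  then obtain y where y: "y \<in> alg" "psi a * y * psi a = psi a" using alg_regular[OF psi_alg] by blast
  then have "phi (psi a) \<otimes> phi y \<otimes> phi (psi a) = phi (psi a)"
    using psi_alg[OF a] by (simp only: phi_mult[symmetric] alg.mult)
  then have "a = a \<otimes> phi y \<otimes> a" by (simp add: phi_psi[OF a])
  then show ?thesis using phi_carrier[OF y(1)] by blast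
qed

sublocale idem_family R "\<lambda>g. phi (E g)"
proof
  show "idem R (phi (E g))" for g by (intro phi_idem E_alg E_idem)
  show "\<one> \<noteq> \<zero>"
  proof
    assume "\<one> = \<zero>"
    then have "(1 :: 'a tm) = 0" using psi_one psi_zero by simp
    then show False by simp
  qed
qed (rule R_regular)

lemma tmrep_rep: "tmrep e u \<Longrightarrow> rep (phi e) u"
proof (induction rule: tmrep.induct)
  case (gen g)
  show ?case by (rule rep_gen)
next
  case zero
  show ?case by (simp add: phi_zero rep_zero)
next
  case (equiv a b e f u)
  have ef: "e \<in> alg" "f \<in> alg" using equiv.hyps by (auto intro: alg.mult)
  show ?case
    by (rule rep_equiv[OF phi_carrier phi_carrier phi_mult_eq phi_mult_eq phi_mult_eq phi_mult_eq equiv.IH])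
      (fact ef equiv.hyps)+
next
  case (add e f u t)
  then show ?case 
    by (simp add: phi_add rep_add phi_carrier phi_mult[symmetric] phi_zero)
qed

lemma rep_relations: "(u, t) \<in> M_relations \<Longrightarrow> \<exists>e\<in>carrier R. rep e u \<and> rep e t"
  using tmrep_relations tmrep_rep phi_carrier by blast

lemma rep_corner_sum:
  assumes "e \<in> alg" "e * e = e" "corner_sum e"
  shows "\<exists>u. rep (phi e) u"
proof -
  obtain n :: nat and r g c where e: "e = (\<Sum>i<n. r i * g i * c i)"
    and rgc: "\<And>i. i < n \<Longrightarrow> r i \<in> alg \<and> c i \<in> alg \<and> (g i = p \<or> g i = q)"
    using assms(3) unfolding corner_sum_def by blast
  have g: "g i \<in> alg" "g i * g i = g i" if "i < n" for i
    using rgc[OF that] alg_p alg_q p_p q_q by auto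
  show ?thesis
  proof (rule rep_embedded[of "{..<n}"])
    show "idem R (phi e)" using assms by (intro phi_idem)
    show "idem R (phi (g i))" if "i \<in> {..<n}" for i using g that by (intro phi_idem) auto
    show "phi (r i) \<in> carrier R \<and> phi (c i) \<in> carrier R" if "i \<in> {..<n}" for i
      using rgc that by (auto intro: phi_carrier)
    have "psi (\<Oplus>i\<in>{..<n}. phi (r i) \<otimes> phi (g i) \<otimes> phi (c i)) = e"
      unfolding e using rgc g
      by (subst psi_finsum) (auto simp: psi_mult phi_carrier psi_phi intro!: sum.cong)
    moreover have "(\<Oplus>i\<in>{..<n}. phi (r i) \<otimes> phi (g i) \<otimes> phi (c i)) \<in> carrier R"
      using rgc g by (intro finsum_closed) (simp add: Pi_iff phi_carrier)
    ultimately show "phi e = (\<Oplus>i\<in>{..<n}. phi (r i) \<otimes> phi (g i) \<otimes> phi (c i))"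
      using phi_psi by metis
    fix i h assume i: "i \<in> {..<n}" and h: "idem R h" "phi (g i) \<otimes> h = h" "h \<otimes> phi (g i) = h"
    have hc: "h \<in> carrier R" "h \<otimes> h = h" using h by (auto simp: idem_def)
    have gi: "g i \<in> alg" using g i by simp
    have "psi h * psi h = psi h" using psi_mult[OF hc(1) hc(1)] hc(2) by simp
    moreover have "g i * psi h = psi h" "psi h * g i = psi h"
      using psi_mult[OF phi_carrier[OF gi] hc(1)] psi_mult[OF hc(1) phi_carrier[OF gi]] h
      by (simp_all add: psi_phi[OF gi])
    ultimately have "\<exists>u. tmrep (psi h) u"
      using p_corner_rep[OF psi_alg[OF hc(1)]] q_corner_rep[OF psi_alg[OF hc(1)]] rgc[of i] i by auto
    then show "\<exists>u. rep h u" using tmrep_rep phi_psi[OF hc(1)] by metis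
  qed simp
qed

lemma idem_rep:
  assumes "idem R e"
  shows "\<exists>u. rep e u"
proof -
  have ec: "e \<in> carrier R" "e \<otimes> e = e" using assms by (auto simp: idem_def)
  let ?e = "psi e"
  have e: "?e \<in> alg" "?e * ?e = ?e" using psi_alg psi_mult[OF ec(1) ec(1)] ec by auto
  show ?thesis
  proof (cases "germ ?e \<in> J")
    case True
    then show ?thesis using rep_corner_sum[OF e corner_sum_of_J[OF e(1)]] phi_psi[OF ec(1)] by simp
  next
    case False
    then obtain f l where f: "f \<in> alg" "f * f = f" "?e * f = f" "f * ?e = f" "tmrep f {#gen_x l#}" "germ (?e - f) \<in> J"
      using idempotent_split[OF e] by blast
    let ?d = "?e - f"
    have d: "?d \<in> alg" "?d * ?d = ?d" "f * ?d = 0" "?d * f = 0"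
      using e f by (auto intro: alg_diff simp: left_diff_distrib right_diff_distrib)
    obtain u where "rep (phi ?d) u" using rep_corner_sum[OF d(1,2) corner_sum_of_J[OF d(1) f(6)]] by blast
    then have "rep (phi f \<oplus> phi ?d) ({#gen_x l#} + u)"
      using tmrep_rep[OF f(5)] f(1,2) d by (intro rep_add) (simp_all add: phi_carrier phi_mult[symmetric] phi_zero)
    moreover have "phi f \<oplus> phi ?d = e" using phi_add[OF f(1) d(1)] phi_psi[OF ec(1)] by simp
    ultimately show ?thesis by auto
  qed
qed

lemma list_mod_matrices:
  assumes "left_module_isomorphic R (list_mod xs) (list_mod ys)"
  obtains A B where
    "\<And>i j. \<lbrakk>i < length xs; j < length ys\<rbrakk> \<Longrightarrow> A i j \<in> alg \<and> E (xs ! i) * A i j = A i j \<and> A i j * E (ys ! j) = A i j"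
    "\<And>i k. \<lbrakk>i < length xs; k < length xs\<rbrakk> \<Longrightarrow>
       (\<Sum>j<length ys. A i j * B j k) = (if i = k then E (xs ! i) else 0)"
proof -
  note iso = assms[unfolded list_mod_def]
  obtain A B where A: "\<And>i j. \<lbrakk>i \<in> {..<length xs}; j \<in> {..<length ys}\<rbrakk> \<Longrightarrow>
      A i j \<in> carrier R \<and> phi (E (xs ! i)) \<otimes> A i j = A i j \<and> A i j \<otimes> phi (E (ys ! j)) = A i j"
    and B: "\<And>i j. \<lbrakk>i \<in> {..<length xs}; j \<in> {..<length ys}\<rbrakk> \<Longrightarrow>
      B j i \<in> carrier R \<and> phi (E (ys ! j)) \<otimes> B j i = B j i \<and> B j i \<otimes> phi (E (xs ! i)) = B j i"
    and AB: "\<And>i k. \<lbrakk>i \<in> {..<length xs}; k \<in> {..<length xs}\<rbrakk> \<Longrightarrow>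
      (\<Oplus>j\<in>{..<length ys}. A i j \<otimes> B j k) = (if i = k then phi (E (xs ! i)) else \<zero>)"
    using isomorphic_sum_mod_matrices[OF _ _ _ iso] idem_E by auto
  show ?thesis
  proof (rule that[of "\<lambda>i j. psi (A i j)" "\<lambda>j i. psi (B j i)"])
    fix i j assume ij: "i < length xs" "j < length ys"
    then have a: "A i j \<in> carrier R" "phi (E (xs ! i)) \<otimes> A i j = A i j" "A i j \<otimes> phi (E (ys ! j)) = A i j"
      using A by auto
    then show "psi (A i j) \<in> alg \<and> E (xs ! i) * psi (A i j) = psi (A i j) \<and> psi (A i j) * E (ys ! j) = psi (A i j)"
      using psi_mult[OF phi_carrier[OF E_alg] a(1)] psi_mult[OF a(1) phi_carrier[OF E_alg]]
      by (metis E_alg psi_alg psi_phi)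
  next
    fix i k assume ik: "i < length xs" "k < length xs"
    have "(\<Sum>j<length ys. psi (A i j) * psi (B j k)) = (\<Sum>j<length ys. psi (A i j \<otimes> B j k))"
      using A B ik by (intro sum.cong) (auto simp: psi_mult)
    also have "\<dots> = psi (\<Oplus>j\<in>{..<length ys}. A i j \<otimes> B j k)"
      using A B ik by (intro psi_finsum[symmetric]) auto
    also have "\<dots> = (if i = k then E (xs ! i) else 0)"
      using AB ik by (simp add: psi_zero psi_phi E_alg)
    finally show "(\<Sum>j<length ys. psi (A i j) * psi (B j k)) = (if i = k then E (xs ! i) else 0)" .
  qed
qed

lemma list_mod_of_std_mod:
  assumes "left_module_isomorphic R (std_mod (mset xs)) (std_mod (mset ys))"
  shows "left_module_isomorphic R (list_mod xs) (list_mod ys)"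
  using left_module_isomorphic_trans[OF left_module_isomorphic_trans[OF std_mod_mset assms]
      left_module_isomorphic_sym[OF left_module_list_mod std_mod_mset]] .

section \<open>Invariants of isomorphism classes\<close>

text \<open>In a normal form of index L with n \<le> L the x's have rank zero at level n, and every
  other generator has rank at most one. The rank then counts the summands that survive at level
  n.\<close>

lemma rank_le:
  assumes "left_module_isomorphic R (std_mod u) (std_mod t)" "1 \<le> n"
  shows "rank_at n u \<le> rank_at n t"
proof -
  obtain L0 where "\<forall>g\<in>set_mset (u + t). gen_index g \<le> L0"
    using finite_nat_set_iff_bounded_le[of "gen_index ` set_mset (u + t)"] by auto
  then obtain L where L: "n \<le> L" "\<And>g. g \<in># u \<Longrightarrow> gen_index g \<le> L" "\<And>g. g \<in># t \<Longrightarrow> gen_index g \<le> L"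
    by (metis union_iff le_max_iff_disj max.cobounded2)
  obtain m b c k where u: "u \<approx> normal_form L m b c k" using exists_normal_form[OF L(2)] by metis
  obtain m' b' c' k' where t: "t \<approx> normal_form L m' b' c' k'" using exists_normal_form[OF L(3)] by metis
  obtain xs where xs: "mset xs = normal_form L m b c k" using ex_mset by blast
  obtain ys where ys: "mset ys = normal_form L m' b' c' k'" using ex_mset by blast
  have type: "gen_type g \<noteq> 0" if "g \<in># mset xs \<or> g \<in># mset ys" "gen_rank n g \<noteq> 0" for g
    using that L(1) normal_form_gen_x[of g L] unfolding xs ys by fastforce
  have small: "gen_rank n g = (if gen_rank n g \<noteq> 0 then 1 else 0)" if "g \<in># mset xs \<or> g \<in># mset ys" for g
    using type[OF that] by (cases g) (auto split: if_splits)
  have card: "rank_at n (mset zs) = card {i. i < length zs \<and> gen_rank n (zs ! i) \<noteq> 0}"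
    if "\<And>g. g \<in># mset zs \<Longrightarrow> gen_rank n g = (if gen_rank n g \<noteq> 0 then 1 else 0)" for zs
  proof -
    have "rank_at n (mset zs) = (\<Sum>i<length zs. if gen_rank n (zs ! i) \<noteq> 0 then 1 else 0)"
      unfolding rank_at_mset
    proof (rule sum.cong)
      fix i assume "i \<in> {..<length zs}"
      then show "gen_rank n (zs ! i) = (if gen_rank n (zs ! i) \<noteq> 0 then 1 else 0)" by (intro that) simp
    qed simp
    then show ?thesis by (simp add: sum.If_cases Collect_conj_eq lessThan_def)
  qed
  have "left_module_isomorphic R (std_mod (mset xs)) (std_mod (mset ys))"
    unfolding xs ys
    by (rule left_module_isomorphic_trans[OF std_mod_cong[OF rep_relations pres_cong.sym[OF u]]
        left_module_isomorphic_trans[OF assms(1) std_mod_cong[OF rep_relations t]]])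
  from list_mod_matrices[OF list_mod_of_std_mod[OF this]] obtain A B where
    A: "\<And>i j. \<lbrakk>i < length xs; j < length ys\<rbrakk> \<Longrightarrow> A i j \<in> alg \<and> E (xs ! i) * A i j = A i j \<and> A i j * E (ys ! j) = A i j"
    and AB: "\<And>i k. \<lbrakk>i < length xs; k < length xs\<rbrakk> \<Longrightarrow>
       (\<Sum>j<length ys. A i j * B j k) = (if i = k then E (xs ! i) else 0)" by blast
  have "card {i. i < length xs \<and> gen_rank n (xs ! i) \<noteq> 0} \<le> card {j. j < length ys \<and> gen_rank n (ys ! j) \<noteq> 0}"
  proof (rule card_le_at_level[OF assms(2), where K = "{..<length ys}" and A = A and B = B
        and k = "\<lambda>i. kind (xs ! i)" and k' = "\<lambda>j. kind (ys ! j)" and e = "\<lambda>i. E (xs ! i)" and f = "\<lambda>j. E (ys ! j)"])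
    fix i j l assume "i \<in> {i. i < length xs \<and> gen_rank n (xs ! i) \<noteq> 0}"
      "j \<in> {..<length ys} - {j. j < length ys \<and> gen_rank n (ys ! j) \<noteq> 0}"
    then have ij: "i < length xs" "j < length ys" "gen_rank n (ys ! j) = 0" by auto
    have "lev {n} * (A i j * B j l) = lev {n} * ((A i j * E (ys ! j)) * B j l)" using A[OF ij(1,2)] by simp
    also have "\<dots> = A i j * ((lev {n} * E (ys ! j)) * B j l)"
      by (simp only: mult.assoc lev_left_commute[of "A i j"])
    finally show "lev {n} * (A i j * B j l) = 0" using lev_E_zero[OF ij(3)] by simp
  next
    fix i assume "i \<in> {i. i < length xs \<and> gen_rank n (xs ! i) \<noteq> 0}"
    then have "gen_rank n (xs ! i) \<noteq> 0" "xs ! i \<in># mset xs" by simp_all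
    then show "(kind (xs ! i) = p \<or> kind (xs ! i) = q) \<and> lev {n} * E (xs ! i) = lev {n} * kind (xs ! i)"
      using type lev_E_kind kind_cases by blast
  next
    fix j assume "j \<in> {j. j < length ys \<and> gen_rank n (ys ! j) \<noteq> 0}"
    then have "gen_rank n (ys ! j) \<noteq> 0" "ys ! j \<in># mset ys" by simp_all
    then show "(kind (ys ! j) = p \<or> kind (ys ! j) = q) \<and> lev {n} * E (ys ! j) = lev {n} * kind (ys ! j)"
      using type lev_E_kind kind_cases by blast
  qed (use A AB in auto)
  moreover have "rank_at n (mset xs) = card {i. i < length xs \<and> gen_rank n (xs ! i) \<noteq> 0}"
    by (rule card) (rule small, rule disjI1)
  moreover have "rank_at n (mset ys) = card {i. i < length ys \<and> gen_rank n (ys ! i) \<noteq> 0}"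
    by (rule card) (rule small, rule disjI2)
  ultimately have "rank_at n (mset xs) \<le> rank_at n (mset ys)" by simp
  then show ?thesis using rank_at_cong[OF u] rank_at_cong[OF t] by (simp add: xs ys)
qed

lemma germ_E_y: "gen_type g = 1 \<Longrightarrow> germ (E g * x) = P * germ x"
  and germ_E_z: "gen_type g = 2 \<Longrightarrow> germ (x * E g) = germ x * Q"
proof -
  have "germ (lev {l<..} * y) = germ y" for l and y :: "'a tm"
    by (rule germ_eqI[of "Suc l"]) (simp add: entry_lev)
  then show "gen_type g = 1 \<Longrightarrow> germ (E g * x) = P * germ x"
    "gen_type g = 2 \<Longrightarrow> germ (x * E g) = germ x * Q" by (cases g; simp)+
qed

text \<open>Modulo the socle an entry of A from a y to a z is of the form P t Q and so zero. At high
  levels these entries vanish and so do the a's; only the y's remain in the comparison, each of rank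
  one.\<close>

lemma type_y_le:
  assumes iso: "left_module_isomorphic R (std_mod u) (std_mod t)"
    and 0: "type_count 0 u = 0" "type_count 0 t = 0"
  shows "type_count 1 u \<le> type_count 1 t"
proof -
  obtain xs where xs: "u = mset xs" using ex_mset by metis
  obtain ys where ys: "t = mset ys" using ex_mset by metis
  from list_mod_matrices[OF list_mod_of_std_mod[OF iso[unfolded xs ys]]] obtain A B where
    A: "\<And>i j. \<lbrakk>i < length xs; j < length ys\<rbrakk> \<Longrightarrow> A i j \<in> alg \<and> E (xs ! i) * A i j = A i j \<and> A i j * E (ys ! j) = A i j"
    and AB: "\<And>i k. \<lbrakk>i < length xs; k < length xs\<rbrakk> \<Longrightarrow>
       (\<Sum>j<length ys. A i j * B j k) = (if i = k then E (xs ! i) else 0)" by blast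
  let ?I = "{i. i < length xs \<and> gen_type (xs ! i) = 1}"
  let ?J = "{j. j < length ys \<and> gen_type (ys ! j) = 1}"
  let ?K = "{j. j < length ys \<and> gen_type (ys ! j) = 2}"
  have "germ (A i j) = 0" if i: "i \<in> ?I" and j: "j \<in> ?K" for i j
  proof -
    have a: "A i j \<in> alg" "E (xs ! i) * A i j = A i j" "A i j * E (ys ! j) = A i j" using A i j by auto
    have "germ (A i j) = P * germ (A i j)" using germ_E_y[of "xs ! i" "A i j"] i a(2) by simp
    moreover have "germ (A i j) = germ (A i j) * Q" using germ_E_z[of "ys ! j" "A i j"] j a(3) by simp
    ultimately have "germ (A i j) = P * (germ (A i j) * Q)" by metis
    then show ?thesis using P_GA_Q[of "germ (A i j)"] a(1) by (simp add: GA_def)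
  qed
  then have "\<forall>i\<in>?I. \<forall>j\<in>?K. \<forall>\<^sub>F n in sequentially. lev {n} * A i j = 0"
  proof (intro ballI)
    fix i j assume "i \<in> ?I" "j \<in> ?K" "\<And>i j. i \<in> ?I \<Longrightarrow> j \<in> ?K \<Longrightarrow> germ (A i j) = 0"
    then have "germ (A i j) = germ 0" by simp
    then obtain N where "\<forall>n\<ge>N. \<forall>r c. entry (A i j) n r c = 0" unfolding germ_eq_iff by auto
    then have "lev {n} * A i j = 0" if "n \<ge> N" for n
      by (intro tm_eqI) (use that in \<open>auto simp: entry_lev\<close>)
    then show "\<forall>\<^sub>F n in sequentially. lev {n} * A i j = 0" unfolding eventually_sequentially by blast
  qed
  then have "\<forall>\<^sub>F n in sequentially. \<forall>i\<in>?I. \<forall>j\<in>?K. lev {n} * A i j = 0"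
    by (intro eventually_ball_finite ballI) auto
  then obtain N where N: "\<And>n i j. \<lbrakk>n \<ge> N; i \<in> ?I; j \<in> ?K\<rbrakk> \<Longrightarrow> lev {n} * A i j = 0"
    unfolding eventually_sequentially by blast
  obtain L where L: "\<And>g. g \<in> set xs \<union> set ys \<Longrightarrow> gen_index g \<le> L"
    using finite_nat_set_iff_bounded_le[of "gen_index ` (set xs \<union> set ys)"] by auto
  \<comment> \<open>From \<open>N\<close> on the entries from y to z vanish; above \<open>L\<close>
    the a's vanish and every y is \<open>p\<close> itself.\<close>
  define n where "n = max N (Suc L)"
  have n: "N \<le> n" "L < n" by (auto simp: n_def)
  have y: "kind g = p" "lev {n} * E g = lev {n} * p" if "g \<in> set xs \<union> set ys" "gen_type g = 1" for g
    using L[OF that(1)] that(2) n by (cases g; simp add: lev_lev Int_absorb2)+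
  have "card ?I \<le> card ?J"
  proof (rule card_le_at_level[where n = n and K = "{..<length ys}" and A = A and B = B
        and k = "\<lambda>i. p" and k' = "\<lambda>j. p" and e = "\<lambda>i. E (xs ! i)" and f = "\<lambda>j. E (ys ! j)"])
    fix i j l assume i: "i \<in> ?I" and j: "j \<in> {..<length ys} - ?J"
    have a: "A i j * E (ys ! j) = A i j" using A i j by auto
    have "lev {n} * A i j = 0"
    proof (cases "j \<in> ?K")
      case True
      then show ?thesis using N n i by blast
    next
      case False
      have "ys ! j \<in># t" using j by (simp add: ys)
      then have "gen_type (ys ! j) \<noteq> 0" using 0(2) by (auto simp: type_count_def filter_mset_eq_conv)
      then obtain m where m: "ys ! j = gen_a m" using False j by (cases "ys ! j") auto
      moreover have "gen_index (ys ! j) \<le> L" using L j by simp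
      ultimately have "gen_rank n (ys ! j) = 0" using n by auto
      then have "lev {n} * E (ys ! j) = 0" by (rule lev_E_zero)
      then have "A i j * (lev {n} * E (ys ! j)) = 0" by simp
      then show ?thesis using a by (simp only: lev_left_commute[of "A i j"])
    qed
    then show "lev {n} * (A i j * B j l) = 0" by (simp add: mult.assoc[symmetric])
  next
    fix i assume "i \<in> ?I"
    then show "(p = p \<or> p = q) \<and> lev {n} * E (xs ! i) = lev {n} * p" using y(2) by simp
  next
    fix j assume "j \<in> ?J"
    then show "(p = p \<or> p = q) \<and> lev {n} * E (ys ! j) = lev {n} * p" using y(2) by simp
  qed (use n A AB in auto)
  then show ?thesis by (simp add: xs ys type_count_mset)
qed

theorem V_monoid_alg: "V_monoid R \<cong> M_monoid"
  unfolding M_monoid_def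
proof (rule V_monoid_iso[OF rep_relations idem_rep])
  fix u t assume iso: "left_module_isomorphic R (std_mod u) (std_mod t)"
  have iso': "left_module_isomorphic R (std_mod t) (std_mod u)"
    by (rule left_module_isomorphic_sym[OF left_module_std_mod iso])
  show "u \<approx> t"
    using rank_le[OF iso] rank_le[OF iso'] type_y_le[OF iso] type_y_le[OF iso']
    by (intro M_cong_of_rank) (auto intro: antisym)
qed

end

section \<open>The algebra R\<close>

lemma ring_of_embedding:
  fixes R :: "('r, 's) ring_scheme" (structure) and psi :: "'r \<Rightarrow> 'b::ring_1"
  assumes inj: "inj_on psi (carrier R)"
    and closed: "\<And>x y. \<lbrakk>x \<in> carrier R; y \<in> carrier R\<rbrakk> \<Longrightarrow> x \<oplus> y \<in> carrier R"
      "\<And>x y. \<lbrakk>x \<in> carrier R; y \<in> carrier R\<rbrakk> \<Longrightarrow> x \<otimes> y \<in> carrier R" "\<zero> \<in> carrier R" "\<one> \<in> carrier R"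
      "\<And>x. x \<in> carrier R \<Longrightarrow> - psi x \<in> psi ` carrier R"
    and hom: "\<And>x y. \<lbrakk>x \<in> carrier R; y \<in> carrier R\<rbrakk> \<Longrightarrow> psi (x \<oplus> y) = psi x + psi y"
      "\<And>x y. \<lbrakk>x \<in> carrier R; y \<in> carrier R\<rbrakk> \<Longrightarrow> psi (x \<otimes> y) = psi x * psi y" "psi \<zero> = 0" "psi \<one> = 1"
  shows "ring R"
proof -
  have eq: "x = y" if "psi x = psi y" "x \<in> carrier R" "y \<in> carrier R" for x y
    using inj that by (auto simp: inj_on_def)
  have "\<exists>y\<in>carrier R. y \<oplus> x = \<zero>" if x: "x \<in> carrier R" for x
  proof -
    obtain y where y: "y \<in> carrier R" "psi y = - psi x" using closed(5)[OF x] by (metis imageE)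
    have "y \<oplus> x = \<zero>" by (rule eq) (use x y closed hom in auto)
    then show ?thesis using y(1) by blast
  qed
  then show ?thesis
    by (intro ringI abelian_groupI monoidI) (auto intro!: eq simp: closed hom algebra_simps)
qed

text \<open>Level 0 is the empty matrix whatever the value of \<open>t\<close> there, so nothing is
  added to the product over n \<ge> 1.\<close>

definition tm_of :: "(nat \<Rightarrow> 'a::field mat) \<Rightarrow> 'a tm" where
  "tm_of t = mk (\<lambda>n i j. t n $$ (i, j))"

definition of_tm :: "'a tm \<Rightarrow> nat \<Rightarrow> 'a::field mat" where
  "of_tm x = (\<lambda>n\<in>{1..}. mat n n (\<lambda>(i, j). entry x n i j))"

lemma T_ring_simps:
  "t \<in> carrier T_ring \<longleftrightarrow> t \<in> extensional {1..} \<and> (\<forall>n\<ge>1. t n \<in> carrier_mat n n)"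
  "s \<otimes>\<^bsub>T_ring\<^esub> t = (\<lambda>n\<in>{1..}. s n * t n)" "s \<oplus>\<^bsub>T_ring\<^esub> t = (\<lambda>n\<in>{1..}. s n + t n)"
  "\<one>\<^bsub>T_ring\<^esub> = (\<lambda>n\<in>{1..}. 1\<^sub>m n)" "\<zero>\<^bsub>T_ring\<^esub> = (\<lambda>n\<in>{1..}. 0\<^sub>m n n)"
  by (auto simp: T_ring_def product_ring_def ring_mat_def PiE_def Pi_def)

lemma entry_tm_of: "entry (tm_of t) n i j = (if i < n \<and> j < n then t n $$ (i, j) else 0)"
  by (simp add: tm_of_def)

lemma of_tm_carrier: "of_tm x \<in> carrier T_ring"
  by (auto simp: T_ring_simps of_tm_def)

lemma tm_of_of_tm: "tm_of (of_tm x) = x"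
  by (rule tm_eqI) (simp add: entry_tm_of of_tm_def)

lemma of_tm_tm_of: "t \<in> carrier T_ring \<Longrightarrow> of_tm (tm_of t) = t"
  by (rule extensionalityI[of _ "{1..}"]) (auto simp: T_ring_simps of_tm_def entry_tm_of intro!: eq_matI)

lemma tm_of_inj: "inj_on tm_of (carrier T_ring)"
  by (rule inj_on_inverseI[of _ of_tm]) (rule of_tm_tm_of)

lemma T_carrier:
  "\<lbrakk>s \<in> carrier T_ring; t \<in> carrier T_ring\<rbrakk> \<Longrightarrow> s \<oplus>\<^bsub>T_ring\<^esub> t \<in> carrier T_ring"
  "\<lbrakk>s \<in> carrier T_ring; t \<in> carrier T_ring\<rbrakk> \<Longrightarrow> s \<otimes>\<^bsub>T_ring\<^esub> t \<in> carrier T_ring"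
  "\<zero>\<^bsub>T_ring\<^esub> \<in> carrier T_ring" "\<one>\<^bsub>T_ring\<^esub> \<in> carrier T_ring"
  by (auto simp: T_ring_simps intro!: mult_carrier_mat)

lemma tm_of_hom:
  "\<lbrakk>s \<in> carrier T_ring; t \<in> carrier T_ring\<rbrakk> \<Longrightarrow> tm_of (s \<oplus>\<^bsub>T_ring\<^esub> t) = tm_of s + tm_of t"
  "\<lbrakk>s \<in> carrier T_ring; t \<in> carrier T_ring\<rbrakk> \<Longrightarrow> tm_of (s \<otimes>\<^bsub>T_ring\<^esub> t) = tm_of s * tm_of t"
  "tm_of \<zero>\<^bsub>T_ring\<^esub> = 0" "tm_of \<one>\<^bsub>T_ring\<^esub> = 1"
proof -
  assume c: "s \<in> carrier T_ring" "t \<in> carrier T_ring"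
  have d: "dim_row (s n) = n" "dim_col (s n) = n" "dim_row (t n) = n" "dim_col (t n) = n" if "1 \<le> n" for n
    using c that unfolding T_ring_simps by auto
  show "tm_of (s \<oplus>\<^bsub>T_ring\<^esub> t) = tm_of s + tm_of t"
    by (rule tm_eqI) (use d in \<open>auto simp: entry_tm_of T_ring_simps\<close>)
  show "tm_of (s \<otimes>\<^bsub>T_ring\<^esub> t) = tm_of s * tm_of t"
  proof (rule tm_eqI)
    fix n i j :: nat assume ij: "i < n" "j < n"
    then have n: "1 \<le> n" by simp
    show "entry (tm_of (s \<otimes>\<^bsub>T_ring\<^esub> t)) n i j = entry (tm_of s * tm_of t) n i j"
      using ij n d[OF n] by (simp add: entry_tm_of T_ring_simps entry_times scalar_prod_def atLeast0LessThan)
  qed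
qed (rule tm_eqI, simp add: entry_tm_of T_ring_simps)+

lemma ring_T: "ring T_ring"
proof (rule ring_of_embedding[where psi = tm_of])
  fix x :: "nat \<Rightarrow> 'a mat"
  show "- tm_of x \<in> tm_of ` carrier T_ring"
    using tm_of_of_tm[of "- tm_of x"] of_tm_carrier by (metis imageI)
qed (simp_all add: tm_of_inj T_carrier tm_of_hom)

lemma T_scalar_carrier: "T_scalar c \<in> carrier T_ring"
  by (auto simp: T_ring_simps T_scalar_def)

lemma tm_of_scalar: "tm_of (T_scalar c) = diag (\<lambda>_. c)"
  by (rule tm_eqI) (auto simp: entry_tm_of T_scalar_def)

lemma tm_of_uminus:
  assumes "t \<in> carrier T_ring"
  shows "tm_of (\<ominus>\<^bsub>T_ring\<^esub> t) = - tm_of t"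
proof -
  interpret T: ring T_ring by (rule ring_T)
  have "tm_of (\<ominus>\<^bsub>T_ring\<^esub> t \<oplus>\<^bsub>T_ring\<^esub> t) = 0" using assms by (simp add: T.l_neg tm_of_hom)
  then have "tm_of (\<ominus>\<^bsub>T_ring\<^esub> t) + tm_of t = 0" using assms by (simp add: tm_of_hom)
  then show ?thesis by (rule eq_neg_iff_add_eq_0[THEN iffD2])
qed

lemma tm_of_soc: "t \<in> carrier T_ring \<Longrightarrow> t \<in> T_soc \<longleftrightarrow> germ (tm_of t) = 0"
proof -
  assume t: "t \<in> carrier T_ring"
  have z: "t n = 0\<^sub>m n n \<longleftrightarrow> (\<forall>i j. entry (tm_of t) n i j = 0)" if "1 \<le> n" for n
  proof -
    have d: "dim_row (t n) = n" "dim_col (t n) = n" using t that unfolding T_ring_simps by auto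
    show ?thesis
    proof
      assume z: "\<forall>i j. entry (tm_of t) n i j = 0"
      have "t n $$ (i, j) = 0" if "i < n" "j < n" for i j
        using z[rule_format, of i j] that by (simp add: entry_tm_of)
      then show "t n = 0\<^sub>m n n" using d by (intro eq_matI) auto
    qed (auto simp: entry_tm_of)
  qed
  have "germ (tm_of t) = 0 \<longleftrightarrow> (\<exists>N. \<forall>n\<ge>N. \<forall>i j. entry (tm_of t) n i j = 0)"
    using germ_eq_iff[of "tm_of t" 0] by simp
  also have "\<dots> \<longleftrightarrow> finite {n \<in> {1..}. t n \<noteq> 0\<^sub>m n n}"
  proof
    assume "\<exists>N. \<forall>n\<ge>N. \<forall>i j. entry (tm_of t) n i j = 0"
    then obtain N where "\<forall>n\<ge>N. \<forall>i j. entry (tm_of t) n i j = 0" ..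
    then have "{n \<in> {1..}. t n \<noteq> 0\<^sub>m n n} \<subseteq> {..<N}" using z by (auto simp: not_le[symmetric])
    then show "finite {n \<in> {1..}. t n \<noteq> 0\<^sub>m n n}" using finite_subset by blast
  next
    assume "finite {n \<in> {1..}. t n \<noteq> 0\<^sub>m n n}"
    then obtain N where N: "\<forall>n\<in>{n \<in> {1..}. t n \<noteq> 0\<^sub>m n n}. n < N" using finite_nat_set_iff_bounded by auto
    have "\<forall>i j. entry (tm_of t) n i j = 0" if "n \<ge> max N 1" for n
    proof -
      have "t n = 0\<^sub>m n n" using N that by force
      then show ?thesis using z[of n] that by simp
    qed
    then show "\<exists>N. \<forall>n\<ge>N. \<forall>i j. entry (tm_of t) n i j = 0" by blast
  qed
  finally show ?thesis using t by (simp add: T_soc_def)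
qed

lemma w_elem_carrier: "w_elem \<in> carrier T_ring"
  by (auto simp: T_ring_simps w_elem_def w_mat_def)

lemma tm_of_w: "tm_of w_elem = shift"
proof (rule tm_eqI)
  fix n i j :: nat assume ij: "i < n" "j < n"
  have "(\<Sum>k\<in>{1..<n}. e_unit (k + 1) k (Suc i) (Suc j) :: 'a) = (\<Sum>k\<in>{1..<n}. if k = Suc j then if i = Suc j then 1 else 0 else 0)"
    by (rule sum.cong) (auto simp: e_unit_def)
  also have "\<dots> = (if i = Suc j then 1 else 0)" using ij by auto
  finally show "entry (tm_of w_elem) n i j = entry (shift :: 'a tm) n i j"
    using ij by (simp add: entry_tm_of w_elem_def w_mat_def entry_shift)
qed

lemma tm_of_power:
  assumes "t \<in> carrier T_ring"
  shows "tm_of (t [^]\<^bsub>T_ring\<^esub> (n :: nat)) = tm_of t ^ n"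
proof -
  interpret T: ring T_ring by (rule ring_T)
  show ?thesis
    using assms by (induction n) (simp_all add: tm_of_hom power_commutes)
qed

lemma T_poly_carrier: "T_poly g w_elem \<in> carrier T_ring"
proof -
  interpret T: ring T_ring by (rule ring_T)
  show ?thesis
    unfolding T_poly_def by (intro T.finsum_closed) (auto intro!: T.m_closed T_scalar_carrier w_elem_carrier)
qed

lemma tm_of_poly: "tm_of (T_poly g w_elem) = ser (fps_of_poly g)"
proof -
  interpret T: ring T_ring by (rule ring_T)
  have fin: "tm_of (\<Oplus>\<^bsub>T_ring\<^esub>i\<in>I. h i) = (\<Sum>i\<in>I. tm_of (h i))" if "h \<in> I \<rightarrow> carrier T_ring" "finite I"
    for h and I :: "nat set"
    using that(2,1)
    by (induction I rule: finite_induct) (simp_all add: Pi_iff T.finsum_insert T.finsum_closed tm_of_hom)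
  have "tm_of (T_poly g w_elem) = (\<Sum>i\<le>degree g. diag (\<lambda>_. coeff g i) * shift ^ i)"
    unfolding T_poly_def
    by (subst fin) (auto simp: tm_of_hom T_scalar_carrier w_elem_carrier tm_of_scalar tm_of_power tm_of_w)
  also have "\<dots> = (\<Sum>i\<le>degree g. ser (fps_of_poly (monom (coeff g i) i)))"
    by (simp add: fps_of_poly_monom ser_simps ser_power shift_def)
  also have "\<dots> = ser (\<Sum>i\<le>degree g. fps_of_poly (monom (coeff g i) i))"
  proof -
    have ser0: "ser (0 :: 'a fps) = 0" using ser_simps(3)[of 1 "1 :: 'a fps"] by simp
    have "ser (\<Sum>i\<in>I. h i) = (\<Sum>i\<in>I. ser (h i))" if "finite I" for h :: "nat \<Rightarrow> 'a fps" and I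
      using that by (induction I rule: finite_induct) (simp_all add: ser0 ser_simps)
    then show ?thesis by simp
  qed
  also have "\<dots> = ser (fps_of_poly g)"
    by (simp add: fps_of_poly_sum[symmetric] poly_as_sum_of_monoms)
  finally show ?thesis .
qed

text \<open>The power series inverse to g can be evaluated at w, and the result is inverse to g(w)
  at all levels at once.\<close>

lemma T_inv_poly:
  assumes "coeff g 0 = 1"
  shows "inv\<^bsub>T_ring\<^esub> (T_poly g w_elem) \<in> carrier T_ring"
    and "tm_of (inv\<^bsub>T_ring\<^esub> (T_poly g w_elem)) = ser (inverse (fps_of_poly g))"
proof -
  interpret T: ring T_ring by (rule ring_T)
  let ?y = "of_tm (ser (inverse (fps_of_poly g)))"
  have inv: "inverse (fps_of_poly g) * fps_of_poly g = 1" using assms by (intro inverse_mult_eq_1) simp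
  then have inv': "fps_of_poly g * inverse (fps_of_poly g) = 1" by (simp only: mult.commute)
  have eq: "x = \<one>\<^bsub>T_ring\<^esub>" if "x \<in> carrier T_ring" "tm_of x = 1" for x :: "nat \<Rightarrow> 'a mat"
    using inj_onD[OF tm_of_inj, of x "\<one>\<^bsub>T_ring\<^esub>"] that T_carrier(4) tm_of_hom(4) by simp
  have "T_poly g w_elem \<otimes>\<^bsub>T_ring\<^esub> ?y = \<one>\<^bsub>T_ring\<^esub>"
  proof (rule eq)
    show "tm_of (T_poly g w_elem \<otimes>\<^bsub>T_ring\<^esub> ?y) = 1"
      by (simp only: tm_of_hom(2)[OF T_poly_carrier of_tm_carrier] tm_of_poly tm_of_of_tm ser_simps(1)[symmetric] inv' ser_simps(5))
  qed (intro T_carrier T_poly_carrier of_tm_carrier)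
  moreover have "?y \<otimes>\<^bsub>T_ring\<^esub> T_poly g w_elem = \<one>\<^bsub>T_ring\<^esub>"
  proof (rule eq)
    show "tm_of (?y \<otimes>\<^bsub>T_ring\<^esub> T_poly g w_elem) = 1"
      by (simp only: tm_of_hom(2)[OF of_tm_carrier T_poly_carrier] tm_of_poly tm_of_of_tm ser_simps(1)[symmetric] inv ser_simps(5))
  qed (intro T_carrier T_poly_carrier of_tm_carrier)
  ultimately have y: "?y = inv\<^bsub>T_ring\<^esub> (T_poly g w_elem)"
    by (rule T.inv_unique'[OF T_poly_carrier of_tm_carrier])
  show "inv\<^bsub>T_ring\<^esub> (T_poly g w_elem) \<in> carrier T_ring" unfolding y[symmetric] by (rule of_tm_carrier)
  show "tm_of (inv\<^bsub>T_ring\<^esub> (T_poly g w_elem)) = ser (inverse (fps_of_poly g))"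
    unfolding y[symmetric] by (rule tm_of_of_tm)
qed

context levels
begin

text \<open>The right-hand side is a subalgebra that contains the generators. Conversely, induction
  over \<open>alg\<close> places its elements in every such subalgebra.\<close>

lemma T_generated_subalgebra_eq:
  assumes vstar: "vstar \<in> carrier T_ring" "tm_of vstar = v"
  shows "T_generated_subalgebra (T_soc \<union> {w_elem, vstar} \<union>
      {inv\<^bsub>T_ring\<^esub> (T_poly g w_elem) | g. g \<in> Sigma_polys}) = {t \<in> carrier T_ring. tm_of t \<in> alg}"
    (is "T_generated_subalgebra ?G = ?R")
proof
  interpret T: ring T_ring by (rule ring_T)
  have sub: "subring ?R T_ring"
    by (rule T.subringI) (auto simp: tm_of_hom tm_of_uminus intro: alg_one alg_uminus alg.mult alg.add)
  moreover have "subalgebra (range T_scalar) ?R T_ring"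
  proof (intro subalgebra.intro subalgebra_axioms.intro)
    show "subgroup ?R (add_monoid T_ring)" using sub by (simp add: subring_def)
  qed (auto simp: tm_of_hom T_scalar_carrier tm_of_scalar intro!: alg.mult[OF alg.const])
  moreover have "?G \<subseteq> ?R"
  proof -
    have "T_soc \<subseteq> ?R" using tm_of_soc alg.soc by (fastforce simp: T_soc_def)
    moreover have "inv\<^bsub>T_ring\<^esub> (T_poly g w_elem) \<in> ?R" if "g \<in> Sigma_polys" for g
    proof -
      have g: "coeff g 0 = 1" using that by (simp add: Sigma_polys_def poly_0_coeff_0)
      show ?thesis using alg.inv[OF g] T_inv_poly[OF g] by simp
    qed
    ultimately show ?thesis using vstar by (auto simp: w_elem_carrier tm_of_w intro: alg.w alg.v)
  qed
  ultimately show "T_generated_subalgebra ?G \<subseteq> ?R"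
    unfolding T_generated_subalgebra_def by blast
  show "?R \<subseteq> T_generated_subalgebra ?G"
    unfolding T_generated_subalgebra_def
  proof (intro subsetI InterI)
    fix t S assume t: "t \<in> ?R" and "S \<in> {S. subring S T_ring \<and> subalgebra (range T_scalar) S T_ring \<and> ?G \<subseteq> S}"
    then have S: "subring S T_ring" "subalgebra (range T_scalar) S T_ring" "?G \<subseteq> S" by auto
    interpret S: subring S T_ring by (rule S(1))
    have "of_tm x \<in> S" if "x \<in> alg" for x
      using that
    proof (induction rule: alg.induct)
      case (soc x)
      then show ?case using tm_of_soc[OF of_tm_carrier, of x] S(3) by (auto simp: tm_of_of_tm)
    next
      case w
      have "of_tm (w :: 'a tm) = w_elem" by (simp only: tm_of_w[symmetric] of_tm_tm_of[OF w_elem_carrier])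
      then show ?case using S(3) by simp
    next
      case v
      then show ?case using S(3) of_tm_tm_of[OF vstar(1)] vstar(2) by auto
    next
      case (inv b)
      then have "b \<in> Sigma_polys" by (simp add: Sigma_polys_def poly_0_coeff_0)
      then have "inv\<^bsub>T_ring\<^esub> (T_poly b w_elem) \<in> S" using S(3) by auto
      then show ?case using of_tm_tm_of[OF T_inv_poly(1)[OF inv]] by (simp add: T_inv_poly(2)[OF inv])
    next
      case (const c)
      have "T_scalar c \<otimes>\<^bsub>T_ring\<^esub> \<one>\<^bsub>T_ring\<^esub> \<in> S"
        using subalgebra.smult_closed[OF S(2)] S.one_closed by blast
      then show ?case using of_tm_tm_of[OF T_scalar_carrier[of c]] by (simp add: tm_of_scalar T_scalar_carrier)
    next
      case (add x y)
      then have "of_tm x \<oplus>\<^bsub>T_ring\<^esub> of_tm y \<in> S" using subringE(7)[OF S(1)] by simp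
      moreover have "of_tm (x + y) = of_tm x \<oplus>\<^bsub>T_ring\<^esub> of_tm y"
        using of_tm_tm_of[OF T_carrier(1)[OF of_tm_carrier of_tm_carrier], of x y]
        by (simp add: tm_of_hom of_tm_carrier tm_of_of_tm)
      ultimately show ?case by simp
    next
      case (mult x y)
      then have "of_tm x \<otimes>\<^bsub>T_ring\<^esub> of_tm y \<in> S"
        using subringE(6)[OF S(1)] by simp
      moreover have "of_tm (x * y) = of_tm x \<otimes>\<^bsub>T_ring\<^esub> of_tm y"
        using of_tm_tm_of[OF T_carrier(2)[OF of_tm_carrier of_tm_carrier], of x y]
        by (simp add: tm_of_hom of_tm_carrier tm_of_of_tm)
      ultimately show ?case by simp
    qed
    then have "of_tm (tm_of t) \<in> S" using t by blast
    moreover have "of_tm (tm_of t) = t" using t by (intro of_tm_tm_of) simp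
    ultimately show "t \<in> S" by simp
  qed
qed

lemma alg_ring_of_carrier:
  "alg_ring F (T_ring\<lparr>carrier := {t \<in> carrier T_ring. tm_of t \<in> alg}\<rparr>) tm_of"
proof -
  let ?R = "T_ring\<lparr>carrier := {t \<in> carrier T_ring. tm_of t \<in> alg}\<rparr>"
  interpret T: ring T_ring by (rule ring_T)
  have "subring {t \<in> carrier T_ring. tm_of t \<in> alg} T_ring"
    by (rule T.subringI) (auto simp: tm_of_hom tm_of_uminus intro: alg_one alg_uminus alg.mult alg.add)
  then have "ring ?R" by (rule T.subring_is_ring)
  moreover have "bij_betw tm_of (carrier ?R) alg"
  proof (rule bij_betw_imageI)
    show "inj_on tm_of (carrier ?R)" by (rule inj_on_subset[OF tm_of_inj]) auto
    have "x \<in> tm_of ` carrier ?R" if "x \<in> alg" for x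
      using that by (intro image_eqI[of _ _ "of_tm x"]) (auto simp: tm_of_of_tm of_tm_carrier)
    then show "tm_of ` carrier ?R = alg" by auto
  qed
  ultimately show ?thesis
    by (intro alg_ring.intro alg_ring_axioms.intro levels_axioms) (auto simp: tm_of_hom)
qed

end

section \<open>The levels\<close>

context
  fixes f :: "nat \<Rightarrow> 'a::field poly" and M :: "nat \<Rightarrow> nat"
  assumes f_bij: "bij_betw f UNIV Sigma_polys" and f_0: "f 0 = 1"
    and M_strict: "\<forall>k\<ge>1. M k < M (k + 1)"
    and M_bound: "\<forall>k\<ge>1. 2 * (k + 1) * N_deg f k \<le> M k"
begin

text \<open>Below \<open>M 1\<close> the matrix w* has no correction, which is the case of the
  polynomial 1.\<close>

definition level_poly :: "nat \<Rightarrow> 'a poly" where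
  "level_poly n = (if n < M 1 then 1 else partial_prod f (wstar_level M n))"

lemma M_mono: assumes "1 \<le> i" "i \<le> j" shows "M i \<le> M j"
  using assms(2)
proof (induction j rule: dec_induct)
  case (step j)
  then have "M j < M (j + 1)" using M_strict assms(1) by auto
  then show ?case using step by auto
qed simp

lemma M_unbounded: "k \<le> M (k + 1)"
proof (induction k)
  case (Suc k)
  have "M (k + 1) < M (k + 1 + 1)" using M_strict by auto
  then show ?case using Suc by simp
qed simp

text \<open>The intervals between consecutive values of \<open>M\<close> are disjoint and cover all
  n from \<open>M 1\<close> on, so the description in \<open>wstar_level\<close> denotes.\<close>

lemma wstar_level:
  assumes "M 1 \<le> n"
  shows "1 \<le> wstar_level M n \<and> M (wstar_level M n) \<le> n \<and> n < M (wstar_level M n + 1)"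
proof -
  let ?P = "\<lambda>k. 1 \<le> k \<and> M k \<le> n"
  have bound: "k \<le> n + 2" if "?P k" for k
  proof (rule ccontr)
    assume "\<not> k \<le> n + 2"
    then have "M (n + 2) \<le> M k" by (intro M_mono) auto
    moreover have "n + 1 \<le> M (n + 2)" using M_unbounded[of "n + 1"] by simp
    ultimately show False using that by simp
  qed
  define k where "k = (GREATEST k. ?P k)"
  have k: "?P k" unfolding k_def by (rule GreatestI_nat[of ?P 1 "n + 2"]) (use assms bound in auto)
  have "n < M (k + 1)"
  proof (rule ccontr)
    assume "\<not> n < M (k + 1)"
    then have "?P (k + 1)" using k by simp
    then have "k + 1 \<le> k" unfolding k_def using bound by (rule Greatest_le_nat)
    then show False by simp
  qed
  moreover have "j = k" if "1 \<le> j \<and> M j \<le> n \<and> n < M (j + 1)" for j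
  proof (rule ccontr)
    assume "j \<noteq> k"
    then consider "j + 1 \<le> k" | "k + 1 \<le> j" by linarith
    then show False
    proof cases
      case 1
      then have "M (j + 1) \<le> M k" by (intro M_mono) auto
      then show False using that k by simp
    next
      case 2
      then have "M (k + 1) \<le> M j" by (intro M_mono) auto
      then show False using that \<open>n < M (k + 1)\<close> by simp
    qed
  qed
  ultimately have "\<exists>!k. 1 \<le> k \<and> M k \<le> n \<and> n < M (k + 1)" using k by blast
  then show ?thesis unfolding wstar_level_def by (rule theI')
qed

lemma coeff_f: "coeff (f i) 0 = 1"
  using f_bij by (auto simp: bij_betw_def Sigma_polys_def poly_0_coeff_0)

lemma coeff_partial_prod: "coeff (partial_prod f k) 0 = 1"
  unfolding partial_prod_def poly_0_coeff_0[symmetric] poly_prod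
  by (simp add: poly_0_coeff_0 coeff_f)

text \<open>f 1 differs from f 0 = 1 but has the same constant term, so it is not constant.\<close>

lemma N_deg_pos: "1 \<le> k \<Longrightarrow> 1 \<le> N_deg f k"
proof -
  assume k: "1 \<le> k"
  have nz: "f i \<noteq> 0" for i using coeff_f[of i] by auto
  have "degree (f 1) \<noteq> 0"
  proof
    assume "degree (f 1) = 0"
    then obtain c where "f 1 = [:c:]" by (metis degree_eq_zeroE)
    then have "f 1 = f 0" using coeff_f[of 1] f_0 by (simp add: one_pCons)
    then show False using f_bij by (auto simp: bij_betw_def inj_on_def)
  qed
  moreover have "f 1 dvd partial_prod f k" unfolding partial_prod_def using k by (intro dvd_prodI) auto
  moreover have "partial_prod f k \<noteq> 0" unfolding partial_prod_def using nz by simp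
  ultimately show ?thesis unfolding N_deg_def using dvd_imp_degree_le[of "f 1" "partial_prod f k"] by linarith
qed

text \<open>The factor k + 1 in the bound on \<open>M\<close> pays for the margin: 2(k + 1)N = 2N +
  2kN \<ge> 2N + 2k as N is positive. Divisibility by b holds once k reaches the position of b in
  the enumeration.\<close>

lemma levels_level_poly: "levels level_poly"
proof
  show "coeff (level_poly n) 0 = 1" for n by (simp add: level_poly_def coeff_partial_prod)
  have level: "2 * degree (level_poly n) + 2 * k \<le> n" if "1 \<le> k" "M k \<le> n" for n k
  proof -
    have n: "M 1 \<le> n" using M_mono[of 1 k] that by simp
    let ?k = "wstar_level M n"
    note l = wstar_level[OF n]
    have "k \<le> ?k"
    proof (rule ccontr)
      assume "\<not> k \<le> ?k"
      then have "M (?k + 1) \<le> M k" by (intro M_mono) auto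
      then show False using l that by simp
    qed
    have "2 * (?k + 1) * N_deg f ?k \<le> n" using M_bound l by (meson le_trans)
    moreover have "?k * 1 \<le> ?k * N_deg f ?k" using N_deg_pos l by (intro mult_left_mono) auto
    moreover have "2 * (?k + 1) * N_deg f ?k = 2 * N_deg f ?k + 2 * (?k * N_deg f ?k)" by (simp add: algebra_simps)
    ultimately have "2 * N_deg f ?k + 2 * ?k \<le> n" by linarith
    then show ?thesis using \<open>k \<le> ?k\<close> n by (simp add: level_poly_def N_deg_def)
  qed
  show "2 * degree (level_poly n) < n" if "1 \<le> n" for n
  proof (cases "n < M 1")
    case False
    then show ?thesis using level[of 1 n] by simp
  qed (use that in \<open>simp add: level_poly_def\<close>)
  fix b :: "'a poly" and d assume b: "coeff b 0 = 1"
  then have "b \<in> Sigma_polys" by (simp add: Sigma_polys_def poly_0_coeff_0)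
  then obtain i where i: "b = f i" using f_bij by (auto simp: bij_betw_def)
  \<comment> \<open>Large enough for f i to be a factor of F_k and for the margin 2k to exceed
    \<open>d\<close>.\<close>
  let ?k = "i + d + 1"
  have "b dvd level_poly n \<and> 2 * degree (level_poly n) + d < n" if n: "M ?k \<le> n" for n
  proof
    show "2 * degree (level_poly n) + d < n" using level[OF _ n] by simp
    have n1: "M 1 \<le> n" using M_mono[of 1 ?k] n by simp
    note l = wstar_level[OF n1]
    have "?k \<le> wstar_level M n"
    proof (rule ccontr)
      assume "\<not> ?k \<le> wstar_level M n"
      then have "M (wstar_level M n + 1) \<le> M ?k" by (intro M_mono) auto
      then show False using l n by simp
    qed
    then show "b dvd level_poly n"
      using n1 unfolding i by (auto simp: level_poly_def partial_prod_def intro!: dvd_prodI)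
  qed
  then show "\<exists>n0. \<forall>n\<ge>n0. b dvd level_poly n \<and> 2 * degree (level_poly n) + d < n" by blast
qed

lemma wstar_elem_carrier: "wstar_elem f M \<in> carrier T_ring"
  by (auto simp: T_ring_simps wstar_elem_def wstar_mat_def Let_def)

lemma tm_of_wstar: "tm_of (wstar_elem f M) = levels.v level_poly"
proof (rule tm_eqI)
  interpret levels level_poly by (rule levels_level_poly)
  fix n i j :: nat assume ij: "i < n" "j < n"
  have up: "(\<Sum>k\<in>{1..<n}. e_unit k (k + 1) (Suc i) (Suc j) :: 'a) = (if j = Suc i then 1 else 0)"
  proof -
    have "(\<Sum>k\<in>{1..<n}. e_unit k (k + 1) (Suc i) (Suc j) :: 'a) = (\<Sum>k\<in>{1..<n}. if k = Suc i then if j = Suc i then 1 else 0 else 0)"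
      by (rule sum.cong) (auto simp: e_unit_def)
    then show ?thesis using ij by auto
  qed
  show "entry (tm_of (wstar_elem f M)) n i j = entry v n i j"
  proof (cases "n < M 1")
    case True
    then have "coeff (level_poly n) (Suc m) = 0" for m by (simp add: level_poly_def coeff_eq_0)
    moreover obtain m where "n - j = Suc m" using ij by (metis Suc_diff_Suc)
    ultimately show ?thesis
      using True ij up by (simp add: entry_tm_of wstar_elem_def wstar_mat_def v_def)
  next
    case False
    let ?N = "N_deg f (wstar_level M n)" and ?c = "coeff (partial_prod f (wstar_level M n))"
    have lp: "level_poly n = partial_prod f (wstar_level M n)" using False by (simp add: level_poly_def)
    \<comment> \<open>This keeps the truncated subtraction n - m exact, so that m = n - j is the
      only summand to meet column j of the last row.\<close>
    then have N: "2 * ?N < n" using degree_bound[of n] ij by (simp add: N_deg_def)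
    have high: "?c m = 0" if "?N < m" for m using that by (intro coeff_eq_0) (simp add: N_deg_def)
    have "(\<Sum>m\<in>{1..?N}. ?c m * (e_unit m 1 (Suc i) (Suc j) + e_unit n (n - m + 1) (Suc i) (Suc j)))
       = (\<Sum>m\<in>{1..?N}. if m = Suc i then if j = 0 then ?c (Suc i) else 0 else 0)
         + (\<Sum>m\<in>{1..?N}. if m = n - j then if Suc i = n then ?c (n - j) else 0 else 0)"
      unfolding sum.distrib[symmetric] using N ij by (intro sum.cong) (auto simp: e_unit_def distrib_left)
    also have "\<dots> = (if j = 0 then ?c (Suc i) else 0) + (if Suc i = n then ?c (n - j) else 0)"
      using high[of "Suc i"] high[of "n - j"] ij by (auto simp: not_le)
    finally show ?thesis
      using False ij up lp by (simp add: entry_tm_of wstar_elem_def wstar_mat_def v_def Let_def)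
  qed
qed

lemma alg_ring_R_algebra: "alg_ring level_poly (R_algebra f M) tm_of"
proof -
  interpret levels level_poly by (rule levels_level_poly)
  show ?thesis
    unfolding R_algebra_def T_generated_subalgebra_eq[OF wstar_elem_carrier tm_of_wstar]
    by (rule alg_ring_of_carrier)
qed

end

theorem theorem5p5:
  fixes f :: "nat \<Rightarrow> 'a::field poly" and M :: "nat \<Rightarrow> nat"
  assumes "countable (UNIV :: 'a set)"
    and "bij_betw f UNIV Sigma_polys" and "f 0 = 1"
    and "\<forall>k\<ge>1. 0 < M k" and "\<forall>k\<ge>1. M k < M (k + 1)"
    and "\<forall>k\<ge>1. 2 * (k + 1) * N_deg f k \<le> M k"
  shows "von_neumann_regular (R_algebra f M) \<and> V_monoid (R_algebra f M) \<cong> M_monoid"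
proof -
  interpret alg_ring "level_poly f M" "R_algebra f M" tm_of
    by (rule alg_ring_R_algebra[OF assms(2,3,5,6)])
  show ?thesis
    unfolding von_neumann_regular_def using ring_axioms R_regular V_monoid_alg by blast
qed

end
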